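(* Let $K\subset\mathbb{R}^3$ be a generic knot and let $(\overline{s}_1,\overline{s}_2)$ be any $\overline{s}_2$-special pair. Put $\widehat N_{K,0}:=N_{K,0}|_{\pi_{s_1}^{-1}(\overline{s}_1-\delta_K,\overline{s}_1+\delta_K)}$. Then the base projection $\pi_{s_1}:\widehat N_{K,0}\to(\overline{s}_1-\delta_K,\overline{s}_1+\delta_K)$ is a broken fibration with exactly two critical points. In more detail, in coordinates $(s_1,s_2,\theta_2)$ the critical points are $(\overline{s}_1,\overline{s}_2,\pm\pi/2)$, they lie in the real boundary of $N_{K,0}$ and are of Morse index $1$. The analogous statement (with the roles of the indices $1$ and $2$ exchanged) also holds for $\overline{s}_1$-special pairs.
   Context: $K\subset\mathbb{R}^3$ is a smooth knot of length $T$ with arc-length parametrization $\gamma:\mathbb{R}/T\mathbb{Z}\to\mathbb{R}^3$; $n=\ddot\gamma/\|\ddot\gamma\|$, $b=\dot\gamma\times n$, $v(s,\theta)=\cos(\theta)n(s)+\sin(\theta)b(s)$. A pair $(s_1,s_2)$, $s_1\neq s_2$, is $s_i$-special if the tangent line of $K$ at $\gamma(s_i)$ passes through the other point $\gamma(s_j)$. $K$ is generic if its curvature vanishes nowhere, there are finitely many special pairs, for an $s_i$-special pair the tangent line at $\gamma(s_j)$ ($j\neq i$) does not lie in the osculating plane at $\gamma(s_i)$, and no two distinct points of $K$ have the same tangent line. $\delta_K>0$ is a fixed sufficiently small constant such that the closed squares of half-side $\delta_K$ around special pairs and the set $\{\widetilde d(s_1,s_2)\le\delta_K\}$ ($\widetilde{d}$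 the flat distance) are pairwise disjoint. For an $\overline s_2$-special pair let $W=[\overline s_1-\delta_K,\overline s_1+\delta_K]\times[\overline s_2-\delta_K,\overline s_2+\delta_K]$ and $$N_{K,0}=\{(s_1,s_2,\theta_2): (s_1,s_2)\in W,\ \langle\gamma(s_2)-\gamma(s_1),v(s_2,\theta_2)\rangle\ge0\},$$ a compact $3$-manifold with corners, stratified by which of the defining constraints ($\langle\gamma(s_2)-\gamma(s_1),v(s_2,\theta_2)\rangle\geq 0$, $s_1$ in its interval, $s_2$ in its interval) are boundary equalities. The real boundary consists of points where $\langle\gamma(s_2)-\gamma(s_1),v(s_2,\theta_2)\rangle=0$ and $(s_1,s_2)$ is in the interior of $W$; the fake boundary consists of the points with $(s_1,s_2)\in\partial W$. Let $M$ be a manifold with corners and $f:M\to\mathbb{R}$ smooth. A point $p$ is critical if $df(p)$ vanishes on the tangent space of the stratum containing $p$. $f$ is Morse if (i) $f$ is proper, (ii) for each stratum $\mathcal Q$ the critical points of $f|_{\mathcal Q}$ are nondegenerate, (iii) if $p\in\mathcal Q$ is critical, then $df(p)|_V\ne0$ for every limit $V=\lim T_{p_j}\mathcal M$ with $p_j\to p$ in a stratum $\mathcal M$ higher than $\mathcal Q$. The Morse index of a critical point is that of $f$ restricted to its stratum. If $f$ is Morse and surjective onto an interval $I$, then $f:f^{-1}(I)\to I$ is called a broken fibration (properness being understood as a map to $I$). *)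

theory Defs
  imports "HOL-Analysis.Analysis" "HOL-Library.Real_Mod"
begin

section \<open>Smooth maps between open subsets of Euclidean spaces\<close>

primrec Ck_on :: "nat \<Rightarrow> ('a::euclidean_space \<Rightarrow> 'b::real_normed_vector) \<Rightarrow> 'a set \<Rightarrow> bool" where
  "Ck_on 0 f S \<longleftrightarrow> continuous_on S f"
| "Ck_on (Suc k) f S \<longleftrightarrow>
     f differentiable_on S \<and> (\<forall>e\<in>Basis. Ck_on k (\<lambda>x. frechet_derivative f (at x) e) S)"

definition smooth_on :: "('a::euclidean_space \<Rightarrow> 'b::real_normed_vector) \<Rightarrow> 'a set \<Rightarrow> bool" where
  "smooth_on f S \<longleftrightarrow> open S \<and> (\<forall>k. Ck_on k f S)"


section \<open>Stratified manifolds with corners inside a Euclidean space\<close>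

text \<open>
  A stratification of \<open>M\<close> is given by a labelling \<open>\<sigma>\<close>; the strata are its level sets in \<open>M\<close>.
\<close>

definition stratum :: "'a set \<Rightarrow> ('a \<Rightarrow> 'l) \<Rightarrow> 'a \<Rightarrow> 'a set" where
  "stratum M \<sigma> p = {x \<in> M. \<sigma> x = \<sigma> p}"

text \<open>
  An adapted chart at \<open>p\<close>: a diffeomorphism \<open>\<Phi>\<close> (inverse \<open>\<Psi>\<close>) of open sets of the ambient space that
  straightens \<open>M\<close> to the corner \<open>{y \<in> span D. \<forall>e\<in>C. 0 \<le> y \<bullet> e}\<close>, \<open>C \<subseteq> D \<subseteq> Basis\<close>, with \<open>p\<close> at its
  apex.  The strata met by the chart domain correspond to the open faces of that corner.
\<close>

definition corner_chart ::
  "'a::euclidean_space set \<Rightarrow> ('a \<Rightarrow> 'l) \<Rightarrow> 'a \<Rightarrow> 'a set \<Rightarrow> 'a set \<Rightarrow> ('a \<Rightarrow> 'a) \<Rightarrow> ('a \<Rightarrow> 'a)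
     \<Rightarrow> 'a set \<Rightarrow> 'a set \<Rightarrow> bool" where
  "corner_chart M \<sigma> p U V \<Phi> \<Psi> D C \<longleftrightarrow>
     p \<in> U \<and> smooth_on \<Phi> U \<and> smooth_on \<Psi> V \<and> homeomorphism U V \<Phi> \<Psi> \<and> \<Phi> p = 0 \<and>
     C \<subseteq> D \<and> D \<subseteq> Basis \<and>
     \<Phi> ` (M \<inter> U) = {y \<in> V. (\<forall>e\<in>Basis - D. y \<bullet> e = 0) \<and> (\<forall>e\<in>C. 0 \<le> y \<bullet> e)} \<and>
     (\<forall>x\<in>M \<inter> U. \<forall>x'\<in>M \<inter> U.
        \<sigma> x = \<sigma> x' \<longleftrightarrow> (\<forall>e\<in>C. \<Phi> x \<bullet> e = 0 \<longleftrightarrow> \<Phi> x' \<bullet> e = 0))"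

definition manifold_with_corners :: "nat \<Rightarrow> 'a::euclidean_space set \<Rightarrow> ('a \<Rightarrow> 'l) \<Rightarrow> bool" where
  "manifold_with_corners k M \<sigma> \<longleftrightarrow>
     (\<forall>p\<in>M. \<exists>U V \<Phi> \<Psi> D C. corner_chart M \<sigma> p U V \<Phi> \<Psi> D C \<and> card D = k)"

text \<open>A chart of a submanifold without boundary, such as a single stratum, is the case \<open>C = {}\<close>.\<close>

definition submanifold_chart ::
  "'a::euclidean_space set \<Rightarrow> 'a \<Rightarrow> 'a set \<Rightarrow> 'a set \<Rightarrow> ('a \<Rightarrow> 'a) \<Rightarrow> ('a \<Rightarrow> 'a) \<Rightarrow> 'a set \<Rightarrow> bool" where
  "submanifold_chart Q p U V \<Phi> \<Psi> D \<longleftrightarrow> corner_chart Q (\<lambda>_. ()) p U V \<Phi> \<Psi> D {}"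

definition tangent_space :: "'a::euclidean_space set \<Rightarrow> 'a \<Rightarrow> 'a set" where
  "tangent_space Q p = {v. \<exists>c \<epsilon>. \<epsilon> > 0 \<and> smooth_on c {-\<epsilon><..<\<epsilon>} \<and> c ` {-\<epsilon><..<\<epsilon>} \<subseteq> Q \<and>
                             c (0::real) = p \<and> (c has_vector_derivative v) (at 0)}"

text \<open>Convergence in the Grassmannian, i.e. convergence of the orthogonal projections.\<close>

definition subspace_limit :: "(nat \<Rightarrow> 'a::euclidean_space set) \<Rightarrow> 'a set \<Rightarrow> bool" where
  "subspace_limit Vs V \<longleftrightarrow>
     subspace V \<and> (\<forall>x. (\<lambda>j. closest_point (Vs j) x) \<longlonglongrightarrow> closest_point V x)"


section \<open>Morse functions and broken fibrations\<close>

definition critical_point ::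
  "'a::euclidean_space set \<Rightarrow> ('a \<Rightarrow> 'l) \<Rightarrow> ('a \<Rightarrow> real) \<Rightarrow> 'a \<Rightarrow> bool" where
  "critical_point M \<sigma> f p \<longleftrightarrow>
     p \<in> M \<and> (\<forall>v\<in>tangent_space (stratum M \<sigma> p) p. frechet_derivative f (at p) v = 0)"

definition hessian ::
  "('a::euclidean_space \<Rightarrow> real) \<Rightarrow> 'a \<Rightarrow> 'a \<Rightarrow> 'a \<Rightarrow> real" where
  "hessian h y u w = frechet_derivative (\<lambda>x. frechet_derivative h (at x) u) (at y) w"

text \<open>
  The next two predicates are meant for critical points of \<open>f\<close> restricted to \<open>Q\<close>, where they do not
  depend on the chart.
\<close>

definition nondegenerate_at ::
  "('a::euclidean_space \<Rightarrow> real) \<Rightarrow> 'a set \<Rightarrow> 'a \<Rightarrow> bool" where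
  "nondegenerate_at f Q p \<longleftrightarrow>
     (\<exists>U V \<Phi> \<Psi> D. submanifold_chart Q p U V \<Phi> \<Psi> D \<and>
        (\<forall>u\<in>span D. (\<forall>w\<in>span D. hessian (f \<circ> \<Psi>) 0 u w = 0) \<longrightarrow> u = 0))"

definition has_morse_index ::
  "('a::euclidean_space \<Rightarrow> real) \<Rightarrow> 'a set \<Rightarrow> 'a \<Rightarrow> nat \<Rightarrow> bool" where
  "has_morse_index f Q p m \<longleftrightarrow>
     (\<exists>U V \<Phi> \<Psi> D. submanifold_chart Q p U V \<Phi> \<Psi> D \<and>
        m = Max {dim S | S. subspace S \<and> S \<subseteq> span D \<and>
                            (\<forall>u\<in>S - {0}. hessian (f \<circ> \<Psi>) 0 u u < 0)})"

text \<open>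
  Properness is properness as a map to \<open>I\<close>; an ordinary Morse function is the case \<open>I = UNIV\<close>.
  Smoothness of \<open>f\<close> on \<open>M\<close> means that \<open>f\<close> is smooth on an open neighbourhood of \<open>M\<close> in the ambient
  space.
\<close>

definition morse ::
  "'a::euclidean_space set \<Rightarrow> ('a \<Rightarrow> 'l) \<Rightarrow> ('a \<Rightarrow> real) \<Rightarrow> real set \<Rightarrow> bool" where
  "morse M \<sigma> f I \<longleftrightarrow>
     (\<exists>U. M \<subseteq> U \<and> smooth_on f U) \<and>
     proper_map (top_of_set M) (top_of_set I) f \<and>
     (\<forall>p. critical_point M \<sigma> f p \<longrightarrow> nondegenerate_at f (stratum M \<sigma> p) p) \<and>
     (\<forall>p X V. critical_point M \<sigma> f p \<and>
        (\<forall>j. X j \<in> stratum M \<sigma> (X 0)) \<and> X \<longlonglongrightarrow> p \<and>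
        (\<forall>j. dim (tangent_space (stratum M \<sigma> p) p) < dim (tangent_space (stratum M \<sigma> (X j)) (X j))) \<and>
        subspace_limit (\<lambda>j. tangent_space (stratum M \<sigma> (X j)) (X j)) V
        \<longrightarrow> (\<exists>v\<in>V. frechet_derivative f (at p) v \<noteq> 0))"

definition broken_fibration ::
  "nat \<Rightarrow> 'a::euclidean_space set \<Rightarrow> ('a \<Rightarrow> 'l) \<Rightarrow> ('a \<Rightarrow> real) \<Rightarrow> real set \<Rightarrow> bool" where
  "broken_fibration k M \<sigma> f I \<longleftrightarrow>
     manifold_with_corners k M \<sigma> \<and> is_interval I \<and> f ` M = I \<and> morse M \<sigma> f I"


section \<open>Generic knots\<close>

text \<open>Maps on \<open>\<real>/T\<int>\<close> are represented by \<open>T\<close>-periodic maps on \<open>\<real>\<close>.\<close>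

definition velocity :: "(real \<Rightarrow> real^3) \<Rightarrow> real \<Rightarrow> real^3" where
  "velocity \<gamma> s = vector_derivative \<gamma> (at s)"

definition acceleration :: "(real \<Rightarrow> real^3) \<Rightarrow> real \<Rightarrow> real^3" where
  "acceleration \<gamma> s = vector_derivative (velocity \<gamma>) (at s)"

definition smooth_knot :: "real \<Rightarrow> (real \<Rightarrow> real^3) \<Rightarrow> bool" where
  "smooth_knot T \<gamma> \<longleftrightarrow>
     T > 0 \<and> smooth_on \<gamma> UNIV \<and>
     (\<forall>s t. \<gamma> s = \<gamma> t \<longleftrightarrow> [s = t] (rmod T)) \<and>
     (\<forall>s. norm (velocity \<gamma> s) = 1)"

definition principal_normal :: "(real \<Rightarrow> real^3) \<Rightarrow> real \<Rightarrow> real^3" where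
  "principal_normal \<gamma> s = acceleration \<gamma> s /\<^sub>R norm (acceleration \<gamma> s)"

definition binormal :: "(real \<Rightarrow> real^3) \<Rightarrow> real \<Rightarrow> real^3" where
  "binormal \<gamma> s = cross3 (velocity \<gamma> s) (principal_normal \<gamma> s)"

definition tangent_line :: "(real \<Rightarrow> real^3) \<Rightarrow> real \<Rightarrow> (real^3) set" where
  "tangent_line \<gamma> s = {\<gamma> s + x *\<^sub>R velocity \<gamma> s | x. True}"

definition osculating_plane :: "(real \<Rightarrow> real^3) \<Rightarrow> real \<Rightarrow> (real^3) set" where
  "osculating_plane \<gamma> s = {\<gamma> s + x *\<^sub>R velocity \<gamma> s + y *\<^sub>R acceleration \<gamma> s | x y. True}"

text \<open>
  \<open>tangent_hits T \<gamma> s t\<close>: the tangent line at \<open>\<gamma> s\<close> passes through the other point \<open>\<gamma> t\<close>.  Thus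
  \<open>(s1, s2)\<close> is \<open>s1\<close>-special iff \<open>tangent_hits T \<gamma> s1 s2\<close>, and \<open>s2\<close>-special iff
  \<open>tangent_hits T \<gamma> s2 s1\<close>.
\<close>

definition tangent_hits :: "real \<Rightarrow> (real \<Rightarrow> real^3) \<Rightarrow> real \<Rightarrow> real \<Rightarrow> bool" where
  "tangent_hits T \<gamma> s t \<longleftrightarrow> \<not> [s = t] (rmod T) \<and> \<gamma> t \<in> tangent_line \<gamma> s"

definition special1 :: "real \<Rightarrow> (real \<Rightarrow> real^3) \<Rightarrow> real \<Rightarrow> real \<Rightarrow> bool" where
  "special1 T \<gamma> s1 s2 \<longleftrightarrow> tangent_hits T \<gamma> s1 s2"

definition special2 :: "real \<Rightarrow> (real \<Rightarrow> real^3) \<Rightarrow> real \<Rightarrow> real \<Rightarrow> bool" where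
  "special2 T \<gamma> s1 s2 \<longleftrightarrow> tangent_hits T \<gamma> s2 s1"

text \<open>Special pairs in \<open>(\<real>/T\<int>)\<^sup>2\<close>, each given by its representative in the fundamental square.\<close>

definition special_pairs :: "real \<Rightarrow> (real \<Rightarrow> real^3) \<Rightarrow> (real \<times> real) set" where
  "special_pairs T \<gamma> = {(s1, s2). s1 \<in> {0..<T} \<and> s2 \<in> {0..<T} \<and>
                                  (special1 T \<gamma> s1 s2 \<or> special2 T \<gamma> s1 s2)}"

definition generic_knot :: "real \<Rightarrow> (real \<Rightarrow> real^3) \<Rightarrow> bool" where
  "generic_knot T \<gamma> \<longleftrightarrow>
     smooth_knot T \<gamma> \<and>
     (\<forall>s. acceleration \<gamma> s \<noteq> 0) \<and>
     finite (special_pairs T \<gamma>) \<and>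
     (\<forall>s t. tangent_hits T \<gamma> s t \<longrightarrow> \<not> tangent_line \<gamma> t \<subseteq> osculating_plane \<gamma> s) \<and>
     (\<forall>s t. \<not> [s = t] (rmod T) \<longrightarrow> tangent_line \<gamma> s \<noteq> tangent_line \<gamma> t)"

text \<open>The flat distance on \<open>\<real>/T\<int>\<close>.\<close>

definition flat_dist :: "real \<Rightarrow> real \<Rightarrow> real \<Rightarrow> real" where
  "flat_dist T s t = (INF k::int. \<bar>s - t + of_int k * T\<bar>)"

text \<open>The closed square of half-side \<open>\<delta>\<close> in \<open>(\<real>/T\<int>)\<^sup>2\<close>, as a \<open>T\<int>\<^sup>2\<close>-periodic subset of \<open>\<real>\<^sup>2\<close>.\<close>

definition flat_square :: "real \<Rightarrow> real \<Rightarrow> real \<times> real \<Rightarrow> (real \<times> real) set" where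
  "flat_square T \<delta> p = {(s1, s2). flat_dist T s1 (fst p) \<le> \<delta> \<and> flat_dist T s2 (snd p) \<le> \<delta>}"

definition admissible_delta :: "real \<Rightarrow> (real \<Rightarrow> real^3) \<Rightarrow> real \<Rightarrow> bool" where
  "admissible_delta T \<gamma> \<delta> \<longleftrightarrow>
     \<delta> > 0 \<and>
     disjoint_family_on (flat_square T \<delta>) (special_pairs T \<gamma>) \<and>
     (\<forall>p\<in>special_pairs T \<gamma>. flat_square T \<delta> p \<inter> {(s1, s2). flat_dist T s1 s2 \<le> \<delta>} = {})"


section \<open>The manifold \<open>N\<^sub>K\<^sub>,\<^sub>0\<close> near a special pair\<close>

text \<open>
  The angle \<open>\<theta> \<in> \<real>/2\<pi>\<int>\<close> is represented by \<open>z = cis \<theta>\<close> on the unit circle, so that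
  \<open>normal_vector \<gamma> s (cis \<theta>) = cos \<theta> n(s) + sin \<theta> b(s)\<close>.  The ambient Euclidean space is
  \<open>\<real> \<times> \<real> \<times> \<complex>\<close>.  As the half-side \<open>\<delta>\<close> is less than \<open>T / 2\<close> for an admissible \<open>\<delta>\<close>, the square around a
  special pair may be taken in \<open>\<real>\<^sup>2\<close>, around any lift \<open>(a1, a2)\<close> of the pair.
\<close>

definition normal_vector :: "(real \<Rightarrow> real^3) \<Rightarrow> real \<Rightarrow> complex \<Rightarrow> real^3" where
  "normal_vector \<gamma> s z = Re z *\<^sub>R principal_normal \<gamma> s + Im z *\<^sub>R binormal \<gamma> s"

text \<open>The constraint function for \<open>s2\<close>-special pairs, and the one with the indices exchanged.\<close>

definition height2 :: "(real \<Rightarrow> real^3) \<Rightarrow> real \<times> real \<times> complex \<Rightarrow> real" where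
  "height2 \<gamma> = (\<lambda>(s1, s2, z). (\<gamma> s2 - \<gamma> s1) \<bullet> normal_vector \<gamma> s2 z)"

definition height1 :: "(real \<Rightarrow> real^3) \<Rightarrow> real \<times> real \<times> complex \<Rightarrow> real" where
  "height1 \<gamma> = (\<lambda>(s1, s2, z). (\<gamma> s1 - \<gamma> s2) \<bullet> normal_vector \<gamma> s1 z)"

definition square :: "real \<Rightarrow> real \<Rightarrow> real \<Rightarrow> (real \<times> real) set" where
  "square \<delta> a1 a2 = {a1 - \<delta>..a1 + \<delta>} \<times> {a2 - \<delta>..a2 + \<delta>}"

definition N0 ::
  "(real \<times> real \<times> complex \<Rightarrow> real) \<Rightarrow> real \<Rightarrow> real \<Rightarrow> real \<Rightarrow> (real \<times> real \<times> complex) set" where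
  "N0 g \<delta> a1 a2 = {(s1, s2, z). norm z = 1 \<and> (s1, s2) \<in> square \<delta> a1 a2 \<and> g (s1, s2, z) \<ge> 0}"

text \<open>Stratification by the set of constraints that hold with boundary equality.\<close>

definition N0_label ::
  "(real \<times> real \<times> complex \<Rightarrow> real) \<Rightarrow> real \<Rightarrow> real \<Rightarrow> real \<Rightarrow> real \<times> real \<times> complex
     \<Rightarrow> bool \<times> bool \<times> bool" where
  "N0_label g \<delta> a1 a2 =
     (\<lambda>(s1, s2, z). (g (s1, s2, z) = 0, s1 \<in> {a1 - \<delta>, a1 + \<delta>}, s2 \<in> {a2 - \<delta>, a2 + \<delta>}))"

definition real_boundary ::
  "(real \<times> real \<times> complex \<Rightarrow> real) \<Rightarrow> real \<Rightarrow> real \<Rightarrow> real \<Rightarrow> (real \<times> real \<times> complex) set" where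
  "real_boundary g \<delta> a1 a2 =
     {(s1, s2, z) \<in> N0 g \<delta> a1 a2. g (s1, s2, z) = 0 \<and> (s1, s2) \<in> interior (square \<delta> a1 a2)}"

definition proj_s1 :: "real \<times> real \<times> complex \<Rightarrow> real" where
  "proj_s1 = (\<lambda>(s1, s2, z). s1)"

definition proj_s2 :: "real \<times> real \<times> complex \<Rightarrow> real" where
  "proj_s2 = (\<lambda>(s1, s2, z). s2)"

end

theory Submission
  imports Defs
begin

text \<open>
  Consider an \<open>s\<^sub>2\<close>-special pair \<open>(a1, a2)\<close>.  The constraint is \<open>\<langle>F (s1, s2), z\<rangle> \<ge> 0\<close>, where \<open>F\<close> is the planar
  vector of the normal and binormal components at \<open>s2\<close> of the chord \<open>\<gamma> s2 - \<gamma> s1\<close>, and \<open>z\<close> is a point of the unit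
  circle.  The zeros of \<open>F\<close> are the pairs for which \<open>\<gamma> s1\<close> is on the tangent line at \<open>\<gamma> s2\<close>; the choice of \<open>\<delta>\<close>
  leaves \<open>(a1, a2)\<close> as the only one in the square (\<open>special_pair_isolated\<close>).  By the Frenet equations the
  differential of \<open>F\<close> there maps the direction of \<open>s2\<close> to a nonzero multiple of the normal, and by genericity it
  maps the direction of \<open>s1\<close> to a vector with nonzero binormal component (\<open>chord_derivatives\<close>).

  Where \<open>F \<noteq> 0\<close>, the fibre of \<open>N\<close> over \<open>(s1, s2)\<close> is a closed half circle whose end points move smoothly with
  \<open>(s1, s2)\<close>.  There \<open>s1\<close> is a coordinate on each stratum and has no critical point.  Over \<open>(a1, a2)\<close> the
  whole circle belongs to the boundary \<open>\<langle>F, z\<rangle> = 0\<close>, which is regular by the form of the differential.  Its tangent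
  space is orthogonal to the direction of \<open>s1\<close> exactly if \<open>z\<close> is orthogonal to the normal, that is for
  \<open>z = \<plusminus>\<i>\<close>.  Near these two points the boundary is the graph of \<open>s1\<close> over \<open>s2\<close> and the angle, and the
  Hessian of this graph at the point has a vanishing entry in the angular direction (\<open>F = 0\<close> there, and the whole circle is in
  the boundary) and a nonzero mixed entry (\<open>fold_hessian\<close>).  It is a saddle, so the index is \<open>1\<close>.  The only
  higher stratum near such a point is the open one, whose tangent spaces contain the direction of \<open>s1\<close>.

  The argument is carried out for an abstract vector field \<open>(A, B)\<close> in the locale \<open>circle_constraint\<close>, which is
  instantiated once for each kind of special pair.  Charts are obtained from systems of defining functions
  with independent differentials by the inverse function theorem; its smooth version requires that the
  inverse of a smooth family of linear maps is smooth.
\<close>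

section \<open>Calculus of smooth maps\<close>

lemma Ck_on_differentiable:
  assumes "open S" "Ck_on (Suc k) f S" "x \<in> S"
  shows "(f has_derivative frechet_derivative f (at x)) (at x)"
proof -
  have "f differentiable (at x)"
    using assms at_within_open[of x S] by (auto simp: differentiable_on_def)
  then show ?thesis
    by (simp add: frechet_derivative_works)
qed

lemma differentiable_onI_has_derivative:
  assumes "\<And>x. x \<in> S \<Longrightarrow> (f has_derivative f' x) (at x)"
  shows "f differentiable_on S"
  unfolding differentiable_on_def
proof
  fix x assume "x \<in> S"
  show "f differentiable (at x within S)"
    by (rule differentiableI[OF has_derivative_at_withinI[OF assms[OF \<open>x \<in> S\<close>]]])
qed

lemma Ck_on_cong_imp:
  assumes "open S" "\<And>x. x \<in> S \<Longrightarrow> f x = g x" "Ck_on k f S"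
  shows "Ck_on k g S"
  using assms(2,3)
proof (induction k arbitrary: f g)
  case 0
  then show ?case using continuous_on_cong[of S S f g] by simp
next
  case (Suc k)
  have diff: "g differentiable_on S"
  proof (rule differentiable_onI_has_derivative)
    fix x assume x: "x \<in> S"
    show "(g has_derivative frechet_derivative f (at x)) (at x)"
      by (rule has_derivative_transform_within_open[OF Ck_on_differentiable[OF assms(1) Suc.prems(2) x]
            assms(1) x]) (rule Suc.prems(1))
  qed
  have eq: "frechet_derivative f (at x) = frechet_derivative g (at x)" if "x \<in> S" for x
  proof (rule frechet_derivative_transform_within_open[of f x S g])
    show "f differentiable at x"
      by (rule differentiableI[OF Ck_on_differentiable[OF assms(1) Suc.prems(2) that]])
  qed (use that assms(1) Suc.prems(1) in auto)
  have "Ck_on k (\<lambda>x. frechet_derivative g (at x) e) S" if "e \<in> Basis" for e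
  proof -
    have "Ck_on k (\<lambda>x. frechet_derivative f (at x) e) S" using Suc.prems(2) that by simp
    from Suc.IH[OF _ this] show ?thesis using eq by simp
  qed
  then show ?case using diff by simp
qed

lemma Ck_on_SucI:
  assumes "open S" "\<And>x. x \<in> S \<Longrightarrow> (f has_derivative f' x) (at x)"
    "\<And>e. e \<in> Basis \<Longrightarrow> Ck_on k (\<lambda>x. f' x e) S"
  shows "Ck_on (Suc k) f S"
proof -
  have "f differentiable_on S"
    by (rule differentiable_onI_has_derivative[OF assms(2)])
  moreover have "Ck_on k (\<lambda>x. frechet_derivative f (at x) e) S" if "e \<in> Basis" for e
  proof (rule Ck_on_cong_imp[OF assms(1) _ assms(3)[OF that]])
    show "f' x e = frechet_derivative f (at x) e" if "x \<in> S" for x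
      using frechet_derivative_at[OF assms(2)[OF that]] by (rule fun_cong)
  qed
  ultimately show ?thesis by simp
qed

lemma Ck_on_continuous: "Ck_on k f S \<Longrightarrow> continuous_on S f"
  by (cases k) (auto intro: differentiable_imp_continuous_on)

lemma Ck_on_Suc_imp: "Ck_on (Suc k) f S \<Longrightarrow> Ck_on k f S"
proof (induction k arbitrary: f)
  case 0
  then show ?case by (auto intro: differentiable_imp_continuous_on)
next
  case (Suc k)
  have "f differentiable_on S" "\<forall>e\<in>Basis. Ck_on (Suc k) (\<lambda>x. frechet_derivative f (at x) e) S"
    using Suc.prems unfolding Ck_on.simps(2)[of "Suc k"] by (rule conjunct1, rule conjunct2)
  then show ?case
    using Suc.IH by (subst Ck_on.simps(2)) blast
qed

lemma Ck_on_subset: "open S \<Longrightarrow> R \<subseteq> S \<Longrightarrow> Ck_on k f S \<Longrightarrow> Ck_on k f R"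
  by (induction k arbitrary: f)
    (auto intro: continuous_on_subset differentiable_on_subset)

lemma Ck_on_const: "Ck_on k (\<lambda>x. c) S"
proof (induction k arbitrary: c)
  case (Suc k)
  then show ?case by simp
qed auto

lemma Ck_on_bounded_linear:
  assumes "open S" "bounded_linear f"
  shows "Ck_on k f S"
proof (cases k)
  case 0
  then show ?thesis using assms by (simp add: linear_continuous_on)
next
  case (Suc j)
  show ?thesis unfolding Suc
    by (rule Ck_on_SucI[where f' = "\<lambda>_. f"])
      (use assms in \<open>auto intro: bounded_linear_imp_has_derivative Ck_on_const\<close>)
qed

lemma Ck_on_add:
  assumes "open S" "Ck_on k f S" "Ck_on k g S"
  shows "Ck_on k (\<lambda>x. f x + g x) S"
  using assms(2,3)
proof (induction k arbitrary: f g)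
  case 0
  then show ?case by (simp add: continuous_on_add)
next
  case (Suc k)
  show ?case
    by (rule Ck_on_SucI[OF assms(1) has_derivative_add[OF Ck_on_differentiable[OF assms(1) Suc.prems(1)]
            Ck_on_differentiable[OF assms(1) Suc.prems(2)]]])
      (use Suc in auto)
qed

lemma (in bounded_bilinear) Ck_on_prod:
  assumes "open S" "Ck_on k f S" "Ck_on k g S"
  shows "Ck_on k (\<lambda>x. prod (f x) (g x)) S"
  using assms(2,3)
proof (induction k arbitrary: f g)
  case 0
  then show ?case by (simp add: continuous_on)
next
  case (Suc k)
  note Suc' = Suc.prems[THEN Ck_on_Suc_imp]
  show ?case
    by (rule Ck_on_SucI[OF assms(1) FDERIV[OF Ck_on_differentiable[OF assms(1) Suc.prems(1)]
            Ck_on_differentiable[OF assms(1) Suc.prems(2)]]])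
      (use Suc Suc' in \<open>auto intro!: Ck_on_add[OF assms(1)]\<close>)
qed

lemma Ck_on_sum:
  assumes "open S" "\<And>i. i \<in> I \<Longrightarrow> Ck_on k (f i) S"
  shows "Ck_on k (\<lambda>x. \<Sum>i\<in>I. f i x) S"
  using assms(2)
  by (induction I rule: infinite_finite_induct)
    (auto intro: Ck_on_const Ck_on_add[OF assms(1)])

lemma linear_expand_Basis:
  fixes f' :: "'a::euclidean_space \<Rightarrow> 'b::real_normed_vector"
  assumes "linear f'"
  shows "f' v = (\<Sum>b\<in>Basis. (v \<bullet> b) *\<^sub>R f' b)"
proof -
  have "f' (\<Sum>b\<in>Basis. (v \<bullet> b) *\<^sub>R b) = (\<Sum>b\<in>Basis. (v \<bullet> b) *\<^sub>R f' b)"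
    by (simp add: linear_sum[OF assms] linear_scale[OF assms])
  then show ?thesis by (simp add: euclidean_representation)
qed

text \<open>
  Expanding the inner derivative in the basis writes the derivative of \<open>f \<circ> g\<close> as a sum of products of
  a derivative of \<open>g\<close> with a composition of a derivative of \<open>f\<close> and \<open>g\<close>; the induction on \<open>k\<close> applies to
  each of them.
\<close>

lemma Ck_on_compose:
  fixes g :: "'a::euclidean_space \<Rightarrow> 'b::euclidean_space"
  assumes "open S" "open R" "Ck_on k f R" "Ck_on k g S" "g ` S \<subseteq> R"
  shows "Ck_on k (\<lambda>x. f (g x)) S"
  using assms(3,4)
proof (induction k arbitrary: f)
  case 0
  then show ?case using assms(5) by (auto intro: continuous_on_compose2)
next
  case (Suc k)
  have fd: "(f has_derivative frechet_derivative f (at y)) (at y)" if "y \<in> R" for y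
    using Ck_on_differentiable[OF assms(2) Suc.prems(1) that] .
  have gd: "(g has_derivative frechet_derivative g (at x)) (at x)" if "x \<in> S" for x
    using Ck_on_differentiable[OF assms(1) Suc.prems(2) that] .
  have "((\<lambda>x. f (g x)) has_derivative
          (\<lambda>v. \<Sum>b\<in>Basis. (frechet_derivative g (at x) v \<bullet> b) *\<^sub>R frechet_derivative f (at (g x)) b)) (at x)"
    if "x \<in> S" for x
  proof -
    have "g x \<in> R" using that assms(5) by auto
    then show ?thesis
      using has_derivative_compose[OF gd[OF that] fd]
        linear_expand_Basis[OF has_derivative_linear[OF fd]]
      by (metis (no_types, lifting) ext)
  qed
  then show ?case
  proof (rule Ck_on_SucI[OF assms(1)])
    fix e :: 'a assume e: "e \<in> Basis"
    show "Ck_on k (\<lambda>x. \<Sum>b\<in>Basis. (frechet_derivative g (at x) e \<bullet> b) *\<^sub>R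
            frechet_derivative f (at (g x)) b) S"
    proof (intro Ck_on_sum[OF assms(1)] bounded_bilinear.Ck_on_prod[OF bounded_bilinear_scaleR assms(1)]
        bounded_bilinear.Ck_on_prod[OF bounded_bilinear_inner assms(1)] Ck_on_const)
      fix b :: 'b assume "b \<in> Basis"
      then show "Ck_on k (\<lambda>x. frechet_derivative f (at (g x)) b) S"
        using Suc.prems Ck_on_Suc_imp[OF Suc.prems(2)] by (auto intro: Suc.IH)
    qed (use Suc.prems e in auto)
  qed
qed

lemma smooth_on_open: "smooth_on f S \<Longrightarrow> open S"
  by (simp add: smooth_on_def)

lemma smooth_on_cong: "smooth_on f S \<Longrightarrow> (\<And>x. x \<in> S \<Longrightarrow> f x = g x) \<Longrightarrow> smooth_on g S"
  unfolding smooth_on_def using Ck_on_cong_imp[of S f g] by blast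

lemma smooth_on_subset: "smooth_on f S \<Longrightarrow> open R \<Longrightarrow> R \<subseteq> S \<Longrightarrow> smooth_on f R"
  unfolding smooth_on_def using Ck_on_subset by blast

lemma smooth_on_continuous: "smooth_on f S \<Longrightarrow> continuous_on S f"
  unfolding smooth_on_def using Ck_on_continuous by blast

lemma smooth_on_has_derivative:
  "smooth_on f S \<Longrightarrow> x \<in> S \<Longrightarrow> (f has_derivative frechet_derivative f (at x)) (at x)"
  unfolding smooth_on_def using Ck_on_differentiable by blast

lemma smooth_on_const: "open S \<Longrightarrow> smooth_on (\<lambda>x. c) S"
  by (simp add: smooth_on_def Ck_on_const)

lemma smooth_on_bounded_linear: "open S \<Longrightarrow> bounded_linear f \<Longrightarrow> smooth_on f S"
  by (simp add: smooth_on_def Ck_on_bounded_linear)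

lemma smooth_on_add: "smooth_on f S \<Longrightarrow> smooth_on g S \<Longrightarrow> smooth_on (\<lambda>x. f x + g x) S"
  by (simp add: smooth_on_def Ck_on_add)

lemma (in bounded_bilinear) smooth_on_prod:
  "smooth_on f S \<Longrightarrow> smooth_on g S \<Longrightarrow> smooth_on (\<lambda>x. prod (f x) (g x)) S"
  by (simp add: smooth_on_def Ck_on_prod)

lemmas smooth_on_scaleR = bounded_bilinear.smooth_on_prod[OF bounded_bilinear_scaleR]
  and smooth_on_inner = bounded_bilinear.smooth_on_prod[OF bounded_bilinear_inner]
  and smooth_on_mult = bounded_bilinear.smooth_on_prod[OF bounded_bilinear_mult]

lemma smooth_on_diff:
  assumes "smooth_on f S" "smooth_on g S"
  shows "smooth_on (\<lambda>x. f x - g x) S"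
  using smooth_on_add[OF assms(1) smooth_on_scaleR[OF smooth_on_const[of S "-1"] assms(2)]]
    smooth_on_open[OF assms(1)] by simp

lemma smooth_on_power2:
  fixes f :: "'a::euclidean_space \<Rightarrow> real"
  shows "smooth_on f S \<Longrightarrow> smooth_on (\<lambda>x. (f x)\<^sup>2) S"
  using smooth_on_mult[of f S f] by (simp add: power2_eq_square)

lemma smooth_on_compose:
  fixes g :: "'a::euclidean_space \<Rightarrow> 'b::euclidean_space"
  shows "smooth_on f R \<Longrightarrow> smooth_on g S \<Longrightarrow> g ` S \<subseteq> R \<Longrightarrow> smooth_on (\<lambda>x. f (g x)) S"
  unfolding smooth_on_def using Ck_on_compose by blast

lemma smooth_on_Pair:
  fixes f :: "'a::euclidean_space \<Rightarrow> 'b::euclidean_space" and g :: "'a \<Rightarrow> 'c::euclidean_space"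
  assumes "smooth_on f S" "smooth_on g S"
  shows "smooth_on (\<lambda>x. (f x, g x)) S"
proof -
  have "smooth_on (\<lambda>x. (f x, 0) + (0, g x)) S"
    by (intro smooth_on_add smooth_on_compose[OF smooth_on_bounded_linear[OF open_UNIV], of "\<lambda>y. (y, 0)"]
        smooth_on_compose[OF smooth_on_bounded_linear[OF open_UNIV], of "\<lambda>y. (0, y)"] assms
        bounded_linear_Pair bounded_linear_ident bounded_linear_zero subset_UNIV)
  then show ?thesis by simp
qed

lemma smooth_on_frechet_derivative:
  fixes f :: "'a::euclidean_space \<Rightarrow> 'b::real_normed_vector"
  assumes "smooth_on f S"
  shows "smooth_on (\<lambda>x. frechet_derivative f (at x) u) S"
proof -
  have o: "open S" using assms by (rule smooth_on_open)
  have b: "smooth_on (\<lambda>x. frechet_derivative f (at x) e) S" if "e \<in> Basis" for e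
    unfolding smooth_on_def
  proof (intro conjI allI o)
    fix k
    have "Ck_on (Suc k) f S" using assms by (auto simp: smooth_on_def simp del: Ck_on.simps)
    then show "Ck_on k (\<lambda>x. frechet_derivative f (at x) e) S" using that by simp
  qed
  have "smooth_on (\<lambda>x. \<Sum>e\<in>Basis. (u \<bullet> e) *\<^sub>R frechet_derivative f (at x) e) S"
    unfolding smooth_on_def
    by (intro conjI allI o Ck_on_sum bounded_bilinear.Ck_on_prod[OF bounded_bilinear_scaleR] Ck_on_const)
      (use b in \<open>simp add: smooth_on_def\<close>)
  then show ?thesis
    by (rule smooth_on_cong)
      (metis assms linear_expand_Basis has_derivative_linear smooth_on_has_derivative)
qed

lemma smooth_on_powr: "smooth_on (\<lambda>x::real. x powr c) {0<..}"
  unfolding smooth_on_def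
proof (intro conjI allI)
  fix k show "Ck_on k (\<lambda>x::real. x powr c) {0<..}"
  proof (induction k arbitrary: c)
    case 0
    then show ?case by (auto intro!: continuous_intros)
  next
    case (Suc k)
    show ?case
    proof (rule Ck_on_SucI)
      show "((\<lambda>x. x powr c) has_derivative (\<lambda>h. c * x powr (c - 1) * h)) (at x)" if "x \<in> {0<..}" for x
        using has_real_derivative_powr[of x c] that by (simp add: has_field_derivative_def)
      show "Ck_on k (\<lambda>x. c * x powr (c - 1) * e) {0<..}" for e
        using Suc[of "c - 1"]
        by (intro bounded_bilinear.Ck_on_prod[OF bounded_bilinear_mult] Ck_on_const) auto
    qed auto
  qed
qed auto

section \<open>Inverse function theorem for smooth maps\<close>

lemma linear_two_sided_inverse:
  assumes "linear A" "\<And>v. A (B v) = v" "\<And>v. B (A v) = v"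
  shows "linear B"
proof (rule linearI)
  show "B (a + b) = B a + B b" for a b
    by (metis assms linear_add)
  show "B (c *\<^sub>R a) = c *\<^sub>R B a" for a c
    by (metis assms linear_scale)
qed

text \<open>
  The local bound on \<open>B y\<close> comes from \<open>norm (A y v) \<ge> norm (A y0 v) - norm ((A y - A y0) v)\<close>; the
  resolvent identity \<open>B y - B y0 = - B y0 (A y - A y0) B y\<close> then gives continuity.
\<close>

lemma inverse_family_continuous:
  fixes A B :: "'a::euclidean_space \<Rightarrow> 'b::euclidean_space \<Rightarrow> 'b"
  assumes V: "open V" and lin: "\<And>y. y \<in> V \<Longrightarrow> linear (A y)"
    and inv: "\<And>y v. y \<in> V \<Longrightarrow> A y (B y v) = v"
    and left: "\<And>y v. y \<in> V \<Longrightarrow> B y (A y v) = v"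
    and cont: "\<And>v. continuous_on V (\<lambda>y. A y v)"
  shows "continuous_on V (\<lambda>y. B y u)"
proof (rule continuous_at_imp_continuous_on, intro ballI)
  fix y0 assume y0: "y0 \<in> V"
  have linB: "linear (B y)" if "y \<in> V" for y
    by (rule linear_two_sided_inverse[OF lin[OF that]]) (simp_all add: inv left that)
  obtain K where K: "K > 0" "\<And>v. norm (B y0 v) \<le> K * norm v"
    using linear_bounded_pos[OF linB[OF y0]] by (metis mult.commute)
  let ?s = "\<lambda>y. \<Sum>b\<in>Basis. norm (A y b - A y0 b)"
  have Alim: "((\<lambda>y. A y v) \<longlongrightarrow> A y0 v) (at y0)" for v
    using cont[of v] y0 V by (simp add: continuous_on_eq_continuous_at isCont_def)
  have s0: "(?s \<longlongrightarrow> 0) (at y0)"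
    using tendsto_sum[of Basis "\<lambda>b y. norm (A y b - A y0 b)" "\<lambda>_. 0" "at y0"]
      tendsto_norm_zero[OF LIM_zero[OF Alim]] by simp
  have est: "norm (A y v - A y0 v) \<le> ?s y * norm v" if "y \<in> V" for y v
  proof -
    have "A y v - A y0 v = (\<Sum>b\<in>Basis. (v \<bullet> b) *\<^sub>R (A y b - A y0 b))"
      using linear_expand_Basis[OF lin[OF that], of v]
        linear_expand_Basis[OF lin[OF y0], of v]
      by (simp add: scaleR_diff_right sum_subtractf)
    also have "norm \<dots> \<le> (\<Sum>b\<in>Basis. norm v * norm (A y b - A y0 b))"
      by (rule sum_norm_le) (auto intro!: mult_right_mono Basis_le_norm)
    finally show ?thesis by (simp add: sum_distrib_left mult.commute)
  qed
  have ev: "\<forall>\<^sub>F y in at y0. y \<in> V \<and> ?s y < 1 / (2 * K)"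
    using eventually_conj[OF topological_tendstoD[OF tendsto_ident_at V y0, of UNIV] order_tendstoD(2)[OF s0, of "1 / (2 * K)"]] K(1)
    by auto
  have bd: "norm (B y u) \<le> 2 * K * norm u" if "y \<in> V" "?s y < 1 / (2 * K)" for y
  proof -
    have "B y0 (A y0 (B y u)) = B y u" using left y0 by simp
    then have "norm (B y u) \<le> K * norm (A y0 (B y u))" using K(2) by metis
    also have "A y0 (B y u) = u - (A y (B y u) - A y0 (B y u))" using inv that by simp
    also have "norm \<dots> \<le> norm u + ?s y * norm (B y u)"
      using norm_triangle_ineq4 est[OF that(1)] by (meson add_left_mono order_trans)
    also have "\<dots> \<le> norm u + 1 / (2 * K) * norm (B y u)"
      using that by (intro add_left_mono mult_right_mono) auto
    finally show ?thesis using K(1) by (simp add: field_simps)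
  qed
  have "((\<lambda>y. B y u - B y0 u) \<longlongrightarrow> 0) (at y0)"
  proof (rule Lim_null_comparison)
    show "\<forall>\<^sub>F y in at y0. norm (B y u - B y0 u) \<le> K * (?s y * (2 * K * norm u))"
      using ev
    proof eventually_elim
      case (elim y)
      have "B y u - B y0 u = B y0 (- (A y (B y u) - A y0 (B y u)))"
        using elim y0 by (simp add: linear_diff[OF linB] left inv)
      also have "norm \<dots> \<le> K * norm (A y (B y u) - A y0 (B y u))"
        using K(2) norm_minus_cancel by metis
      also have "\<dots> \<le> K * (?s y * norm (B y u))"
        using est elim K(1) by (intro mult_left_mono) auto
      also have "\<dots> \<le> K * (?s y * (2 * K * norm u))"
        using bd elim K(1) by (intro mult_left_mono) (auto intro: sum_nonneg)
      finally show ?case .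
    qed
    show "((\<lambda>y. K * (?s y * (2 * K * norm u))) \<longlongrightarrow> 0) (at y0)"
      using tendsto_mult_right_zero[OF tendsto_mult_left_zero[OF s0]] by simp
  qed
  then show "isCont (\<lambda>y. B y u) y0"
    by (simp add: isCont_def LIM_zero_iff)
qed

text \<open>
  In \<open>B y u - B y0 u = - B y (d y)\<close> with \<open>d y = A y (B y0 u) - A y0 (B y0 u)\<close> the factor \<open>d\<close> is
  differentiable and vanishes at \<open>y0\<close>.  Therefore mere continuity of \<open>B\<close> suffices to differentiate
  the right-hand side.
\<close>

lemma inverse_family_has_derivative:
  fixes A B :: "'a::euclidean_space \<Rightarrow> 'b::euclidean_space \<Rightarrow> 'b"
  assumes V: "open V" and lin: "\<And>y. y \<in> V \<Longrightarrow> linear (A y)"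
    and inv: "\<And>y v. y \<in> V \<Longrightarrow> A y (B y v) = v"
    and left: "\<And>y v. y \<in> V \<Longrightarrow> B y (A y v) = v"
    and der: "\<And>y v. y \<in> V \<Longrightarrow> ((\<lambda>y. A y v) has_derivative A' y v) (at y)"
    and y0: "y0 \<in> V"
  shows "((\<lambda>y. B y u) has_derivative (\<lambda>w. - B y0 (A' y0 (B y0 u) w))) (at y0)"
proof -
  have linB: "linear (B y)" if "y \<in> V" for y
    by (rule linear_two_sided_inverse[OF lin[OF that]]) (simp_all add: inv left that)
  have contA: "continuous_on V (\<lambda>y. A y v)" for v
    using der by (meson continuous_at_imp_continuous_on has_derivative_continuous)
  have contB: "isCont (\<lambda>y. B y v) y0" for v
    using inverse_family_continuous[of V A B, OF V lin inv left contA] V y0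
    by (auto simp: continuous_on_eq_continuous_at)
  define d where "d y = A y (B y0 u) - A y0 (B y0 u)" for y
  have dd: "(d has_derivative A' y0 (B y0 u)) (at y0)"
    unfolding d_def by (auto intro!: derivative_eq_intros der[OF y0])
  have prod: "((\<lambda>y. (d y \<bullet> e) *\<^sub>R B y e) has_derivative (\<lambda>w. (A' y0 (B y0 u) w \<bullet> e) *\<^sub>R B y0 e)) (at y0)" for e
  proof -
    have de: "((\<lambda>y. d y \<bullet> e) has_derivative (\<lambda>w. A' y0 (B y0 u) w \<bullet> e)) (at y0)"
      using has_derivative_inner_left[OF dd] .
    obtain K where K: "K > 0" "\<forall>\<^sub>F y in at y0. norm (d y \<bullet> e) \<le> K * norm (y - y0)"
    proof -
      have "bounded_linear (\<lambda>w. A' y0 (B y0 u) w \<bullet> e)" using de has_derivative_bounded_linear by blast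
      then obtain K where "K > 0" and K: "\<And>w. norm (A' y0 (B y0 u) w \<bullet> e) \<le> norm w * K"
        using bounded_linear.pos_bounded by blast
      have "\<forall>\<^sub>F y in at y0. norm ((d y \<bullet> e) - (d y0 \<bullet> e) - (A' y0 (B y0 u) (y - y0) \<bullet> e)) \<le> 1 * norm (y - y0)"
        using de unfolding has_derivative_within_alt eventually_at
        by (metis UNIV_I dist_norm zero_less_one)
      then have "\<forall>\<^sub>F y in at y0. norm (d y \<bullet> e) \<le> (K + 1) * norm (y - y0)"
      proof eventually_elim
        case (elim y)
        have "d y0 = 0" by (simp add: d_def)
        then show ?case using elim K[of "y - y0"] by (auto simp: algebra_simps abs_if split: if_splits)
      qed
      then show ?thesis using that[of "K + 1"] \<open>K > 0\<close> by simp
    qed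
    have "((\<lambda>y. (d y \<bullet> e) *\<^sub>R B y0 e) has_derivative (\<lambda>w. (A' y0 (B y0 u) w \<bullet> e) *\<^sub>R B y0 e)) (at y0)"
      by (intro has_derivative_scaleR_left de)
    \<comment> \<open>The first factor is \<open>O(norm (y - y0))\<close> and the second one tends to zero.\<close>
    moreover have "((\<lambda>y. (d y \<bullet> e) *\<^sub>R (B y e - B y0 e)) has_derivative (\<lambda>w. 0)) (at y0)"
      unfolding has_derivative_at_within
    proof (rule conjI[OF bounded_linear_zero], rule Lim_null_comparison)
      have d0: "d y0 = 0" by (simp add: d_def)
      show "((\<lambda>y. K * norm (B y e - B y0 e)) \<longlongrightarrow> 0) (at y0)"
        by (rule tendsto_mult_right_zero[OF tendsto_norm_zero[OF LIM_zero[OF contB[of e, unfolded isCont_def]]]])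
      show "\<forall>\<^sub>F y in at y0. norm (((d y \<bullet> e) *\<^sub>R (B y e - B y0 e) - (d y0 \<bullet> e) *\<^sub>R (B y0 e - B y0 e) - 0) /\<^sub>R norm (y - y0))
               \<le> K * norm (B y e - B y0 e)"
        using K(2) eventually_neq_at_within[of y0 y0 UNIV]
      proof eventually_elim
        case (elim y)
        then have "\<bar>d y \<bullet> e\<bar> / norm (y - y0) \<le> K" by (simp add: field_simps)
        then have "\<bar>d y \<bullet> e\<bar> / norm (y - y0) * norm (B y e - B y0 e) \<le> K * norm (B y e - B y0 e)"
          by (rule mult_right_mono) auto
        then show ?case by (simp add: d0 divide_inverse abs_mult mult_ac)
      qed
    qed
    ultimately show ?thesis
      using has_derivative_add by (fastforce simp: algebra_simps)
  qed
  have "((\<lambda>y. B y0 u - (\<Sum>e\<in>Basis. (d y \<bullet> e) *\<^sub>R B y e)) has_derivative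
        (\<lambda>w. 0 - (\<Sum>e\<in>Basis. (A' y0 (B y0 u) w \<bullet> e) *\<^sub>R B y0 e))) (at y0)"
    by (intro has_derivative_diff has_derivative_const has_derivative_sum prod)
  moreover have "(\<Sum>e\<in>Basis. (v \<bullet> e) *\<^sub>R B y e) = B y v" if "y \<in> V" for v y
    using linear_expand_Basis[OF linB[OF that], of v] by simp
  ultimately have "((\<lambda>y. B y0 u - (\<Sum>e\<in>Basis. (d y \<bullet> e) *\<^sub>R B y e)) has_derivative
        (\<lambda>w. - B y0 (A' y0 (B y0 u) w))) (at y0)"
    using y0 by simp
  then show ?thesis
  proof (rule has_derivative_transform_within_open[OF _ V y0])
    fix y assume y: "y \<in> V"
    have "(\<Sum>e\<in>Basis. (d y \<bullet> e) *\<^sub>R B y e) = B y (d y)"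
      using linear_expand_Basis[OF linB[OF y], of "d y"] by simp
    also have "\<dots> = B y0 u - B y u"
      using y y0 by (simp add: d_def linear_diff[OF linB] left inv)
    finally show "B y0 u - (\<Sum>e\<in>Basis. (d y \<bullet> e) *\<^sub>R B y e) = B y u" by simp
  qed
qed

text \<open>
  The derivative \<open>- B (A' (B u))\<close> of \<open>B u\<close> is a polynomial expression in the coordinates of \<open>B\<close> and of
  the derivative of \<open>A\<close>, so each order of differentiability of \<open>A\<close> passes to \<open>B\<close> by induction.
\<close>

lemma inverse_family_Ck_on:
  fixes A B :: "'a::euclidean_space \<Rightarrow> 'b::euclidean_space \<Rightarrow> 'b"
  assumes V: "open V" and lin: "\<And>y. y \<in> V \<Longrightarrow> linear (A y)"
    and inv: "\<And>y v. y \<in> V \<Longrightarrow> A y (B y v) = v"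
    and left: "\<And>y v. y \<in> V \<Longrightarrow> B y (A y v) = v"
    and Ck: "\<And>v. Ck_on k (\<lambda>y. A y v) V"
  shows "Ck_on k (\<lambda>y. B y u) V"
  using Ck
proof (induction k arbitrary: u)
  case 0
  then show ?case using inverse_family_continuous[of V A B, OF V lin inv left] by simp
next
  case (Suc k)
  have linB: "linear (B y)" if "y \<in> V" for y
    by (rule linear_two_sided_inverse[OF lin[OF that]]) (simp_all add: inv left that)
  define A' where "A' y v = frechet_derivative (\<lambda>y. A y v) (at y)" for y v
  have A': "((\<lambda>y. A y v) has_derivative A' y v) (at y)" if "y \<in> V" for y v
    unfolding A'_def using Ck_on_differentiable[OF V Suc.prems that] .
  have IH: "Ck_on k (\<lambda>y. B y v) V" for v
    using Suc.IH Suc.prems Ck_on_Suc_imp by blast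
  have A'_lin: "A' y (B y u) w = (\<Sum>c\<in>Basis. (B y u \<bullet> c) *\<^sub>R A' y c w)" if y: "y \<in> V" for y w
  proof -
    have "((\<lambda>z. \<Sum>c\<in>Basis. (B y u \<bullet> c) *\<^sub>R A z c) has_derivative (\<lambda>w. \<Sum>c\<in>Basis. (B y u \<bullet> c) *\<^sub>R A' y c w)) (at y)"
      by (intro has_derivative_sum has_derivative_scaleR_right A' y)
    then have "((\<lambda>z. A z (B y u)) has_derivative (\<lambda>w. \<Sum>c\<in>Basis. (B y u \<bullet> c) *\<^sub>R A' y c w)) (at y)"
      by (rule has_derivative_transform_within_open[OF _ V y])
        (use linear_expand_Basis[OF lin] in metis)
    from has_derivative_unique[OF this A'[OF y]] show ?thesis by metis
  qed
  show ?case
  proof (rule Ck_on_SucI[OF V])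
    show "((\<lambda>y. B y u) has_derivative (\<lambda>w. - B y (A' y (B y u) w))) (at y)" if "y \<in> V" for y
      by (rule inverse_family_has_derivative[of V A B A', OF V lin inv left A' that])
  next
    fix w :: 'a assume w: "w \<in> Basis"
    have C: "Ck_on k (\<lambda>y. A' y c w) V" for c
      unfolding A'_def using Suc.prems[of c] w by simp
    have "Ck_on k (\<lambda>y. \<Sum>b\<in>Basis. ((\<Sum>c\<in>Basis. (B y u \<bullet> c) *\<^sub>R A' y c w) \<bullet> (- b)) *\<^sub>R B y b) V"
      by (intro Ck_on_sum[OF V] bounded_bilinear.Ck_on_prod[OF bounded_bilinear_scaleR V]
          bounded_bilinear.Ck_on_prod[OF bounded_bilinear_inner V] Ck_on_const IH C)
    then show "Ck_on k (\<lambda>y. - B y (A' y (B y u) w)) V"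
    proof (rule Ck_on_cong_imp[OF V, rotated])
      fix y assume y: "y \<in> V"
      show "(\<Sum>b\<in>Basis. ((\<Sum>c\<in>Basis. (B y u \<bullet> c) *\<^sub>R A' y c w) \<bullet> (- b)) *\<^sub>R B y b) = - B y (A' y (B y u) w)"
        using linear_expand_Basis[OF linB[OF y], of "A' y (B y u) w"] A'_lin[OF y, of w]
        by (simp add: sum_negf)
    qed
  qed
qed

text \<open>
  The \<open>C\<^sup>1\<close> inverse function theorem provides \<open>g\<close> with \<open>g' y = (f' (g y))\<^sup>-\<^sup>1\<close>.  If \<open>g\<close> is \<open>C\<^sup>k\<close>, so is
  \<open>y \<mapsto> f' (g y)\<close> and hence its inverse \<open>g'\<close>, which makes \<open>g\<close> of class \<open>C\<^sup>k\<^sup>+\<^sup>1\<close>.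
\<close>

theorem smooth_inverse_function:
  fixes f :: "'a::euclidean_space \<Rightarrow> 'a"
  assumes f: "smooth_on f W" and p: "p \<in> W" and f': "(f has_derivative f') (at p)"
    and inj: "\<And>v. f' v = 0 \<Longrightarrow> v = 0"
  obtains U V g where "p \<in> U" "U \<subseteq> W" "smooth_on f U" "smooth_on g V" "homeomorphism U V f g"
proof -
  note o = smooth_on_open[OF f]
  define D where "D x = Blinfun (frechet_derivative f (at x))" for x
  have D: "blinfun_apply (D x) = frechet_derivative f (at x)" if "x \<in> W" for x
    unfolding D_def using smooth_on_has_derivative[OF f that]
    by (intro bounded_linear_Blinfun_apply) (rule has_derivative_bounded_linear)
  have derf: "(f has_derivative blinfun_apply (D x)) (at x)" if "x \<in> W" for x
    using smooth_on_has_derivative[OF f that] D that by simp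
  have contf: "continuous_on W D"
  proof (rule continuous_on_blinfun_componentwise)
    fix i :: 'a
    have "continuous_on W (\<lambda>x. frechet_derivative f (at x) i)"
      by (rule smooth_on_continuous[OF smooth_on_frechet_derivative[OF f]])
    then show "continuous_on W (\<lambda>x. D x i)"
      by (rule continuous_on_eq) (simp add: D)
  qed
  have f'D: "f' = blinfun_apply (D p)"
    using has_derivative_unique[OF f' derf[OF p]] .
  have lin: "linear f'" using f' by (rule has_derivative_linear)
  obtain h where h: "linear h" "\<And>v. h (f' v) = v"
    using linear_injective_left_inverse[OF lin] inj
    by (metis comp_apply id_apply lin linear_injective_0)
  have "Blinfun h o\<^sub>L D p = id_blinfun"
    by (rule blinfun_eqI)
      (use h f'D in \<open>simp add: bounded_linear_Blinfun_apply linear_conv_bounded_linear\<close>)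
  from inverse_function_theorem[OF o derf contf p this]
  obtain U V g g' where U: "open U" "U \<subseteq> W" "p \<in> U" "open V" "homeomorphism U V f g"
    and g': "\<And>y. y \<in> V \<Longrightarrow> (g has_derivative (g' y)) (at y)"
      "\<And>y. y \<in> V \<Longrightarrow> g' y = inv (blinfun_apply (D (g y)))"
    and bij: "\<And>y. y \<in> V \<Longrightarrow> bij (blinfun_apply (D (g y)))" by metis
  have gV: "g ` V \<subseteq> W" using U by (auto simp: homeomorphism_def)
  define A where "A y = blinfun_apply (D (g y))" for y
  have "Ck_on k g V" for k
  proof (induction k)
    case 0
    then show ?case using U by (auto simp: homeomorphism_def)
  next
    case (Suc k)
    show ?case
    proof (rule Ck_on_SucI[OF \<open>open V\<close> g'(1)])
      fix e :: 'a
      show "Ck_on k (\<lambda>y. g' y e) V"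
      proof (rule inverse_family_Ck_on[OF \<open>open V\<close>, of A])
        fix y assume y: "y \<in> V"
        show "linear (A y)" unfolding A_def by (rule bounded_linear.linear[OF blinfun.bounded_linear_right])
        show "A y (g' y v) = v" for v
          using g'(2)[OF y] bij[OF y] by (simp add: A_def bij_is_surj surj_f_inv_f)
        show "g' y (A y v) = v" for v
          using g'(2)[OF y] bij[OF y] by (simp add: A_def bij_is_inj)
      next
        fix v
        have "Ck_on k (\<lambda>x. frechet_derivative f (at x) v) W"
          using smooth_on_frechet_derivative[OF f, of v] by (simp add: smooth_on_def)
        from Ck_on_compose[OF \<open>open V\<close> o this Suc gV]
        show "Ck_on k (\<lambda>y. A y v) V"
          by (rule Ck_on_cong_imp[OF \<open>open V\<close>, rotated]) (use gV D in \<open>auto simp: A_def\<close>)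
      qed
    qed
  qed
  then have "smooth_on g V" using U by (simp add: smooth_on_def)
  then show thesis using that U smooth_on_subset[OF f] by blast
qed

section \<open>Corner charts\<close>

text \<open>
  The source of all charts: finitely many defining functions with independent differentials at \<open>p\<close>,
  completed to a full coordinate system \<open>\<Phi>\<close>.
\<close>

lemma corner_chart_exists:
  fixes \<Phi> :: "'a::euclidean_space \<Rightarrow> 'a"
  assumes \<Phi>: "smooth_on \<Phi> W" and p: "p \<in> W" "\<Phi> p = 0"
    and der: "(\<Phi> has_derivative \<Phi>') (at p)" and inj: "\<And>v. \<Phi>' v = 0 \<Longrightarrow> v = 0"
    and CD: "C \<subseteq> D" "D \<subseteq> Basis"
    and mem: "\<And>x. x \<in> W \<Longrightarrow> x \<in> M \<longleftrightarrow> (\<forall>e\<in>Basis - D. \<Phi> x \<bullet> e = 0) \<and> (\<forall>e\<in>C. 0 \<le> \<Phi> x \<bullet> e)"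
    and lab: "\<And>x y. x \<in> M \<inter> W \<Longrightarrow> y \<in> M \<inter> W \<Longrightarrow>
                \<sigma> x = \<sigma> y \<longleftrightarrow> (\<forall>e\<in>C. \<Phi> x \<bullet> e = 0 \<longleftrightarrow> \<Phi> y \<bullet> e = 0)"
  obtains U V \<Psi> where "U \<subseteq> W" "corner_chart M \<sigma> p U V \<Phi> \<Psi> D C"
proof -
  obtain U V \<Psi> where U: "p \<in> U" "U \<subseteq> W" "smooth_on \<Phi> U" "smooth_on \<Psi> V" "homeomorphism U V \<Phi> \<Psi>"
    by (rule smooth_inverse_function[OF \<Phi> p(1) der inj])
  have hom: "\<Phi> ` U = V" "\<And>y. y \<in> V \<Longrightarrow> \<Psi> y \<in> U \<and> \<Phi> (\<Psi> y) = y"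
    using U(5) by (auto simp: homeomorphism_def)
  have "\<Phi> ` (M \<inter> U) = {y \<in> V. (\<forall>e\<in>Basis - D. y \<bullet> e = 0) \<and> (\<forall>e\<in>C. 0 \<le> y \<bullet> e)}" (is "?L = ?R")
  proof
    show "?L \<subseteq> ?R"
    proof
      fix y assume "y \<in> ?L"
      then obtain x where x: "y = \<Phi> x" "x \<in> M" "x \<in> U" by blast
      then show "y \<in> ?R" using mem[of x] U(2) hom(1) by auto
    qed
    show "?R \<subseteq> ?L"
    proof
      fix y assume y: "y \<in> ?R"
      then have "\<Psi> y \<in> U" "\<Phi> (\<Psi> y) = y" using hom(2) by auto
      moreover from this have "\<Psi> y \<in> M" using y mem[of "\<Psi> y"] U(2) by auto
      ultimately show "y \<in> ?L" by (intro image_eqI[of y \<Phi> "\<Psi> y"]) simp_all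
    qed
  qed
  moreover have "\<forall>x\<in>M \<inter> U. \<forall>x'\<in>M \<inter> U. \<sigma> x = \<sigma> x' \<longleftrightarrow> (\<forall>e\<in>C. \<Phi> x \<bullet> e = 0 \<longleftrightarrow> \<Phi> x' \<bullet> e = 0)"
    using U(2) by (intro ballI lab) auto
  ultimately have "corner_chart M \<sigma> p U V \<Phi> \<Psi> D C"
    unfolding corner_chart_def by (intro conjI U p(2) CD)
  then show thesis using that U(2) by blast
qed

context
  fixes M :: "'a::euclidean_space set" and \<sigma> :: "'a \<Rightarrow> 'l" and p :: 'a and U V and \<Phi> \<Psi> :: "'a \<Rightarrow> 'a" and D C
  assumes chart: "corner_chart M \<sigma> p U V \<Phi> \<Psi> D C"
begin

lemma corner_chart_simps:
  shows "p \<in> U" "smooth_on \<Phi> U" "smooth_on \<Psi> V" "open U" "open V" "\<Phi> p = 0" "0 \<in> V" "\<Psi> 0 = p"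
    "C \<subseteq> D" "D \<subseteq> Basis"
    "\<And>x. x \<in> U \<Longrightarrow> \<Phi> x \<in> V" "\<And>x. x \<in> U \<Longrightarrow> \<Psi> (\<Phi> x) = x"
    "\<And>y. y \<in> V \<Longrightarrow> \<Psi> y \<in> U" "\<And>y. y \<in> V \<Longrightarrow> \<Phi> (\<Psi> y) = y"
proof -
  have hom: "homeomorphism U V \<Phi> \<Psi>" and *: "p \<in> U" "smooth_on \<Phi> U" "smooth_on \<Psi> V" "\<Phi> p = 0"
    "C \<subseteq> D" "D \<subseteq> Basis"
    using chart by (simp_all add: corner_chart_def)
  show "p \<in> U" "smooth_on \<Phi> U" "smooth_on \<Psi> V" "\<Phi> p = 0" "C \<subseteq> D" "D \<subseteq> Basis" by fact+
  show "open U" "open V" using * smooth_on_open by auto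
  show 1: "\<And>x. x \<in> U \<Longrightarrow> \<Phi> x \<in> V" "\<And>x. x \<in> U \<Longrightarrow> \<Psi> (\<Phi> x) = x"
    "\<And>y. y \<in> V \<Longrightarrow> \<Psi> y \<in> U" "\<And>y. y \<in> V \<Longrightarrow> \<Phi> (\<Psi> y) = y"
    using hom by (auto simp: homeomorphism_def)
  show "0 \<in> V" "\<Psi> 0 = p" using 1[of p] * by auto
qed

lemma corner_chart_mem:
  assumes "x \<in> U"
  shows "x \<in> M \<longleftrightarrow> (\<forall>e\<in>Basis - D. \<Phi> x \<bullet> e = 0) \<and> (\<forall>e\<in>C. 0 \<le> \<Phi> x \<bullet> e)"
proof -
  have im: "\<Phi> ` (M \<inter> U) = {y \<in> V. (\<forall>e\<in>Basis - D. y \<bullet> e = 0) \<and> (\<forall>e\<in>C. 0 \<le> y \<bullet> e)}"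
    using chart by (simp add: corner_chart_def)
  have "x \<in> M \<longleftrightarrow> \<Phi> x \<in> \<Phi> ` (M \<inter> U)"
  proof
    assume "\<Phi> x \<in> \<Phi> ` (M \<inter> U)"
    then obtain x' where x': "\<Phi> x = \<Phi> x'" "x' \<in> M" "x' \<in> U" by blast
    then have "x = x'"
      using corner_chart_simps(12)[OF assms] corner_chart_simps(12)[OF x'(3)] by metis
    then show "x \<in> M" using x'(2) by simp
  qed (use assms in simp)
  then show ?thesis
    unfolding im using corner_chart_simps(11)[OF assms] by simp
qed

lemma corner_chart_base_mem: "p \<in> M"
  unfolding corner_chart_mem[OF corner_chart_simps(1)] corner_chart_simps(6) by simp

text \<open>
  The stratum of the apex is the face on which all coordinates in \<open>C\<close> vanish, so the same map is a
  chart of the stratum.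
\<close>

lemma corner_chart_stratum: "submanifold_chart (stratum M \<sigma> p) p U V \<Phi> \<Psi> (D - C)"
proof -
  note s = corner_chart_simps
  have lab: "\<sigma> x = \<sigma> p \<longleftrightarrow> (\<forall>e\<in>C. \<Phi> x \<bullet> e = 0)" if "x \<in> M" "x \<in> U" for x
  proof -
    have "\<forall>x\<in>M \<inter> U. \<forall>x'\<in>M \<inter> U. \<sigma> x = \<sigma> x' \<longleftrightarrow> (\<forall>e\<in>C. \<Phi> x \<bullet> e = 0 \<longleftrightarrow> \<Phi> x' \<bullet> e = 0)"
      using chart by (simp add: corner_chart_def)
    then have "\<sigma> x = \<sigma> p \<longleftrightarrow> (\<forall>e\<in>C. \<Phi> x \<bullet> e = 0 \<longleftrightarrow> \<Phi> p \<bullet> e = 0)"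
      using that corner_chart_base_mem s(1) by simp
    then show ?thesis by (simp add: s(6))
  qed
  have mem: "x \<in> stratum M \<sigma> p \<longleftrightarrow> (\<forall>e\<in>Basis - (D - C). \<Phi> x \<bullet> e = 0)" if "x \<in> U" for x
  proof -
    have eq: "Basis - (D - C) = (Basis - D) \<union> C" using s(9,10) by auto
    have "x \<in> stratum M \<sigma> p \<longleftrightarrow> x \<in> M \<and> (\<forall>e\<in>C. \<Phi> x \<bullet> e = 0)"
      using lab[OF _ that] by (auto simp: stratum_def)
    then show ?thesis
      unfolding eq ball_Un corner_chart_mem[OF that] by auto
  qed
  have "\<Phi> ` (stratum M \<sigma> p \<inter> U) = {y \<in> V. \<forall>e\<in>Basis - (D - C). y \<bullet> e = 0}" (is "?L = ?R")
  proof
    show "?L \<subseteq> ?R"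
    proof
      fix y assume "y \<in> ?L"
      then obtain x where x: "y = \<Phi> x" "x \<in> stratum M \<sigma> p" "x \<in> U" by blast
      then show "y \<in> ?R" using mem[of x] s(11) by simp
    qed
    show "?R \<subseteq> ?L"
    proof
      fix y assume "y \<in> ?R"
      then have "\<Psi> y \<in> stratum M \<sigma> p \<inter> U" "\<Phi> (\<Psi> y) = y" using mem[of "\<Psi> y"] s(13,14) by auto
      then show "y \<in> ?L" by (intro image_eqI[of y \<Phi> "\<Psi> y"]) simp_all
    qed
  qed
  then show ?thesis
    using chart s(10) unfolding submanifold_chart_def corner_chart_def by (simp add: subset_iff)
qed

lemma corner_chart_derivative_inverse:
  assumes y: "y \<in> V"
  shows "frechet_derivative \<Phi> (at (\<Psi> y)) (frechet_derivative \<Psi> (at y) v) = v"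
    "frechet_derivative \<Psi> (at y) (frechet_derivative \<Phi> (at (\<Psi> y)) v) = v"
proof -
  note s = corner_chart_simps
  have d: "(\<Phi> has_derivative frechet_derivative \<Phi> (at (\<Psi> y))) (at (\<Psi> y))"
    "(\<Psi> has_derivative frechet_derivative \<Psi> (at y)) (at y)"
    by (rule smooth_on_has_derivative[OF s(2) s(13)[OF y]], rule smooth_on_has_derivative[OF s(3) y])
  have "((\<lambda>z. \<Phi> (\<Psi> z)) has_derivative (\<lambda>v. frechet_derivative \<Phi> (at (\<Psi> y)) (frechet_derivative \<Psi> (at y) v))) (at y)"
    by (rule has_derivative_compose[OF d(2,1)])
  then have "((\<lambda>z. z) has_derivative (\<lambda>v. frechet_derivative \<Phi> (at (\<Psi> y)) (frechet_derivative \<Psi> (at y) v))) (at y)"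
    by (rule has_derivative_transform_within_open[OF _ s(5) y]) (rule s(14))
  then show "frechet_derivative \<Phi> (at (\<Psi> y)) (frechet_derivative \<Psi> (at y) v) = v"
    using has_derivative_unique[OF _ has_derivative_ident] by metis
  have d': "(\<Psi> has_derivative frechet_derivative \<Psi> (at y)) (at (\<Phi> (\<Psi> y)))" using d(2) s(14)[OF y] by simp
  have "((\<lambda>z. \<Psi> (\<Phi> z)) has_derivative (\<lambda>v. frechet_derivative \<Psi> (at y) (frechet_derivative \<Phi> (at (\<Psi> y)) v))) (at (\<Psi> y))"
    by (rule has_derivative_compose[OF d(1) d'])
  then have "((\<lambda>z. z) has_derivative (\<lambda>v. frechet_derivative \<Psi> (at y) (frechet_derivative \<Phi> (at (\<Psi> y)) v))) (at (\<Psi> y))"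
    by (rule has_derivative_transform_within_open[OF _ s(4) s(13)[OF y]]) (rule s(12))
  then show "frechet_derivative \<Psi> (at y) (frechet_derivative \<Phi> (at (\<Psi> y)) v) = v"
    using has_derivative_unique[OF _ has_derivative_ident] by metis
qed

end

text \<open>
  A curve in \<open>Q\<close> keeps the coordinates outside \<open>D\<close> at zero; conversely, straight lines in \<open>span D\<close>
  are mapped by \<open>\<Psi>\<close> to curves in \<open>Q\<close>.
\<close>

lemma tangent_space_submanifold:
  assumes chart: "submanifold_chart Q p U V \<Phi> \<Psi> D"
  shows "tangent_space Q p = {v. \<forall>e\<in>Basis - D. frechet_derivative \<Phi> (at p) v \<bullet> e = 0}" (is "_ = ?T")
proof
  note chart' = chart[unfolded submanifold_chart_def]
  note s = corner_chart_simps[OF chart']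
  have mem: "x \<in> Q \<longleftrightarrow> (\<forall>e\<in>Basis - D. \<Phi> x \<bullet> e = 0)" if "x \<in> U" for x
    using corner_chart_mem[OF chart' that] by simp
  have d\<Phi>: "(\<Phi> has_derivative frechet_derivative \<Phi> (at p)) (at p)"
    by (rule smooth_on_has_derivative[OF s(2,1)])
  show "tangent_space Q p \<subseteq> ?T"
  proof
    fix v assume "v \<in> tangent_space Q p"
    then obtain c \<epsilon> where c: "\<epsilon> > 0" "c ` {-\<epsilon><..<\<epsilon>} \<subseteq> Q" "c (0::real) = p"
      "(c has_vector_derivative v) (at 0)" "smooth_on c {-\<epsilon><..<\<epsilon>}"
      unfolding tangent_space_def by blast
    have "frechet_derivative \<Phi> (at p) v \<bullet> e = 0" if e: "e \<in> Basis - D" for e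
    proof -
      have dc: "(c has_derivative (\<lambda>t. t *\<^sub>R v)) (at 0)"
        using c(4) by (simp add: has_vector_derivative_def)
      have "((\<lambda>t. \<Phi> (c t)) has_derivative (\<lambda>t. frechet_derivative \<Phi> (at p) (t *\<^sub>R v))) (at 0)"
        using has_derivative_compose[OF dc, of \<Phi>] d\<Phi> c(3) by simp
      from has_derivative_inner_left[OF this, of e]
      have 1: "((\<lambda>t. \<Phi> (c t) \<bullet> e) has_derivative (\<lambda>t. frechet_derivative \<Phi> (at p) (t *\<^sub>R v) \<bullet> e)) (at 0)" .
      have "open (c -` U \<inter> {-\<epsilon><..<\<epsilon>})"
        using continuous_open_preimage[OF smooth_on_continuous[OF c(5)] _ s(4)] by (simp add: Int_commute)
      moreover have "0 \<in> c -` U \<inter> {-\<epsilon><..<\<epsilon>}" using c s(1) by simp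
      ultimately have "((\<lambda>t. 0) has_derivative (\<lambda>t. frechet_derivative \<Phi> (at p) (t *\<^sub>R v) \<bullet> e)) (at 0)"
      proof (rule has_derivative_transform_within_open[OF 1])
        fix t assume "t \<in> c -` U \<inter> {-\<epsilon><..<\<epsilon>}"
        then have "c t \<in> U" "c t \<in> Q" using c(2) by auto
        then show "\<Phi> (c t) \<bullet> e = 0" using mem[of "c t"] e by simp
      qed
      then have "(\<lambda>t. frechet_derivative \<Phi> (at p) (t *\<^sub>R v) \<bullet> e) = (\<lambda>t. 0)"
        by (rule has_derivative_unique) (rule has_derivative_const)
      from fun_cong[OF this, of 1] show ?thesis by simp
    qed
    then show "v \<in> ?T" by simp
  qed
  show "?T \<subseteq> tangent_space Q p"
  proof
    fix v assume v: "v \<in> ?T"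
    define u where "u = frechet_derivative \<Phi> (at p) v"
    have d\<Psi>: "(\<Psi> has_derivative frechet_derivative \<Psi> (at 0)) (at 0)"
      by (rule smooth_on_has_derivative[OF s(3,7)])
    have "open ((\<lambda>t::real. t *\<^sub>R u) -` V)"
      by (intro open_vimage s(5) continuous_intros)
    then obtain \<epsilon> where \<epsilon>: "\<epsilon> > 0" "ball 0 \<epsilon> \<subseteq> (\<lambda>t::real. t *\<^sub>R u) -` V"
      using s(7) by (metis open_contains_ball scale_zero_left vimageI)
    have ball: "ball 0 \<epsilon> = {-\<epsilon><..<\<epsilon>}" by (auto simp: dist_real_def)
    let ?c = "\<lambda>t::real. \<Psi> (t *\<^sub>R u)"
    have sm: "smooth_on ?c {-\<epsilon><..<\<epsilon>}"
      by (rule smooth_on_compose[OF s(3) smooth_on_bounded_linear[OF _ bounded_linear_scaleR_left]])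
        (use \<epsilon> ball in auto)
    have "?c t \<in> Q" if "t \<in> {-\<epsilon><..<\<epsilon>}" for t
    proof -
      have "t *\<^sub>R u \<in> V" using \<epsilon> that ball by auto
      then show ?thesis using mem[OF s(13)] s(14) v by (simp add: u_def)
    qed
    moreover have "(?c has_vector_derivative v) (at 0)"
    proof -
      have "((\<lambda>t::real. t *\<^sub>R u) has_derivative (\<lambda>t. t *\<^sub>R u)) (at 0)"
        by (intro derivative_eq_intros) auto
      from has_derivative_compose[OF this, of \<Psi>] d\<Psi>
      have "(?c has_derivative (\<lambda>t. frechet_derivative \<Psi> (at 0) (t *\<^sub>R u))) (at 0)" by simp
      moreover have "frechet_derivative \<Psi> (at 0) (t *\<^sub>R u) = t *\<^sub>R v" for t
        using corner_chart_derivative_inverse(2)[OF chart' s(7), of v] s(8)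
          linear_scale[OF has_derivative_linear[OF d\<Psi>]] by (simp add: u_def)
      ultimately show ?thesis by (simp add: has_vector_derivative_def)
    qed
    ultimately show "v \<in> tangent_space Q p"
      unfolding tangent_space_def using \<epsilon>(1) sm s(8) by (auto intro!: exI[of _ ?c] exI[of _ \<epsilon>])
  qed
qed

lemma dim_tangent_space_submanifold:
  assumes chart: "submanifold_chart Q p U V \<Phi> \<Psi> D"
  shows "dim (tangent_space Q p) = card D"
proof -
  note chart' = chart[unfolded submanifold_chart_def]
  note s = corner_chart_simps[OF chart']
  let ?\<Psi>' = "frechet_derivative \<Psi> (at 0)" and ?\<Phi>' = "frechet_derivative \<Phi> (at p)"
  note inv = corner_chart_derivative_inverse[OF chart' s(7), unfolded s(8)]
  have lin: "linear ?\<Psi>'"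
    by (rule has_derivative_linear[OF smooth_on_has_derivative[OF s(3,7)]])
  have span: "span D = {y. \<forall>e\<in>Basis - D. y \<bullet> e = 0}"
    using span_substd_basis[OF s(10)] by auto
  have "tangent_space Q p = ?\<Psi>' ` span D"
    unfolding tangent_space_submanifold[OF chart] span using inv by (auto simp: image_iff) metis
  moreover have "inj ?\<Psi>'" using inv(1) by (metis injI)
  ultimately have "dim (tangent_space Q p) = dim (span D)"
    using dim_image_eq[OF lin, of "span D"] by (simp add: inj_on_subset)
  also have "\<dots> = card D"
    using s(10) by (simp add: dim_eq_card_independent independent_substdbasis)
  finally show ?thesis .
qed

lemma critical_point_chart_iff:
  assumes chart: "corner_chart M \<sigma> p U V \<Phi> \<Psi> D C"
  shows "critical_point M \<sigma> f p \<longleftrightarrow>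
    (\<forall>v. (\<forall>e\<in>Basis - (D - C). frechet_derivative \<Phi> (at p) v \<bullet> e = 0) \<longrightarrow> frechet_derivative f (at p) v = 0)"
  unfolding critical_point_def tangent_space_submanifold[OF corner_chart_stratum[OF chart]]
  using corner_chart_base_mem[OF chart] by auto

text \<open>
  The differential of a coordinate is \<open>1\<close> in its own coordinate direction, which is tangent to the stratum.
\<close>

lemma not_critical_if_coordinate:
  assumes chart: "corner_chart M \<sigma> p U V \<Phi> \<Psi> D C" and e: "e \<in> D - C"
    and f: "\<And>x. x \<in> U \<Longrightarrow> f x = \<Phi> x \<bullet> e + c"
  shows "\<not> critical_point M \<sigma> f p"
proof
  assume crit: "critical_point M \<sigma> f p"
  note s = corner_chart_simps[OF chart]
  let ?v = "frechet_derivative \<Psi> (at 0) e" and ?\<Phi>' = "frechet_derivative \<Phi> (at p)"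
  have v: "?\<Phi>' ?v = e"
    using corner_chart_derivative_inverse(1)[OF chart s(7)] s(8) by simp
  have "(\<Phi> has_derivative ?\<Phi>') (at p)"
    by (rule smooth_on_has_derivative[OF s(2,1)])
  then have "((\<lambda>x. \<Phi> x \<bullet> e + c) has_derivative (\<lambda>v. ?\<Phi>' v \<bullet> e)) (at p)"
    by (auto intro!: derivative_eq_intros)
  then have "(f has_derivative (\<lambda>v. ?\<Phi>' v \<bullet> e)) (at p)"
    by (rule has_derivative_transform_within_open[OF _ s(4,1)]) (simp add: f)
  then have "frechet_derivative f (at p) ?v = e \<bullet> e"
    using frechet_derivative_at v by metis
  moreover have "e \<in> Basis" using e s(10) by auto
  moreover have "\<forall>b\<in>Basis - (D - C). e \<bullet> b = 0"
    using e \<open>e \<in> Basis\<close> by (auto simp: inner_Basis)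
  ultimately show False
    using crit v unfolding critical_point_chart_iff[OF chart] by (metis inner_same_Basis zero_neq_one)
qed

section \<open>A half-plane constraint on a circle bundle\<close>

text \<open>
  The hypotheses say that \<open>(u, w)\<close> has zero coefficients in the orthonormal basis \<open>(c, s)\<close>, \<open>(- s, c)\<close>.
\<close>

lemma radial_angular_zero:
  fixes c s u w :: real
  assumes "c\<^sup>2 + s\<^sup>2 = 1" "c * u + s * w = 0" "c * w - s * u = 0"
  shows "u = 0" "w = 0"
proof -
  have "(c\<^sup>2 + s\<^sup>2) * u = c * (c * u + s * w) - s * (c * w - s * u)"
    "(c\<^sup>2 + s\<^sup>2) * w = s * (c * u + s * w) + c * (c * w - s * u)"
    by (simp_all add: algebra_simps power2_eq_square)
  then show "u = 0" "w = 0" unfolding assms by simp_all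
qed

lemma linear_real_pair:
  fixes L :: "real \<times> real \<Rightarrow> real"
  assumes "linear L"
  shows "L (s, t) = s * L (1, 0) + t * L (0, 1)"
proof -
  have "L (s *\<^sub>R (1, 0) + t *\<^sub>R (0, 1)) = s * L (1, 0) + t * L (0, 1)"
    by (simp only: linear_add[OF assms] linear_scale[OF assms] real_scaleR_def)
  then show ?thesis by simp
qed

text \<open>
  The common form of both halves of the problem.  Points have four coordinates: a position
  \<open>(x \<bullet> e1, x \<bullet> e2)\<close> in a rectangle and a unit vector \<open>(x \<bullet> e3, x \<bullet> e4)\<close>.  A planar vector field
  \<open>(A, B)\<close> on the rectangle restricts the unit vector to the half-plane
  \<open>A * (x \<bullet> e3) + B * (x \<bullet> e4) \<ge> 0\<close>.  The field vanishes only at the centre \<open>(a1, a2)\<close>, where the whole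
  circle lies on the boundary, and its differential there has the matrix
  \<open>(A\<^sub>1, A\<^sub>2; B\<^sub>1, 0)\<close> with \<open>A\<^sub>2 \<noteq> 0\<close> and \<open>B\<^sub>1 \<noteq> 0\<close>.  Coordinates are addressed through the basis vectors so that the
  roles of the two base coordinates can be exchanged.
\<close>

locale circle_constraint =
  fixes e1 e2 e3 e4 :: "'a::euclidean_space" and A B :: "real \<times> real \<Rightarrow> real"
    and A' B' :: "real \<times> real \<Rightarrow> real" and a1 a2 \<delta> :: real
  assumes Basis_eq: "Basis = {e1, e2, e3, e4}" and distinct_e: "distinct [e1, e2, e3, e4]"
    and delta_pos: "\<delta> > 0"
    and smooth_A: "smooth_on A UNIV" and smooth_B: "smooth_on B UNIV"
    and zero: "A (a1, a2) = 0" "B (a1, a2) = 0"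
    and nonzero: "\<And>s t. \<lbrakk>s \<in> {a1 - \<delta>..a1 + \<delta>}; t \<in> {a2 - \<delta>..a2 + \<delta>}; (s, t) \<noteq> (a1, a2)\<rbrakk>
                    \<Longrightarrow> A (s, t) \<noteq> 0 \<or> B (s, t) \<noteq> 0"
    and der_A: "(A has_derivative A') (at (a1, a2))" and der_B: "(B has_derivative B') (at (a1, a2))"
    and A'_2: "A' (0, 1) \<noteq> 0" and B'_2: "B' (0, 1) = 0" and B'_1: "B' (1, 0) \<noteq> 0"
begin

definition g :: "'a \<Rightarrow> real" where
  "g x = A (x \<bullet> e1, x \<bullet> e2) * (x \<bullet> e3) + B (x \<bullet> e1, x \<bullet> e2) * (x \<bullet> e4)"

definition q :: "'a \<Rightarrow> real" where
  "q x = (x \<bullet> e3)\<^sup>2 + (x \<bullet> e4)\<^sup>2 - 1"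

definition M :: "'a set" where
  "M = {x. q x = 0 \<and> x \<bullet> e1 \<in> {a1 - \<delta><..<a1 + \<delta>} \<and> x \<bullet> e2 \<in> {a2 - \<delta>..a2 + \<delta>} \<and> g x \<ge> 0}"

definition on_edge :: "'a \<Rightarrow> bool" where
  "on_edge x \<longleftrightarrow> x \<bullet> e2 \<in> {a2 - \<delta>, a2 + \<delta>}"

text \<open>Among the points of the manifold these will be the critical points of \<open>x \<bullet> e1\<close>.\<close>

definition is_fold :: "'a \<Rightarrow> bool" where
  "is_fold x \<longleftrightarrow> x \<bullet> e1 = a1 \<and> x \<bullet> e2 = a2 \<and> x \<bullet> e3 = 0"

abbreviation height :: "'a \<Rightarrow> real" where
  "height x \<equiv> x \<bullet> e1"

lemma e_in_Basis: "e1 \<in> Basis" "e2 \<in> Basis" "e3 \<in> Basis" "e4 \<in> Basis"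
  by (simp_all add: Basis_eq)

lemma e_neq: "e1 \<noteq> e2" "e1 \<noteq> e3" "e1 \<noteq> e4" "e2 \<noteq> e3" "e2 \<noteq> e4" "e3 \<noteq> e4"
  "e2 \<noteq> e1" "e3 \<noteq> e1" "e4 \<noteq> e1" "e3 \<noteq> e2" "e4 \<noteq> e2" "e4 \<noteq> e3"
  using distinct_e by auto

lemma inner_e [simp]:
  "e1 \<bullet> e1 = 1" "e1 \<bullet> e2 = 0" "e1 \<bullet> e3 = 0" "e1 \<bullet> e4 = 0"
  "e2 \<bullet> e1 = 0" "e2 \<bullet> e2 = 1" "e2 \<bullet> e3 = 0" "e2 \<bullet> e4 = 0"
  "e3 \<bullet> e1 = 0" "e3 \<bullet> e2 = 0" "e3 \<bullet> e3 = 1" "e3 \<bullet> e4 = 0"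
  "e4 \<bullet> e1 = 0" "e4 \<bullet> e2 = 0" "e4 \<bullet> e3 = 0" "e4 \<bullet> e4 = 1"
  using e_in_Basis e_neq by (simp_all add: inner_Basis)

lemma ball_Basis_iff: "(\<forall>e\<in>Basis. P e) \<longleftrightarrow> P e1 \<and> P e2 \<and> P e3 \<and> P e4"
  by (simp add: Basis_eq)

lemma zero_iff_coordinates: "x = 0 \<longleftrightarrow> x \<bullet> e1 = 0 \<and> x \<bullet> e2 = 0 \<and> x \<bullet> e3 = 0 \<and> x \<bullet> e4 = 0"
  by (subst euclidean_all_zero_iff[symmetric]) (rule ball_Basis_iff)

definition of_coords :: "real \<Rightarrow> real \<Rightarrow> real \<Rightarrow> real \<Rightarrow> 'a" where
  "of_coords x1 x2 x3 x4 = x1 *\<^sub>R e1 + x2 *\<^sub>R e2 + x3 *\<^sub>R e3 + x4 *\<^sub>R e4"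

lemma inner_of_coords [simp]:
  "of_coords x1 x2 x3 x4 \<bullet> e1 = x1" "of_coords x1 x2 x3 x4 \<bullet> e2 = x2"
  "of_coords x1 x2 x3 x4 \<bullet> e3 = x3" "of_coords x1 x2 x3 x4 \<bullet> e4 = x4"
  by (simp_all add: of_coords_def inner_add_left)

lemma of_coords_eq_0_iff: "of_coords x1 x2 x3 x4 = 0 \<longleftrightarrow> x1 = 0 \<and> x2 = 0 \<and> x3 = 0 \<and> x4 = 0"
  by (subst zero_iff_coordinates) simp

lemma smooth_on_of_coords:
  assumes "smooth_on f1 S" "smooth_on f2 S" "smooth_on f3 S" "smooth_on f4 S"
  shows "smooth_on (\<lambda>x. of_coords (f1 x) (f2 x) (f3 x) (f4 x)) S"
  unfolding of_coords_def
  by (intro smooth_on_add smooth_on_scaleR assms smooth_on_const smooth_on_open[OF assms(1)])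

lemma has_derivative_of_coords:
  assumes "(f1 has_derivative f1') F" "(f2 has_derivative f2') F" "(f3 has_derivative f3') F" "(f4 has_derivative f4') F"
  shows "((\<lambda>x. of_coords (f1 x) (f2 x) (f3 x) (f4 x)) has_derivative
          (\<lambda>v. of_coords (f1' v) (f2' v) (f3' v) (f4' v))) F"
  unfolding of_coords_def by (intro has_derivative_add has_derivative_scaleR_left assms)

lemma A'_expand: "A' (s, t) = s * A' (1, 0) + t * A' (0, 1)"
  and B'_expand: "B' (s, t) = s * B' (1, 0)"
  using linear_real_pair[OF has_derivative_linear[OF der_A], of s t]
    linear_real_pair[OF has_derivative_linear[OF der_B], of s t] B'_2 by simp_all

lemma smooth_coordinate: "smooth_on (\<lambda>x. x \<bullet> e) UNIV"
  by (intro smooth_on_bounded_linear bounded_linear_inner_left open_UNIV)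

lemma smooth_base: "smooth_on f UNIV \<Longrightarrow> smooth_on (\<lambda>x. f (x \<bullet> e1, x \<bullet> e2)) UNIV"
  by (rule smooth_on_compose[OF _ smooth_on_Pair[OF smooth_coordinate smooth_coordinate] subset_UNIV])

lemma smooth_g: "smooth_on g UNIV"
  unfolding g_def [abs_def]
  by (intro smooth_on_add smooth_on_mult smooth_base smooth_coordinate smooth_A smooth_B)

lemma smooth_q: "smooth_on q UNIV"
  unfolding q_def [abs_def]
  by (intro smooth_on_diff smooth_on_add smooth_on_power2 smooth_coordinate smooth_on_const open_UNIV)

definition dA :: "real \<times> real \<Rightarrow> real \<times> real \<Rightarrow> real" where
  "dA y = frechet_derivative A (at y)"

definition dB :: "real \<times> real \<Rightarrow> real \<times> real \<Rightarrow> real" where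
  "dB y = frechet_derivative B (at y)"

lemma has_derivative_A: "(A has_derivative dA y) (at y)"
  and has_derivative_B: "(B has_derivative dB y) (at y)"
  unfolding dA_def dB_def
  by (rule smooth_on_has_derivative[OF smooth_A UNIV_I], rule smooth_on_has_derivative[OF smooth_B UNIV_I])

lemma dA_base: "dA (a1, a2) = A'" and dB_base: "dB (a1, a2) = B'"
  by (rule has_derivative_unique[OF has_derivative_A der_A], rule has_derivative_unique[OF has_derivative_B der_B])

definition dg :: "'a \<Rightarrow> 'a \<Rightarrow> real" where
  "dg x v = dA (x \<bullet> e1, x \<bullet> e2) (v \<bullet> e1, v \<bullet> e2) * (x \<bullet> e3) + A (x \<bullet> e1, x \<bullet> e2) * (v \<bullet> e3)
          + dB (x \<bullet> e1, x \<bullet> e2) (v \<bullet> e1, v \<bullet> e2) * (x \<bullet> e4) + B (x \<bullet> e1, x \<bullet> e2) * (v \<bullet> e4)"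

lemma has_derivative_base:
  assumes "(f has_derivative f') (at (x \<bullet> e1, x \<bullet> e2))"
  shows "((\<lambda>x. f (x \<bullet> e1, x \<bullet> e2)) has_derivative (\<lambda>v. f' (v \<bullet> e1, v \<bullet> e2))) (at x)"
proof -
  have "((\<lambda>x. (x \<bullet> e1, x \<bullet> e2)) has_derivative (\<lambda>v. (v \<bullet> e1, v \<bullet> e2))) (at x)"
    by (intro has_derivative_Pair has_derivative_inner_left has_derivative_ident)
  from has_derivative_compose[OF this assms] show ?thesis .
qed

lemma has_derivative_g: "(g has_derivative dg x) (at x)"
proof -
  have "(g has_derivative (\<lambda>v. (A (x \<bullet> e1, x \<bullet> e2) * (v \<bullet> e3) + dA (x \<bullet> e1, x \<bullet> e2) (v \<bullet> e1, v \<bullet> e2) * (x \<bullet> e3))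
      + (B (x \<bullet> e1, x \<bullet> e2) * (v \<bullet> e4) + dB (x \<bullet> e1, x \<bullet> e2) (v \<bullet> e1, v \<bullet> e2) * (x \<bullet> e4)))) (at x)"
    unfolding g_def [abs_def]
    by (intro has_derivative_add has_derivative_mult has_derivative_base has_derivative_A has_derivative_B
        has_derivative_inner_left has_derivative_ident)
  then show ?thesis by (simp add: dg_def [abs_def] add_ac)
qed

definition dq :: "'a \<Rightarrow> 'a \<Rightarrow> real" where
  "dq x v = 2 * ((x \<bullet> e3) * (v \<bullet> e3) + (x \<bullet> e4) * (v \<bullet> e4))"

lemma has_derivative_q: "(q has_derivative dq x) (at x)"
  unfolding q_def [abs_def] dq_def [abs_def]
  by (auto intro!: derivative_eq_intros simp: algebra_simps)

lemma continuous_on_coordinates: "continuous_on S (\<lambda>x. x \<bullet> e)"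
  by (intro continuous_intros)

lemma continuous_on_g: "continuous_on S g"
  using smooth_on_continuous[OF smooth_g] continuous_on_subset by blast

lemma continuous_on_q: "continuous_on S q"
  using smooth_on_continuous[OF smooth_q] continuous_on_subset by blast

lemma fold_not_on_edge: "x \<bullet> e2 = a2 \<Longrightarrow> \<not> on_edge x"
  using delta_pos by (auto simp: on_edge_def)

lemma base_zero_iff:
  assumes "x \<in> M"
  shows "A (x \<bullet> e1, x \<bullet> e2) = 0 \<and> B (x \<bullet> e1, x \<bullet> e2) = 0 \<longleftrightarrow> x \<bullet> e1 = a1 \<and> x \<bullet> e2 = a2"
  using nonzero[of "x \<bullet> e1" "x \<bullet> e2"] zero assms by (auto simp: M_def)

end

locale stratified_circle_constraint = circle_constraint +
  fixes \<sigma> :: "'a \<Rightarrow> 'l"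
  assumes label_iff: "\<And>x y. x \<in> M \<Longrightarrow> y \<in> M \<Longrightarrow>
    \<sigma> x = \<sigma> y \<longleftrightarrow> (g x = 0 \<longleftrightarrow> g y = 0) \<and> (on_edge x \<longleftrightarrow> on_edge y)"
begin

subsection \<open>Charts\<close>

text \<open>
  The distance to the edge \<open>x \<bullet> e2 = a2 + \<delta>\<close> or \<open>x \<bullet> e2 = a2 - \<delta>\<close> that contains \<open>p\<close>, signed so that it is
  nonnegative on the manifold.  It is used also for \<open>p\<close> off the edges, where it is just a shifted
  coordinate.
\<close>

definition edge_dist :: "'a \<Rightarrow> 'a \<Rightarrow> real" where
  "edge_dist p x = (if p \<bullet> e2 = a2 + \<delta> then p \<bullet> e2 - x \<bullet> e2 else x \<bullet> e2 - p \<bullet> e2)"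

text \<open>The points at which every strict inequality that holds at \<open>p\<close> still holds.\<close>

definition nbhd :: "'a \<Rightarrow> 'a set" where
  "nbhd p = {x. x \<bullet> e1 \<in> {a1 - \<delta><..<a1 + \<delta>} \<and> (p \<bullet> e2 \<noteq> a2 + \<delta> \<longrightarrow> x \<bullet> e2 < a2 + \<delta>) \<and>
                (p \<bullet> e2 \<noteq> a2 - \<delta> \<longrightarrow> a2 - \<delta> < x \<bullet> e2) \<and> (g p \<noteq> 0 \<longrightarrow> 0 < g x)}"

lemma open_nbhd: "open (nbhd p)"
proof -
  have less: "open {x. P \<longrightarrow> f x < c}" if "continuous_on UNIV f" for f :: "'a \<Rightarrow> real" and c P
    using open_Collect_less[OF that continuous_on_const] by (cases P) auto
  have gr: "open {x. P \<longrightarrow> c < f x}" if "continuous_on UNIV f" for f :: "'a \<Rightarrow> real" and c P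
    using open_Collect_less[OF continuous_on_const that] by (cases P) auto
  have "nbhd p = {x. True \<longrightarrow> a1 - \<delta> < x \<bullet> e1} \<inter> {x. True \<longrightarrow> x \<bullet> e1 < a1 + \<delta>} \<inter>
      {x. p \<bullet> e2 \<noteq> a2 + \<delta> \<longrightarrow> x \<bullet> e2 < a2 + \<delta>} \<inter> {x. p \<bullet> e2 \<noteq> a2 - \<delta> \<longrightarrow> a2 - \<delta> < x \<bullet> e2} \<inter>
      {x. g p \<noteq> 0 \<longrightarrow> 0 < g x}"
    by (auto simp: nbhd_def)
  also have "open \<dots>"
    by (intro open_Int less gr continuous_on_g continuous_on_coordinates)
  finally show ?thesis .
qed

lemma mem_nbhd: "p \<in> M \<Longrightarrow> p \<in> nbhd p"
  by (auto simp: M_def nbhd_def)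

lemma mem_M_nbhd_iff:
  assumes "p \<in> M" "x \<in> nbhd p"
  shows "x \<in> M \<longleftrightarrow> q x = 0 \<and> (on_edge p \<longrightarrow> 0 \<le> edge_dist p x) \<and> (g p = 0 \<longrightarrow> 0 \<le> g x)"
  using assms delta_pos by (auto simp: M_def nbhd_def on_edge_def edge_dist_def)

lemma label_nbhd_iff:
  assumes "p \<in> M" "x \<in> M \<inter> nbhd p" "y \<in> M \<inter> nbhd p"
  shows "\<sigma> x = \<sigma> y \<longleftrightarrow> (g p = 0 \<longrightarrow> (g x = 0 \<longleftrightarrow> g y = 0)) \<and>
           (on_edge p \<longrightarrow> (edge_dist p x = 0 \<longleftrightarrow> edge_dist p y = 0))"
proof -
  have "on_edge z \<longleftrightarrow> on_edge p \<and> edge_dist p z = 0" "g z = 0 \<Longrightarrow> g p = 0" if "z \<in> M \<inter> nbhd p" for z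
    using that assms(1) delta_pos by (auto simp: M_def nbhd_def on_edge_def edge_dist_def split: if_splits)
  then show ?thesis
    using label_iff[of x y] assms by auto
qed

lemma smooth_edge_dist: "smooth_on (edge_dist p) UNIV"
  and has_derivative_edge_dist:
    "(edge_dist p has_derivative (\<lambda>v. (if p \<bullet> e2 = a2 + \<delta> then -1 else 1) * (v \<bullet> e2))) (at x)"
proof -
  show "smooth_on (edge_dist p) UNIV"
    unfolding edge_dist_def [abs_def]
    by (cases "p \<bullet> e2 = a2 + \<delta>")
      (auto intro!: smooth_on_diff smooth_coordinate smooth_on_const)
  show "(edge_dist p has_derivative (\<lambda>v. (if p \<bullet> e2 = a2 + \<delta> then -1 else 1) * (v \<bullet> e2))) (at x)"
    unfolding edge_dist_def [abs_def]
    by (cases "p \<bullet> e2 = a2 + \<delta>") (auto intro!: derivative_eq_intros)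
qed

lemma ball_Basis_minus:
  "(\<forall>e\<in>Basis - {e1, e2, e4}. P e) \<longleftrightarrow> P e3" "(\<forall>e\<in>Basis - {e1, e2, e3}. P e) \<longleftrightarrow> P e4"
  using e_neq by (auto simp: Basis_eq)

text \<open>
  Away from the fold points \<open>x \<bullet> e1\<close> can be kept as a coordinate.  Where \<open>(A, B) \<noteq> 0\<close>, the boundary
  \<open>g = 0\<close> is transverse to the circle, since a unit vector orthogonal to \<open>(A, B)\<close> cannot turn without
  leaving the orthogonal line; thus \<open>g\<close> replaces the angle.  Where \<open>(A, B) = 0\<close> and \<open>x \<bullet> e3 \<noteq> 0\<close>, the
  derivative of \<open>g\<close> along \<open>e2\<close> is \<open>A\<^sub>2 * (x \<bullet> e3) \<noteq> 0\<close>, and \<open>g\<close> replaces \<open>x \<bullet> e2\<close>.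
\<close>

lemma regular_chart:
  assumes p: "p \<in> M" and reg: "\<not> is_fold p"
  obtains U V \<Phi> \<Psi> D C where "corner_chart M \<sigma> p U V \<Phi> \<Psi> D C" "card D = 3" "e1 \<in> D - C"
    "\<forall>x. \<Phi> x \<bullet> e1 = height x - height p" "card C = of_bool (g p = 0) + of_bool (on_edge p)"
proof -
  \<comment> \<open>A local substitute for the angle: the component along the tangent of the circle at \<open>p\<close>.\<close>
  define \<tau> where "\<tau> x = (p \<bullet> e3) * (x \<bullet> e4 - p \<bullet> e4) - (p \<bullet> e4) * (x \<bullet> e3 - p \<bullet> e3)" for x
  have sm_\<tau>: "smooth_on \<tau> UNIV"
    unfolding \<tau>_def [abs_def]
    by (intro smooth_on_diff smooth_on_mult smooth_coordinate smooth_on_const open_UNIV)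
  have d_\<tau>: "(\<tau> has_derivative (\<lambda>v. (p \<bullet> e3) * (v \<bullet> e4) - (p \<bullet> e4) * (v \<bullet> e3))) (at p)"
    unfolding \<tau>_def [abs_def] by (auto intro!: derivative_eq_intros)
  have sm_1: "smooth_on (\<lambda>x. height x - height p) UNIV"
    by (intro smooth_on_diff smooth_coordinate smooth_on_const open_UNIV)
  have d_1: "((\<lambda>x. height x - height p) has_derivative (\<lambda>v. v \<bullet> e1)) (at p)"
    by (auto intro!: derivative_eq_intros)
  have circ: "(p \<bullet> e3)\<^sup>2 + (p \<bullet> e4)\<^sup>2 = 1" and qp: "q p = 0" using p by (auto simp: M_def q_def)
  have [simp]: "\<tau> p = 0" "edge_dist p p = 0" by (simp_all add: \<tau>_def edge_dist_def)
  define E where "E = (if on_edge p then {e2} else {})"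
  show thesis
  proof (cases "g p = 0")
    case False
    let ?\<Phi> = "\<lambda>x. of_coords (height x - height p) (edge_dist p x) (q x) (\<tau> x)"
    obtain U V \<Psi> where ch: "corner_chart M \<sigma> p U V ?\<Phi> \<Psi> {e1, e2, e4} E"
    proof (rule corner_chart_exists[of ?\<Phi> "nbhd p" p _ E "{e1, e2, e4}" M \<sigma>])
      show "smooth_on ?\<Phi> (nbhd p)"
        by (rule smooth_on_subset[OF smooth_on_of_coords[OF sm_1 smooth_edge_dist smooth_q sm_\<tau>] open_nbhd subset_UNIV])
      show "(?\<Phi> has_derivative (\<lambda>v. of_coords (v \<bullet> e1) ((if p \<bullet> e2 = a2 + \<delta> then -1 else 1) * (v \<bullet> e2)) (dq p v)
          ((p \<bullet> e3) * (v \<bullet> e4) - (p \<bullet> e4) * (v \<bullet> e3)))) (at p)"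
        by (intro has_derivative_of_coords d_1 has_derivative_edge_dist has_derivative_q d_\<tau>)
      show "v = 0" if "of_coords (v \<bullet> e1) ((if p \<bullet> e2 = a2 + \<delta> then -1 else 1) * (v \<bullet> e2)) (dq p v)
          ((p \<bullet> e3) * (v \<bullet> e4) - (p \<bullet> e4) * (v \<bullet> e3)) = 0" for v
        using that radial_angular_zero[OF circ, of "v \<bullet> e3" "v \<bullet> e4"]
        by (auto simp: of_coords_eq_0_iff zero_iff_coordinates[of v] dq_def split: if_splits)
      show "x \<in> M \<longleftrightarrow> (\<forall>e\<in>Basis - {e1, e2, e4}. ?\<Phi> x \<bullet> e = 0) \<and> (\<forall>e\<in>E. 0 \<le> ?\<Phi> x \<bullet> e)" if "x \<in> nbhd p" for x
        unfolding ball_Basis_minus mem_M_nbhd_iff[OF p that] using False by (simp add: E_def)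
      show "\<sigma> x = \<sigma> y \<longleftrightarrow> (\<forall>e\<in>E. ?\<Phi> x \<bullet> e = 0 \<longleftrightarrow> ?\<Phi> y \<bullet> e = 0)" if "x \<in> M \<inter> nbhd p" "y \<in> M \<inter> nbhd p" for x y
        unfolding label_nbhd_iff[OF p that] using False by (simp add: E_def)
    qed (use mem_nbhd[OF p] qp in \<open>auto simp: of_coords_eq_0_iff E_def e_in_Basis\<close>)
    show thesis
      by (rule that[OF ch]) (use e_neq False in \<open>auto simp: E_def\<close>)
  next
    case g0: True
    show thesis
    proof (cases "p \<bullet> e1 = a1 \<and> p \<bullet> e2 = a2")
      case False
      let ?A = "A (p \<bullet> e1, p \<bullet> e2)" and ?B = "B (p \<bullet> e1, p \<bullet> e2)"
      let ?\<Phi> = "\<lambda>x. of_coords (height x - height p) (edge_dist p x) (q x) (g x)"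
      let ?C = "insert e4 E"
      obtain U V \<Psi> where ch: "corner_chart M \<sigma> p U V ?\<Phi> \<Psi> {e1, e2, e4} ?C"
      proof (rule corner_chart_exists[of ?\<Phi> "nbhd p" p _ ?C "{e1, e2, e4}" M \<sigma>])
        show "smooth_on ?\<Phi> (nbhd p)"
          by (rule smooth_on_subset[OF smooth_on_of_coords[OF sm_1 smooth_edge_dist smooth_q smooth_g] open_nbhd subset_UNIV])
        show "(?\<Phi> has_derivative (\<lambda>v. of_coords (v \<bullet> e1) ((if p \<bullet> e2 = a2 + \<delta> then -1 else 1) * (v \<bullet> e2)) (dq p v)
            (dg p v))) (at p)"
          by (intro has_derivative_of_coords d_1 has_derivative_edge_dist has_derivative_q has_derivative_g)
        show "v = 0" if "of_coords (v \<bullet> e1) ((if p \<bullet> e2 = a2 + \<delta> then -1 else 1) * (v \<bullet> e2)) (dq p v) (dg p v) = 0" for v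
        proof -
          have v12: "v \<bullet> e1 = 0" "v \<bullet> e2 = 0" and rad: "(p \<bullet> e3) * (v \<bullet> e3) + (p \<bullet> e4) * (v \<bullet> e4) = 0" and "dg p v = 0"
            using that by (auto simp: of_coords_eq_0_iff dq_def split: if_splits)
          have L0: "dA y (0, 0) = 0" "dB y (0, 0) = 0" for y
            using linear_0[OF has_derivative_linear[OF has_derivative_A]]
              linear_0[OF has_derivative_linear[OF has_derivative_B]] by (simp_all add: zero_prod_def)
          have tang: "?A * (v \<bullet> e3) + ?B * (v \<bullet> e4) = 0"
            using \<open>dg p v = 0\<close> by (simp add: dg_def v12 L0)
          have gp: "?A * (p \<bullet> e3) + ?B * (p \<bullet> e4) = 0" using g0 by (simp add: g_def)
          \<comment> \<open>As \<open>(A, B)\<close> is orthogonal to the unit vector of \<open>p\<close>, it is \<open>k\<close> times the tangent vector there.\<close>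
          define k where "k = ?B * (p \<bullet> e3) - ?A * (p \<bullet> e4)"
          have A: "?A = - k * (p \<bullet> e4)"
          proof -
            have "?A = ?A * ((p \<bullet> e3)\<^sup>2 + (p \<bullet> e4)\<^sup>2)" using circ by simp
            also have "\<dots> = (p \<bullet> e3) * (?A * (p \<bullet> e3) + ?B * (p \<bullet> e4)) - k * (p \<bullet> e4)"
              by (simp add: k_def algebra_simps power2_eq_square)
            finally show ?thesis using gp by simp
          qed
          have B: "?B = k * (p \<bullet> e3)"
          proof -
            have "?B = ?B * ((p \<bullet> e3)\<^sup>2 + (p \<bullet> e4)\<^sup>2)" using circ by simp
            also have "\<dots> = (p \<bullet> e4) * (?A * (p \<bullet> e3) + ?B * (p \<bullet> e4)) + k * (p \<bullet> e3)"
              by (simp add: k_def algebra_simps power2_eq_square)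
            finally show ?thesis using gp by simp
          qed
          have "k \<noteq> 0" using base_zero_iff[OF p] False A B by auto
          moreover have "k * ((p \<bullet> e3) * (v \<bullet> e4) - (p \<bullet> e4) * (v \<bullet> e3)) = ?A * (v \<bullet> e3) + ?B * (v \<bullet> e4)"
            by (subst A, subst B) (simp add: algebra_simps)
          ultimately have "(p \<bullet> e3) * (v \<bullet> e4) - (p \<bullet> e4) * (v \<bullet> e3) = 0" using tang by simp
          from radial_angular_zero[OF circ rad this] v12 show ?thesis by (simp add: zero_iff_coordinates[of v])
        qed
        show "x \<in> M \<longleftrightarrow> (\<forall>e\<in>Basis - {e1, e2, e4}. ?\<Phi> x \<bullet> e = 0) \<and> (\<forall>e\<in>?C. 0 \<le> ?\<Phi> x \<bullet> e)" if "x \<in> nbhd p" for x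
          unfolding ball_Basis_minus mem_M_nbhd_iff[OF p that] using g0 by (auto simp: E_def)
        show "\<sigma> x = \<sigma> y \<longleftrightarrow> (\<forall>e\<in>?C. ?\<Phi> x \<bullet> e = 0 \<longleftrightarrow> ?\<Phi> y \<bullet> e = 0)" if "x \<in> M \<inter> nbhd p" "y \<in> M \<inter> nbhd p" for x y
          unfolding label_nbhd_iff[OF p that] using g0 by (simp add: E_def)
      qed (use mem_nbhd[OF p] qp g0 in \<open>auto simp: of_coords_eq_0_iff E_def e_in_Basis\<close>)
      show thesis
        by (rule that[OF ch]) (use e_neq g0 in \<open>auto simp: E_def\<close>)
    next
      case base: True
      then have p3: "p \<bullet> e3 \<noteq> 0" using reg by (simp add: is_fold_def)
      have edge: "\<not> on_edge p" using fold_not_on_edge base by simp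
      let ?\<Phi> = "\<lambda>x. of_coords (height x - height p) (g x) (q x) (\<tau> x)"
      let ?C = "{e2}"
      obtain U V \<Psi> where ch: "corner_chart M \<sigma> p U V ?\<Phi> \<Psi> {e1, e2, e4} ?C"
      proof (rule corner_chart_exists[of ?\<Phi> "nbhd p" p _ ?C "{e1, e2, e4}" M \<sigma>])
        show "smooth_on ?\<Phi> (nbhd p)"
          by (rule smooth_on_subset[OF smooth_on_of_coords[OF sm_1 smooth_g smooth_q sm_\<tau>] open_nbhd subset_UNIV])
        show "(?\<Phi> has_derivative (\<lambda>v. of_coords (v \<bullet> e1) (dg p v) (dq p v)
            ((p \<bullet> e3) * (v \<bullet> e4) - (p \<bullet> e4) * (v \<bullet> e3)))) (at p)"
          by (intro has_derivative_of_coords d_1 has_derivative_g has_derivative_q d_\<tau>)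
        show "v = 0" if "of_coords (v \<bullet> e1) (dg p v) (dq p v)
            ((p \<bullet> e3) * (v \<bullet> e4) - (p \<bullet> e4) * (v \<bullet> e3)) = 0" for v
        proof -
          have "v \<bullet> e1 = 0" "dg p v = 0" "v \<bullet> e3 = 0" "v \<bullet> e4 = 0"
            using that radial_angular_zero[OF circ, of "v \<bullet> e3" "v \<bullet> e4"] by (auto simp: of_coords_eq_0_iff dq_def)
          moreover from this have "v \<bullet> e2 = 0"
            using base p3 A'_2 A'_expand[of 0 "v \<bullet> e2"] B'_expand[of 0 "v \<bullet> e2"]
            by (simp add: dg_def dA_base dB_base)
          ultimately show ?thesis by (simp add: zero_iff_coordinates[of v])
        qed
        show "x \<in> M \<longleftrightarrow> (\<forall>e\<in>Basis - {e1, e2, e4}. ?\<Phi> x \<bullet> e = 0) \<and> (\<forall>e\<in>?C. 0 \<le> ?\<Phi> x \<bullet> e)" if "x \<in> nbhd p" for x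
          unfolding ball_Basis_minus mem_M_nbhd_iff[OF p that] using g0 edge by simp
        show "\<sigma> x = \<sigma> y \<longleftrightarrow> (\<forall>e\<in>?C. ?\<Phi> x \<bullet> e = 0 \<longleftrightarrow> ?\<Phi> y \<bullet> e = 0)" if "x \<in> M \<inter> nbhd p" "y \<in> M \<inter> nbhd p" for x y
          unfolding label_nbhd_iff[OF p that] using g0 edge by simp
      qed (use mem_nbhd[OF p] qp g0 in \<open>auto simp: of_coords_eq_0_iff e_in_Basis\<close>)
      show thesis
        by (rule that[OF ch]) (use e_neq g0 edge in auto)
    qed
  qed
qed

text \<open>
  At a fold point only \<open>e1\<close> is available to straighten \<open>g\<close>, and \<open>x \<bullet> e3\<close> serves as the angle because
  \<open>x \<bullet> e4 = \<plusminus>1\<close>.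
\<close>

definition fold_coords :: "'a \<Rightarrow> 'a" where
  "fold_coords x = of_coords (g x) (x \<bullet> e2 - a2) (x \<bullet> e3) (q x)"

lemma has_derivative_fold_coords:
  "(fold_coords has_derivative (\<lambda>v. of_coords (dg x v) (v \<bullet> e2) (v \<bullet> e3) (dq x v))) (at x)"
proof -
  have "((\<lambda>x. x \<bullet> e2 - a2) has_derivative (\<lambda>v. v \<bullet> e2)) (at x)"
    by (auto intro!: derivative_eq_intros)
  then show ?thesis
    unfolding fold_coords_def [abs_def]
    by (intro has_derivative_of_coords has_derivative_g has_derivative_q
        has_derivative_inner_left has_derivative_ident)
qed

lemma fold_simps:
  assumes "is_fold p" "p \<in> M"
  shows "p \<bullet> e1 = a1" "p \<bullet> e2 = a2" "p \<bullet> e3 = 0" "p \<bullet> e4 \<noteq> 0" "g p = 0"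
    "dg p v = (v \<bullet> e1) * B' (1, 0) * (p \<bullet> e4)"
  using assms zero B'_expand[of "v \<bullet> e1" "v \<bullet> e2"] by (auto simp: is_fold_def M_def q_def g_def dg_def dA_base dB_base)

lemma fold_chart:
  assumes p: "p \<in> M" and fold: "is_fold p"
  obtains U V \<Psi> where "corner_chart M \<sigma> p U V fold_coords \<Psi> {e1, e2, e3} {e1}"
proof -
  note f = fold_simps[OF fold p]
  have edge: "\<not> on_edge p" using fold_not_on_edge f by simp
  show thesis
  proof (rule corner_chart_exists[of fold_coords "nbhd p" p _ "{e1}" "{e1, e2, e3}" M \<sigma>])
    show "smooth_on fold_coords (nbhd p)"
      unfolding fold_coords_def [abs_def]
      by (rule smooth_on_subset[OF _ open_nbhd subset_UNIV])
        (intro smooth_on_of_coords smooth_g smooth_q smooth_on_diff smooth_coordinate smooth_on_const open_UNIV)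
    show "(fold_coords has_derivative (\<lambda>v. of_coords (dg p v) (v \<bullet> e2) (v \<bullet> e3) (dq p v))) (at p)"
      by (rule has_derivative_fold_coords)
    show "v = 0" if "of_coords (dg p v) (v \<bullet> e2) (v \<bullet> e3) (dq p v) = 0" for v
      using that f B'_1 by (auto simp: of_coords_eq_0_iff dq_def zero_iff_coordinates[of v])
    show "x \<in> M \<longleftrightarrow> (\<forall>e\<in>Basis - {e1, e2, e3}. fold_coords x \<bullet> e = 0) \<and> (\<forall>e\<in>{e1}. 0 \<le> fold_coords x \<bullet> e)"
      if "x \<in> nbhd p" for x
      unfolding ball_Basis_minus mem_M_nbhd_iff[OF p that] using f edge by (simp add: fold_coords_def)
    show "\<sigma> x = \<sigma> y \<longleftrightarrow> (\<forall>e\<in>{e1}. fold_coords x \<bullet> e = 0 \<longleftrightarrow> fold_coords y \<bullet> e = 0)"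
      if "x \<in> M \<inter> nbhd p" "y \<in> M \<inter> nbhd p" for x y
      unfolding label_nbhd_iff[OF p that] using f edge by (simp add: fold_coords_def)
    show "fold_coords p = 0" using f p by (simp add: fold_coords_def of_coords_eq_0_iff M_def)
    show "corner_chart M \<sigma> p U V fold_coords \<Psi> {e1, e2, e3} {e1} \<Longrightarrow> thesis" for U V \<Psi>
      by (rule that)
  qed (use mem_nbhd[OF p] in \<open>auto simp: e_in_Basis\<close>)
qed

lemma chart_dimensions:
  assumes p: "p \<in> M"
  obtains U V \<Phi> \<Psi> D C where "corner_chart M \<sigma> p U V \<Phi> \<Psi> D C" "card D = 3"
    "card C = of_bool (g p = 0) + of_bool (on_edge p)"
proof (cases "is_fold p")
  case True
  obtain U V \<Psi> where ch: "corner_chart M \<sigma> p U V fold_coords \<Psi> {e1, e2, e3} {e1}"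
    by (rule fold_chart[OF p True])
  have "card {e1, e2, e3} = 3" using e_neq by simp
  moreover have "g p = 0" "\<not> on_edge p"
    using fold_simps(2,5)[OF True p] fold_not_on_edge by auto
  ultimately show thesis using that[OF ch] by simp
next
  case False
  obtain U V \<Phi> \<Psi> D C where "corner_chart M \<sigma> p U V \<Phi> \<Psi> D C" "card D = 3"
    "card C = of_bool (g p = 0) + of_bool (on_edge p)"
    by (rule regular_chart[OF p False])
  then show thesis by (rule that)
qed

lemma manifold_M: "manifold_with_corners 3 M \<sigma>"
  unfolding manifold_with_corners_def
proof
  fix p assume "p \<in> M"
  then obtain U V \<Phi> \<Psi> D C where "corner_chart M \<sigma> p U V \<Phi> \<Psi> D C" "card D = 3"
    by (rule chart_dimensions)
  then show "\<exists>U V \<Phi> \<Psi> D C. corner_chart M \<sigma> p U V \<Phi> \<Psi> D C \<and> card D = 3"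
    by (intro exI[of _ U] exI[of _ V] exI[of _ \<Phi>] exI[of _ \<Psi>] exI[of _ D] exI[of _ C] conjI)
qed

lemma dim_tangent_space_stratum:
  assumes p: "p \<in> M"
  shows "dim (tangent_space (stratum M \<sigma> p) p) = 3 - (of_bool (g p = 0) + of_bool (on_edge p))"
proof -
  obtain U V \<Phi> \<Psi> D C where ch: "corner_chart M \<sigma> p U V \<Phi> \<Psi> D C" "card D = 3"
    "card C = of_bool (g p = 0) + of_bool (on_edge p)"
    by (rule chart_dimensions[OF p])
  have "dim (tangent_space (stratum M \<sigma> p) p) = card (D - C)"
    by (rule dim_tangent_space_submanifold[OF corner_chart_stratum[OF ch(1)]])
  also have "\<dots> = card D - card C"
  proof (rule card_Diff_subset)
    show "finite C"
      using corner_chart_simps(9,10)[OF ch(1)] finite_subset[OF _ finite_Basis] by blast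
    show "C \<subseteq> D" by (rule corner_chart_simps(9)[OF ch(1)])
  qed
  finally show ?thesis using ch by simp
qed

subsection \<open>Critical points\<close>

lemma frechet_height: "frechet_derivative height (at x) v = v \<bullet> e1"
  by (rule frechet_derivative_at[THEN fun_cong, symmetric])
    (intro has_derivative_inner_left has_derivative_ident)

text \<open>
  At a fold point the differential of \<open>g\<close> is a nonzero multiple of \<open>x \<bullet> e1\<close>, so the tangent space of
  \<open>g = 0\<close> is orthogonal to \<open>e1\<close>.  At all other points \<open>x \<bullet> e1\<close> is a coordinate of the stratum.
\<close>

lemma critical_point_iff: "critical_point M \<sigma> height p \<longleftrightarrow> p \<in> M \<and> is_fold p"
proof
  assume crit: "critical_point M \<sigma> height p"
  then have p: "p \<in> M" by (simp add: critical_point_def)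
  have "is_fold p"
  proof (rule ccontr)
    assume "\<not> is_fold p"
    then obtain U V \<Phi> \<Psi> D C where
      ch: "corner_chart M \<sigma> p U V \<Phi> \<Psi> D C" "card D = 3" "e1 \<in> D - C"
        "\<forall>x. \<Phi> x \<bullet> e1 = height x - height p" "card C = of_bool (g p = 0) + of_bool (on_edge p)"
      by (rule regular_chart[OF p])
    have "\<not> critical_point M \<sigma> height p"
      by (rule not_critical_if_coordinate[OF ch(1,3), of _ "height p"]) (simp add: ch(4))
    then show False using crit by simp
  qed
  then show "p \<in> M \<and> is_fold p" using p by simp
next
  assume p: "p \<in> M \<and> is_fold p"
  obtain U V \<Psi> where ch: "corner_chart M \<sigma> p U V fold_coords \<Psi> {e1, e2, e3} {e1}"
    by (rule fold_chart[OF conjunct1[OF p] conjunct2[OF p]])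
  have "v \<bullet> e1 = 0" if "\<forall>e\<in>Basis - ({e1, e2, e3} - {e1}). frechet_derivative fold_coords (at p) v \<bullet> e = 0" for v
  proof -
    have "frechet_derivative fold_coords (at p) v \<bullet> e1 = 0"
      using that e_in_Basis(1) by simp
    moreover have "frechet_derivative fold_coords (at p) v = of_coords (dg p v) (v \<bullet> e2) (v \<bullet> e3) (dq p v)"
      by (rule frechet_derivative_at[OF has_derivative_fold_coords, THEN fun_cong, symmetric])
    ultimately have "dg p v = 0" by simp
    then show ?thesis using fold_simps[of p] p B'_1 by simp
  qed
  then show "critical_point M \<sigma> height p"
    unfolding critical_point_chart_iff[OF ch] frechet_height by blast
qed

end

context stratified_circle_constraint
begin

lemma span_e2_e3: "span {e2, e3} = {v. v \<bullet> e1 = 0 \<and> v \<bullet> e4 = 0}"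
proof -
  have "span {e2, e3} = {v. \<forall>e\<in>Basis. e \<notin> {e2, e3} \<longrightarrow> v \<bullet> e = 0}"
    using e_in_Basis by (intro span_substd_basis) auto
  also have "\<dots> = {v. v \<bullet> e1 = 0 \<and> v \<bullet> e4 = 0}"
    unfolding ball_Basis_iff using e_neq by auto
  finally show ?thesis .
qed

text \<open>
  On the boundary surface the identity \<open>g (\<Psi> y) = y \<bullet> e1\<close> is differentiated twice.  At a fold point \<open>g\<close>
  has only the first derivative \<open>B\<^sub>1 * (p \<bullet> e4)\<close> along \<open>e1\<close>, so the Hessian of the height is, up to this
  factor, minus the Hessian of \<open>g\<close> on the directions \<open>e2\<close> and \<open>e3\<close>.  There \<open>g\<^sub>3\<^sub>3 = 0\<close>, as \<open>g\<close> is linear in the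
  unit vector, and \<open>g\<^sub>2\<^sub>3 = A\<^sub>2 \<noteq> 0\<close>.  The entry \<open>\<nu>\<close> remains unspecified: an indefinite form arises
  whatever its value.
\<close>

lemma fold_hessian:
  assumes p: "p \<in> M" and fold: "is_fold p"
    and ch: "corner_chart M \<sigma> p U V fold_coords \<Psi> {e1, e2, e3} {e1}"
  obtains \<kappa> \<nu> where "\<kappa> \<noteq> 0"
    "\<And>u w. u \<in> span {e2, e3} \<Longrightarrow> w \<in> span {e2, e3} \<Longrightarrow>
       hessian (height \<circ> \<Psi>) 0 u w =
         \<kappa> * ((u \<bullet> e2) * (w \<bullet> e3) + (u \<bullet> e3) * (w \<bullet> e2)) + \<nu> * ((u \<bullet> e2) * (w \<bullet> e2))"
proof -
  note s = corner_chart_simps[OF ch] and f = fold_simps[OF fold p]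
  define D\<Psi> where "D\<Psi> y = frechet_derivative \<Psi> (at y)" for y
  have d\<Psi>: "(\<Psi> has_derivative D\<Psi> y) (at y)" if "y \<in> V" for y
    unfolding D\<Psi>_def by (rule smooth_on_has_derivative[OF s(3) that])
  have inv: "of_coords (dg (\<Psi> y) (D\<Psi> y v)) (D\<Psi> y v \<bullet> e2) (D\<Psi> y v \<bullet> e3) (dq (\<Psi> y) (D\<Psi> y v)) = v"
    if "y \<in> V" for y v
    using corner_chart_derivative_inverse(1)[OF ch that, of v]
    unfolding frechet_derivative_at[OF has_derivative_fold_coords, symmetric] D\<Psi>_def .
  have comp: "dg (\<Psi> y) (D\<Psi> y v) = v \<bullet> e1" "D\<Psi> y v \<bullet> e2 = v \<bullet> e2" "D\<Psi> y v \<bullet> e3 = v \<bullet> e3"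
    "dq (\<Psi> y) (D\<Psi> y v) = v \<bullet> e4" if "y \<in> V" for y v
    using arg_cong[OF inv[OF that, of v], of "\<lambda>x. x \<bullet> e1"] arg_cong[OF inv[OF that, of v], of "\<lambda>x. x \<bullet> e2"]
      arg_cong[OF inv[OF that, of v], of "\<lambda>x. x \<bullet> e3"] arg_cong[OF inv[OF that, of v], of "\<lambda>x. x \<bullet> e4"]
    unfolding inner_of_coords by auto
  have at0: "D\<Psi> 0 v \<bullet> e1 = 0" "D\<Psi> 0 v \<bullet> e4 = 0" if "v \<in> span {e2, e3}" for v
  proof -
    have v: "v \<bullet> e1 = 0" "v \<bullet> e4 = 0" using that by (simp_all add: span_e2_e3)
    show "D\<Psi> 0 v \<bullet> e1 = 0"
      using comp(1)[OF s(7), of v] v f B'_1 by (simp add: s(8))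
    show "D\<Psi> 0 v \<bullet> e4 = 0"
      using comp(4)[OF s(7), of v] v f by (simp add: s(8) dq_def)
  qed
  define dA1 where "dA1 y = dA y (1, 0)" for y
  define dA2 where "dA2 y = dA y (0, 1)" for y
  define dB1 where "dB1 y = dB y (1, 0)" for y
  define dB2 where "dB2 y = dB y (0, 1)" for y
  have sm: "smooth_on dA1 UNIV" "smooth_on dA2 UNIV" "smooth_on dB1 UNIV" "smooth_on dB2 UNIV"
    unfolding dA1_def [abs_def] dA2_def [abs_def] dB1_def [abs_def] dB2_def [abs_def] dA_def dB_def
    by (rule smooth_on_frechet_derivative[OF smooth_A] smooth_on_frechet_derivative[OF smooth_B])+
  have expand: "dA y (a, b) = a * dA1 y + b * dA2 y" "dB y (a, b) = a * dB1 y + b * dB2 y" for y a b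
    unfolding dA1_def dA2_def dB1_def dB2_def
    by (rule linear_real_pair[OF has_derivative_linear[OF has_derivative_A]],
        rule linear_real_pair[OF has_derivative_linear[OF has_derivative_B]])
  have base: "((\<lambda>y. F (\<Psi> y \<bullet> e1, \<Psi> y \<bullet> e2)) has_derivative
                (\<lambda>w. F' (D\<Psi> 0 w \<bullet> e1, D\<Psi> 0 w \<bullet> e2))) (at 0)"
    if "(F has_derivative F') (at (a1, a2))" for F F' :: "real \<times> real \<Rightarrow> real"
  proof -
    have "((\<lambda>x. F (x \<bullet> e1, x \<bullet> e2)) has_derivative (\<lambda>v. F' (v \<bullet> e1, v \<bullet> e2))) (at (\<Psi> 0))"
      by (rule has_derivative_base) (use that s(8) f in simp)
    from has_derivative_compose[OF d\<Psi>[OF s(7)] this] show ?thesis .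
  qed
  obtain dA1' where dA1': "(dA1 has_derivative dA1') (at (a1, a2))"
    using smooth_on_has_derivative[OF sm(1) UNIV_I] by metis
  obtain dA2' where dA2': "(dA2 has_derivative dA2') (at (a1, a2))"
    using smooth_on_has_derivative[OF sm(2) UNIV_I] by metis
  obtain dB1' where dB1': "(dB1 has_derivative dB1') (at (a1, a2))"
    using smooth_on_has_derivative[OF sm(3) UNIV_I] by metis
  obtain dB2' where dB2': "(dB2 has_derivative dB2') (at (a1, a2))"
    using smooth_on_has_derivative[OF sm(4) UNIV_I] by metis
  have d3: "((\<lambda>y. \<Psi> y \<bullet> e3) has_derivative (\<lambda>w. D\<Psi> 0 w \<bullet> e3)) (at 0)"
    and d4: "((\<lambda>y. \<Psi> y \<bullet> e4) has_derivative (\<lambda>w. D\<Psi> 0 w \<bullet> e4)) (at 0)"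
    using has_derivative_inner_left[OF d\<Psi>[OF s(7)]] by blast+
  define P1 where "P1 y = dA1 (\<Psi> y \<bullet> e1, \<Psi> y \<bullet> e2) * (\<Psi> y \<bullet> e3) + dB1 (\<Psi> y \<bullet> e1, \<Psi> y \<bullet> e2) * (\<Psi> y \<bullet> e4)" for y
  define P2 where "P2 y = dA2 (\<Psi> y \<bullet> e1, \<Psi> y \<bullet> e2) * (\<Psi> y \<bullet> e3) + dB2 (\<Psi> y \<bullet> e1, \<Psi> y \<bullet> e2) * (\<Psi> y \<bullet> e4)" for y
  define P1' where "P1' w =
      (dA1 (\<Psi> 0 \<bullet> e1, \<Psi> 0 \<bullet> e2) * (D\<Psi> 0 w \<bullet> e3) + dA1' (D\<Psi> 0 w \<bullet> e1, D\<Psi> 0 w \<bullet> e2) * (\<Psi> 0 \<bullet> e3)) +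
      (dB1 (\<Psi> 0 \<bullet> e1, \<Psi> 0 \<bullet> e2) * (D\<Psi> 0 w \<bullet> e4) + dB1' (D\<Psi> 0 w \<bullet> e1, D\<Psi> 0 w \<bullet> e2) * (\<Psi> 0 \<bullet> e4))" for w
  have P1': "(P1 has_derivative P1') (at 0)"
    unfolding P1_def [abs_def] P1'_def [abs_def]
    by (rule has_derivative_add[OF has_derivative_mult[OF base[OF dA1'] d3] has_derivative_mult[OF base[OF dB1'] d4]])
  define P2' where "P2' w =
      (dA2 (\<Psi> 0 \<bullet> e1, \<Psi> 0 \<bullet> e2) * (D\<Psi> 0 w \<bullet> e3) + dA2' (D\<Psi> 0 w \<bullet> e1, D\<Psi> 0 w \<bullet> e2) * (\<Psi> 0 \<bullet> e3)) +
      (dB2 (\<Psi> 0 \<bullet> e1, \<Psi> 0 \<bullet> e2) * (D\<Psi> 0 w \<bullet> e4) + dB2' (D\<Psi> 0 w \<bullet> e1, D\<Psi> 0 w \<bullet> e2) * (\<Psi> 0 \<bullet> e4))" for w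
  have P2': "(P2 has_derivative P2') (at 0)"
    unfolding P2_def [abs_def] P2'_def [abs_def]
    by (rule has_derivative_add[OF has_derivative_mult[OF base[OF dA2'] d3] has_derivative_mult[OF base[OF dB2'] d4]])
  have dA2_0: "dA2 (a1, a2) = A' (0, 1)" and dB2_0: "dB2 (a1, a2) = 0" and dB1_0: "dB1 (a1, a2) = B' (1, 0)"
    by (simp_all add: dA2_def dB2_def dB1_def dA_base dB_base B'_2)
  define \<rho> where "\<rho> = B' (1, 0) * (p \<bullet> e4)"
  define \<nu>' where "\<nu>' = dB2' (0, 1) * (p \<bullet> e4)"
  have lam: "\<rho> \<noteq> 0" using B'_1 f by (simp add: \<rho>_def)
  have P1_0: "P1 0 = \<rho>" by (simp add: P1_def s(8) f dB1_0 \<rho>_def)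
  have P2'_w: "P2' w = A' (0, 1) * (w \<bullet> e3) + (w \<bullet> e2) * \<nu>'" if w: "w \<in> span {e2, e3}" for w
  proof -
    have "dB2' (0, w \<bullet> e2) = (w \<bullet> e2) * dB2' (0, 1)"
      using linear_scale[OF has_derivative_linear[OF dB2'], of "w \<bullet> e2" "(0, 1)"] by simp
    then show ?thesis
      by (simp add: P2'_def s(8) f dA2_0 dB2_0 at0[OF w] comp[OF s(7)] \<nu>'_def)
  qed
  have hess: "hessian (height \<circ> \<Psi>) 0 u w * \<rho> =
      - A' (0, 1) * ((u \<bullet> e2) * (w \<bullet> e3) + (u \<bullet> e3) * (w \<bullet> e2)) - \<nu>' * ((u \<bullet> e2) * (w \<bullet> e2))"
    if u: "u \<in> span {e2, e3}" and w: "w \<in> span {e2, e3}" for u w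
  proof -
    have D\<Psi>u: "((\<lambda>y. D\<Psi> y u) has_derivative frechet_derivative (\<lambda>y. D\<Psi> y u) (at 0)) (at 0)"
      unfolding D\<Psi>_def by (rule smooth_on_has_derivative[OF smooth_on_frechet_derivative[OF s(3)] s(7)])
    define k' where "k' v = frechet_derivative (\<lambda>y. D\<Psi> y u) (at 0) v \<bullet> e1" for v
    define m' where "m' v = frechet_derivative (\<lambda>y. D\<Psi> y u) (at 0) v \<bullet> e4" for v
    have k': "((\<lambda>y. D\<Psi> y u \<bullet> e1) has_derivative k') (at 0)"
      and m': "((\<lambda>y. D\<Psi> y u \<bullet> e4) has_derivative m') (at 0)"
      unfolding k'_def [abs_def] m'_def [abs_def] using has_derivative_inner_left[OF D\<Psi>u] by blast+
    have hk: "hessian (height \<circ> \<Psi>) 0 u w = k' w"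
    proof -
      have "frechet_derivative (height \<circ> \<Psi>) (at y) u = D\<Psi> y u \<bullet> e1" if "y \<in> V" for y
      proof -
        have "((height \<circ> \<Psi>) has_derivative (\<lambda>v. D\<Psi> y v \<bullet> e1)) (at y)"
          unfolding comp_def by (rule has_derivative_inner_left[OF d\<Psi>[OF that]])
        from frechet_derivative_at[OF this, THEN fun_cong, of u] show ?thesis by simp
      qed
      then have "((\<lambda>y. frechet_derivative (height \<circ> \<Psi>) (at y) u) has_derivative k') (at 0)"
        by (intro has_derivative_transform_within_open[OF k' s(5,7)]) simp
      from frechet_derivative_at[OF this, THEN fun_cong, of w] show ?thesis
        by (simp add: hessian_def)
    qed
    \<comment> \<open>The derivative of \<open>g \<circ> \<Psi>\<close> along \<open>u\<close>, with the unknown first component of \<open>D\<Psi> y u\<close> kept apart.\<close>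
    define Z where "Z y = (D\<Psi> y u \<bullet> e1) * P1 y + (u \<bullet> e2) * P2 y + A (\<Psi> y \<bullet> e1, \<Psi> y \<bullet> e2) * (u \<bullet> e3)
        + B (\<Psi> y \<bullet> e1, \<Psi> y \<bullet> e2) * (D\<Psi> y u \<bullet> e4)" for y
    have Z0: "Z y = 0" if "y \<in> V" for y
    proof -
      have "u \<bullet> e1 = 0" using u by (simp add: span_e2_e3)
      then have "dg (\<Psi> y) (D\<Psi> y u) = 0" using comp(1)[OF that] by simp
      moreover have "dg (\<Psi> y) (D\<Psi> y u) = Z y"
        by (simp add: dg_def Z_def expand comp(2,3)[OF that] P1_def P2_def algebra_simps)
      ultimately show ?thesis by simp
    qed
    have "(Z has_derivative (\<lambda>w. ((D\<Psi> 0 u \<bullet> e1) * P1' w + k' w * P1 0) + (u \<bullet> e2) * P2' w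
        + A' (D\<Psi> 0 w \<bullet> e1, D\<Psi> 0 w \<bullet> e2) * (u \<bullet> e3)
        + (B (\<Psi> 0 \<bullet> e1, \<Psi> 0 \<bullet> e2) * m' w + B' (D\<Psi> 0 w \<bullet> e1, D\<Psi> 0 w \<bullet> e2) * (D\<Psi> 0 u \<bullet> e4)))) (at 0)"
      unfolding Z_def [abs_def]
      by (intro has_derivative_add has_derivative_mult[OF k' P1'] has_derivative_mult_right P2'
          has_derivative_mult_left has_derivative_mult[OF base[OF der_B] m'] base[OF der_A])
    moreover have "(Z has_derivative (\<lambda>w. 0)) (at 0)"
      by (rule has_derivative_transform_within_open[OF has_derivative_const s(5,7)]) (simp add: Z0)
    ultimately have "((D\<Psi> 0 u \<bullet> e1) * P1' w + k' w * P1 0) + (u \<bullet> e2) * P2' w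
        + A' (D\<Psi> 0 w \<bullet> e1, D\<Psi> 0 w \<bullet> e2) * (u \<bullet> e3)
        + (B (\<Psi> 0 \<bullet> e1, \<Psi> 0 \<bullet> e2) * m' w + B' (D\<Psi> 0 w \<bullet> e1, D\<Psi> 0 w \<bullet> e2) * (D\<Psi> 0 u \<bullet> e4)) = 0"
      using has_derivative_unique by (metis (no_types, lifting))
    then have "k' w * \<rho> + (u \<bullet> e2) * (A' (0, 1) * (w \<bullet> e3) + (w \<bullet> e2) * \<nu>') + (w \<bullet> e2) * A' (0, 1) * (u \<bullet> e3) = 0"
      using A'_expand[of 0 "w \<bullet> e2"]
      by (simp add: at0[OF u] at0[OF w] comp[OF s(7)] P1_0 P2'_w[OF w] s(8) f zero)
    then show ?thesis unfolding hk by (simp add: algebra_simps)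
  qed
  show thesis
  proof (rule that[of "- A' (0, 1) / \<rho>" "- \<nu>' / \<rho>"])
    show "- A' (0, 1) / \<rho> \<noteq> 0" using A'_2 lam by simp
    fix u w assume "u \<in> span {e2, e3}" "w \<in> span {e2, e3}"
    from hess[OF this] lam
    show "hessian (height \<circ> \<Psi>) 0 u w = - A' (0, 1) / \<rho> * ((u \<bullet> e2) * (w \<bullet> e3) + (u \<bullet> e3) * (w \<bullet> e2))
        + - \<nu>' / \<rho> * ((u \<bullet> e2) * (w \<bullet> e2))"
      by (simp add: divide_simps)
  qed
qed

lemma e23_minus: "{e1, e2, e3} - {e1} = {e2, e3}"
  using e_neq by auto

lemma fold_nondegenerate:
  assumes p: "p \<in> M" and fold: "is_fold p"
  shows "nondegenerate_at height (stratum M \<sigma> p) p"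
proof -
  obtain U V \<Psi> where ch: "corner_chart M \<sigma> p U V fold_coords \<Psi> {e1, e2, e3} {e1}"
    by (rule fold_chart[OF p fold])
  obtain \<kappa> \<nu> where k: "\<kappa> \<noteq> 0" and hess: "\<And>u w. u \<in> span {e2, e3} \<Longrightarrow> w \<in> span {e2, e3} \<Longrightarrow>
       hessian (height \<circ> \<Psi>) 0 u w =
         \<kappa> * ((u \<bullet> e2) * (w \<bullet> e3) + (u \<bullet> e3) * (w \<bullet> e2)) + \<nu> * ((u \<bullet> e2) * (w \<bullet> e2))"
    by (rule fold_hessian[OF p fold ch]) blast
  have "u = 0" if u: "u \<in> span {e2, e3}" and z: "\<forall>w\<in>span {e2, e3}. hessian (height \<circ> \<Psi>) 0 u w = 0" for u
  proof -
    have e: "e2 \<in> span {e2, e3}" "e3 \<in> span {e2, e3}" by (auto intro: span_base)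
    have "u \<bullet> e2 = 0" using hess[OF u e(2)] z e(2) k by simp
    moreover from this have "u \<bullet> e3 = 0" using hess[OF u e(1)] z e(1) k by simp
    ultimately show ?thesis using u by (simp add: span_e2_e3 zero_iff_coordinates[of u])
  qed
  then show ?thesis
    unfolding nondegenerate_at_def
    using corner_chart_stratum[OF ch] unfolding e23_minus by blast
qed

text \<open>
  The form \<open>2 \<kappa> u\<^sub>2 u\<^sub>3 + \<nu> u\<^sub>2\<^sup>2\<close> on a plane is negative on a suitable line, but vanishes at \<open>e3\<close>, hence
  is not negative definite on the whole plane.
\<close>

lemma fold_morse_index:
  assumes p: "p \<in> M" and fold: "is_fold p"
  shows "has_morse_index height (stratum M \<sigma> p) p 1"
proof -
  obtain U V \<Psi> where ch: "corner_chart M \<sigma> p U V fold_coords \<Psi> {e1, e2, e3} {e1}"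
    by (rule fold_chart[OF p fold])
  let ?H = "hessian (height \<circ> \<Psi>) 0"
  obtain \<kappa> \<nu> where k: "\<kappa> \<noteq> 0" and hess: "\<And>u w. u \<in> span {e2, e3} \<Longrightarrow> w \<in> span {e2, e3} \<Longrightarrow>
       ?H u w = \<kappa> * ((u \<bullet> e2) * (w \<bullet> e3) + (u \<bullet> e3) * (w \<bullet> e2)) + \<nu> * ((u \<bullet> e2) * (w \<bullet> e2))"
    by (rule fold_hessian[OF p fold ch]) blast
  let ?N = "{dim S | S. subspace S \<and> S \<subseteq> span {e2, e3} \<and> (\<forall>u\<in>S - {0}. ?H u u < 0)}"
  have dim2: "dim (span {e2, e3}) = 2"
    using e_neq e_in_Basis by (simp add: dim_eq_card_independent independent_substdbasis)
  have le1: "n \<le> 1" if n: "n \<in> ?N" for n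
  proof (rule ccontr)
    assume "\<not> n \<le> 1"
    obtain S where S: "n = dim S" "subspace S" "S \<subseteq> span {e2, e3}" and neg: "\<forall>u\<in>S - {0}. ?H u u < 0"
      using n by blast
    have "S = span {e2, e3}"
      by (rule subspace_dim_equal) (use S dim2 \<open>\<not> n \<le> 1\<close> in auto)
    then have "e3 \<in> S - {0}" using span_base[of e3 "{e2, e3}"] e_in_Basis nonzero_Basis by auto
    then have "?H e3 e3 < 0" using neg by (rule bspec[rotated])
    then show False using hess[of e3 e3] span_base[of e3 "{e2, e3}"] by simp
  qed
  \<comment> \<open>The component along \<open>e3\<close> is chosen so that the form takes the value \<open>-1\<close>.\<close>
  define v where "v = e2 - ((\<nu> + 1) / (2 * \<kappa>)) *\<^sub>R e3"
  have v: "v \<bullet> e1 = 0" "v \<bullet> e2 = 1" "v \<bullet> e3 = - ((\<nu> + 1) / (2 * \<kappa>))" "v \<bullet> e4 = 0"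
    by (simp_all add: v_def inner_diff_left)
  have "1 \<in> ?N"
  proof -
    have "?H u u < 0" if u: "u \<in> span {v} - {0}" for u
    proof -
      obtain c where c: "u = c *\<^sub>R v" "c \<noteq> 0" using u by (auto simp: span_singleton)
      have "u \<in> span {e2, e3}" by (simp add: span_e2_e3 c v)
      from hess[OF this this] have "?H u u = c\<^sup>2 * (2 * \<kappa> * (v \<bullet> e3) + \<nu>)"
        by (simp add: c(1) v(2) algebra_simps power2_eq_square)
      also have "2 * \<kappa> * (v \<bullet> e3) + \<nu> = - 1" using k by (simp add: v field_simps)
      finally have "?H u u = c\<^sup>2 * - 1" .
      moreover have "c\<^sup>2 * - 1 < 0" using c(2) by simp
      ultimately show ?thesis by (rule ord_eq_less_trans)
    qed
    moreover have "span {v} \<subseteq> span {e2, e3}" by (auto simp: span_singleton span_e2_e3 v)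
    moreover have "dim (span {v}) = 1"
    proof -
      have "v \<noteq> 0" using v(2) by auto
      then show ?thesis by (simp add: dim_eq_card_independent)
    qed
    ultimately show ?thesis by (intro CollectI exI[of _ "span {v}"]) simp
  qed
  moreover have "finite ?N" using le1 by (intro finite_subset[of ?N "{..1}"]) auto
  ultimately have "1 = Max ?N" using le1 by (intro Max_eqI[symmetric])
  then show ?thesis
    unfolding has_morse_index_def
    using corner_chart_stratum[OF ch] unfolding e23_minus by blast
qed

subsection \<open>The broken fibration\<close>

lemma compact_over_closed_interval:
  "compact {x. q x = 0 \<and> x \<bullet> e1 \<in> {a1 - \<delta>..a1 + \<delta>} \<and> x \<bullet> e2 \<in> {a2 - \<delta>..a2 + \<delta>} \<and> g x \<ge> 0}" (is "compact ?N")
proof -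
  have "?N = {x. q x = 0} \<inter> {x. a1 - \<delta> \<le> x \<bullet> e1} \<inter> {x. x \<bullet> e1 \<le> a1 + \<delta>} \<inter> {x. a2 - \<delta> \<le> x \<bullet> e2} \<inter>
      {x. x \<bullet> e2 \<le> a2 + \<delta>} \<inter> {x. 0 \<le> g x}" by auto
  also have "closed \<dots>"
    by (intro closed_Int closed_Collect_le closed_Collect_eq continuous_on_const continuous_on_g
        continuous_on_q continuous_on_coordinates)
  finally have "closed ?N" .
  moreover have "bounded ?N"
    unfolding bounded_iff
  proof (intro exI ballI)
    fix x assume x: "x \<in> ?N"
    then have "(x \<bullet> e3)\<^sup>2 + (x \<bullet> e4)\<^sup>2 = 1" by (simp add: q_def)
    then have "(x \<bullet> e3)\<^sup>2 \<le> 1" "(x \<bullet> e4)\<^sup>2 \<le> 1"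
      using zero_le_power2[of "x \<bullet> e3"] zero_le_power2[of "x \<bullet> e4"] by linarith+
    then have "\<bar>x \<bullet> e3\<bar> \<le> 1" "\<bar>x \<bullet> e4\<bar> \<le> 1" by (simp_all add: abs_square_le_1)
    moreover have "\<bar>x \<bullet> e1\<bar> \<le> \<bar>a1\<bar> + \<delta>" "\<bar>x \<bullet> e2\<bar> \<le> \<bar>a2\<bar> + \<delta>" using x by auto
    moreover have "norm x \<le> \<bar>x \<bullet> e1\<bar> + \<bar>x \<bullet> e2\<bar> + \<bar>x \<bullet> e3\<bar> + \<bar>x \<bullet> e4\<bar>"
      using norm_le_l1[of x] e_neq by (simp add: Basis_eq add_ac)
    ultimately show "norm x \<le> \<bar>a1\<bar> + \<bar>a2\<bar> + 2 * \<delta> + 2" by linarith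
  qed
  ultimately show ?thesis by (simp add: compact_eq_bounded_closed)
qed

text \<open>
  Over the closed interval the manifold is compact, and a continuous map on a compact space stays proper when
  it is restricted to the full preimage of the open interval.
\<close>

lemma proper_height: "proper_map (top_of_set M) (top_of_set {a1 - \<delta><..<a1 + \<delta>}) height"
proof -
  let ?N = "{x. q x = 0 \<and> x \<bullet> e1 \<in> {a1 - \<delta>..a1 + \<delta>} \<and> x \<bullet> e2 \<in> {a2 - \<delta>..a2 + \<delta>} \<and> g x \<ge> 0}"
  have "proper_map (top_of_set ?N) euclideanreal height"
  proof (rule continuous_imp_proper_map)
    show "compact_space (top_of_set ?N)"
      using compact_over_closed_interval by (simp add: compact_space_subtopology compactin_euclidean_iff)
    show "kc_space euclideanreal" by (simp add: Hausdorff_imp_kc_space)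
    show "continuous_map (top_of_set ?N) euclideanreal height"
      by (simp add: continuous_on_coordinates)
  qed
  then have "proper_map (subtopology (top_of_set ?N) M) (top_of_set {a1 - \<delta><..<a1 + \<delta>}) height"
    by (rule proper_map_restriction) (auto simp: M_def)
  moreover have "?N \<inter> M = M" by (auto simp: M_def)
  ultimately show ?thesis by (simp add: subtopology_subtopology)
qed

lemma image_height: "height ` M = {a1 - \<delta><..<a1 + \<delta>}"
proof
  show "height ` M \<subseteq> {a1 - \<delta><..<a1 + \<delta>}" by (auto simp: M_def)
  show "{a1 - \<delta><..<a1 + \<delta>} \<subseteq> height ` M"
  proof
    fix s assume s: "s \<in> {a1 - \<delta><..<a1 + \<delta>}"
    \<comment> \<open>One of two opposite unit vectors lies in the half-plane.\<close>
    let ?x = "of_coords s a2 0 (if B (s, a2) \<ge> 0 then 1 else -1)"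
    have "?x \<in> M" using s delta_pos by (auto simp: M_def q_def g_def)
    then show "s \<in> height ` M" by (intro image_eqI[of _ _ ?x]) simp_all
  qed
qed

lemma e1_tangent_interior:
  assumes x: "x \<in> M" and pos: "g x \<noteq> 0" and edge: "\<not> on_edge x"
  shows "e1 \<in> tangent_space (stratum M \<sigma> x) x"
proof -
  let ?c = "\<lambda>t::real. x + t *\<^sub>R e1"
  have "open (?c -` nbhd x)" by (intro open_vimage open_nbhd continuous_intros)
  moreover have "0 \<in> ?c -` nbhd x" using mem_nbhd[OF x] by simp
  ultimately obtain \<epsilon> where \<epsilon>: "\<epsilon> > 0" "ball 0 \<epsilon> \<subseteq> ?c -` nbhd x"
    by (metis open_contains_ball)
  have ball: "ball 0 \<epsilon> = {-\<epsilon><..<\<epsilon>}" by (auto simp: dist_real_def)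
  have "?c t \<in> stratum M \<sigma> x" if "t \<in> {-\<epsilon><..<\<epsilon>}" for t
  proof -
    have c: "?c t \<in> nbhd x" using \<epsilon> that ball by auto
    have "q (?c t) = q x" by (simp add: q_def inner_add_left)
    then have cM: "?c t \<in> M"
      unfolding mem_M_nbhd_iff[OF x c] using x pos edge by (simp add: M_def)
    then show ?thesis
      using label_nbhd_iff[OF x, of "?c t" x] c mem_nbhd[OF x] x pos edge by (simp add: stratum_def)
  qed
  moreover have "smooth_on ?c {-\<epsilon><..<\<epsilon>}"
    by (intro smooth_on_add smooth_on_const smooth_on_bounded_linear bounded_linear_scaleR_left) auto
  moreover have "(?c has_vector_derivative e1) (at 0)"
    by (auto intro!: derivative_eq_intros)
  ultimately show ?thesis
    unfolding tangent_space_def using \<epsilon>(1) by (auto intro!: exI[of _ ?c] exI[of _ \<epsilon>])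
qed

text \<open>
  A stratum of dimension greater than two is the open one.  All its tangent spaces contain \<open>e1\<close>, and
  so does any limit of them.
\<close>

lemma fold_limit_condition:
  assumes p: "p \<in> M" and fold: "is_fold p"
    and X: "\<And>j. X j \<in> stratum M \<sigma> (X 0)"
    and dims: "\<And>j. dim (tangent_space (stratum M \<sigma> p) p) < dim (tangent_space (stratum M \<sigma> (X j)) (X j))"
    and lim: "subspace_limit (\<lambda>j. tangent_space (stratum M \<sigma> (X j)) (X j)) L"
  shows "e1 \<in> L"
proof -
  have XM: "X j \<in> M" for j using X[of j] by (simp add: stratum_def)
  have "dim (tangent_space (stratum M \<sigma> p) p) = 2"
    using dim_tangent_space_stratum[OF p] fold_simps[OF fold p] fold_not_on_edge by simp
  then have pos: "g (X j) \<noteq> 0" and edge: "\<not> on_edge (X j)" for j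
    using dims[of j] dim_tangent_space_stratum[OF XM[of j]] by (auto simp: of_bool_def split: if_splits)
  have tan: "e1 \<in> tangent_space (stratum M \<sigma> (X j)) (X j)" for j
    by (rule e1_tangent_interior[OF XM pos edge])
  have "(\<lambda>j. closest_point (tangent_space (stratum M \<sigma> (X j)) (X j)) e1) \<longlonglongrightarrow> closest_point L e1"
    using lim by (simp add: subspace_limit_def)
  then have "(\<lambda>j. e1) \<longlonglongrightarrow> closest_point L e1"
    by (simp add: closest_point_self[OF tan])
  then have "closest_point L e1 = e1" by (simp add: LIMSEQ_const_iff)
  moreover have "closest_point L e1 \<in> L"
    using lim by (intro closest_point_in_set closed_subspace) (auto simp: subspace_limit_def dest: subspace_0)
  ultimately show ?thesis by simp
qed

lemma morse_height: "morse M \<sigma> height {a1 - \<delta><..<a1 + \<delta>}"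
  unfolding morse_def
proof (intro conjI allI impI)
  show "\<exists>U. M \<subseteq> U \<and> smooth_on height U" using smooth_coordinate by blast
  show "proper_map (top_of_set M) (top_of_set {a1 - \<delta><..<a1 + \<delta>}) height" by (rule proper_height)
  show "nondegenerate_at height (stratum M \<sigma> p) p" if "critical_point M \<sigma> height p" for p
    using that fold_nondegenerate by (simp add: critical_point_iff)
next
  fix p X L
  assume *: "critical_point M \<sigma> height p \<and> (\<forall>j. X j \<in> stratum M \<sigma> (X 0)) \<and> X \<longlonglongrightarrow> p \<and>
    (\<forall>j. dim (tangent_space (stratum M \<sigma> p) p) < dim (tangent_space (stratum M \<sigma> (X j)) (X j))) \<and>
    subspace_limit (\<lambda>j. tangent_space (stratum M \<sigma> (X j)) (X j)) L"
  then have "e1 \<in> L"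
    using fold_limit_condition[of p X L] by (simp add: critical_point_iff)
  then show "\<exists>v\<in>L. frechet_derivative height (at p) v \<noteq> 0"
    by (intro bexI[of _ e1]) (simp_all add: frechet_height)
qed

theorem broken_fibration_height: "broken_fibration 3 M \<sigma> height {a1 - \<delta><..<a1 + \<delta>}"
  unfolding broken_fibration_def
  using manifold_M image_height morse_height by (simp add: is_interval_oo)

theorem critical_points_height:
  "{p. critical_point M \<sigma> height p} = {of_coords a1 a2 0 1, of_coords a1 a2 0 (-1)}"
proof -
  have "p \<in> M \<and> is_fold p \<longleftrightarrow> p = of_coords a1 a2 0 1 \<or> p = of_coords a1 a2 0 (-1)" for p
  proof
    assume *: "p \<in> M \<and> is_fold p"
    then have "(p \<bullet> e4)\<^sup>2 = 1" by (auto simp: M_def is_fold_def q_def)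
    then have "p \<bullet> e4 = 1 \<or> p \<bullet> e4 = -1" by (simp add: power2_eq_1_iff)
    moreover have "p = of_coords a1 a2 0 (p \<bullet> e4)"
      using * zero_iff_coordinates[of "p - of_coords a1 a2 0 (p \<bullet> e4)"]
      by (simp add: is_fold_def inner_diff_left)
    ultimately show "p = of_coords a1 a2 0 1 \<or> p = of_coords a1 a2 0 (-1)" by metis
  next
    assume "p = of_coords a1 a2 0 1 \<or> p = of_coords a1 a2 0 (-1)"
    then show "p \<in> M \<and> is_fold p"
      using delta_pos zero by (auto simp: M_def is_fold_def q_def g_def)
  qed
  then show ?thesis by (auto simp: critical_point_iff)
qed

end

section \<open>The frame of a knot\<close>

lemma smooth_on_has_vector_derivative:
  assumes "smooth_on f UNIV"
  shows "(f has_vector_derivative vector_derivative f (at s)) (at (s :: real))"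
proof -
  have "f differentiable at s"
    by (rule differentiableI[OF smooth_on_has_derivative[OF assms UNIV_I]])
  then show ?thesis by (simp add: vector_derivative_works)
qed

lemma smooth_on_vector_derivative:
  assumes "smooth_on f (UNIV :: real set)"
  shows "smooth_on (\<lambda>s. vector_derivative f (at s)) UNIV"
proof (rule smooth_on_cong[OF smooth_on_frechet_derivative[OF assms, of 1]])
  fix s :: real
  show "frechet_derivative f (at s) 1 = vector_derivative f (at s)"
    using frechet_derivative_at[OF smooth_on_has_vector_derivative[OF assms, of s, unfolded has_vector_derivative_def],
        THEN fun_cong, of 1] by simp
qed

lemma has_real_derivative_inner:
  fixes f g :: "real \<Rightarrow> 'a::real_inner"
  assumes "(f has_vector_derivative f') (at s)" "(g has_vector_derivative g') (at s)"
  shows "((\<lambda>s. f s \<bullet> g s) has_real_derivative (f s \<bullet> g' + f' \<bullet> g s)) (at s)"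
  unfolding has_field_derivative_def
  by (rule has_derivative_eq_rhs[OF has_derivative_inner[OF assms[unfolded has_vector_derivative_def]]])
    (auto simp: fun_eq_iff algebra_simps)

lemma inner_derivative_of_constant:
  fixes f g :: "real \<Rightarrow> 'a::real_inner"
  assumes "(f has_vector_derivative f') (at s)" "(g has_vector_derivative g') (at s)"
    and "\<And>s. f s \<bullet> g s = c"
  shows "f s \<bullet> g' = - (f' \<bullet> g s)"
proof -
  have "((\<lambda>s. c) has_real_derivative (f s \<bullet> g' + f' \<bullet> g s)) (at s)"
    using has_real_derivative_inner[OF assms(1,2)] assms(3) by simp
  then have "f s \<bullet> g' + f' \<bullet> g s = 0"
    using DERIV_unique[OF _ DERIV_const] by blast
  then show ?thesis by simp
qed

text \<open>
  The remainder of the expansion is orthogonal to all three vectors; by Lagrange's identity its cross product with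
  \<open>t \<times> n\<close> vanishes too, and a vector with zero inner and zero cross product with a unit vector is zero.
\<close>

lemma orthonormal_frame_expansion:
  fixes t n w :: "real^3"
  assumes "t \<bullet> t = 1" "n \<bullet> n = 1" "t \<bullet> n = 0"
  shows "w = (w \<bullet> t) *\<^sub>R t + (w \<bullet> n) *\<^sub>R n + (w \<bullet> cross3 t n) *\<^sub>R cross3 t n"
proof -
  let ?b = "cross3 t n"
  have bt: "?b \<bullet> t = 0" "?b \<bullet> n = 0" "t \<bullet> ?b = 0" "n \<bullet> ?b = 0" by (simp_all add: dot_cross_self)
  have nt: "n \<bullet> t = 0" using assms(3) by (simp add: inner_commute)
  have "(norm ?b)\<^sup>2 + (t \<bullet> n)\<^sup>2 = (norm t * norm n)\<^sup>2" by (rule norm_cross_dot)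
  then have bb: "?b \<bullet> ?b = 1"
    using assms by (simp add: power_mult_distrib power2_norm_eq_inner)
  define r where "r = w - ((w \<bullet> t) *\<^sub>R t + (w \<bullet> n) *\<^sub>R n + (w \<bullet> ?b) *\<^sub>R ?b)"
  have r: "r \<bullet> t = 0" "r \<bullet> n = 0" "r \<bullet> ?b = 0"
    by (simp_all add: r_def inner_diff_left inner_add_left assms nt bt bb)
  have "cross3 r ?b = 0" using r by (simp add: Lagrange)
  moreover have "(norm (cross3 r ?b))\<^sup>2 + (r \<bullet> ?b)\<^sup>2 = (norm r * norm ?b)\<^sup>2" by (rule norm_cross_dot)
  ultimately have "r \<bullet> r = 0"
    using r(3) bb by (simp add: power_mult_distrib power2_norm_eq_inner)
  then show ?thesis by (simp add: r_def)
qed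

locale regular_knot =
  fixes T :: real and \<gamma> :: "real \<Rightarrow> real^3"
  assumes knot: "smooth_knot T \<gamma>" and curved: "\<And>s. acceleration \<gamma> s \<noteq> 0"
begin

abbreviation "tng \<equiv> velocity \<gamma>"
abbreviation "acc \<equiv> acceleration \<gamma>"
abbreviation "nor \<equiv> principal_normal \<gamma>"
abbreviation "bin \<equiv> binormal \<gamma>"

lemma T_pos: "T > 0" and smooth_\<gamma>: "smooth_on \<gamma> UNIV"
  and eq_iff: "\<gamma> s = \<gamma> t \<longleftrightarrow> [s = t] (rmod T)" and norm_tng: "norm (tng s) = 1"
  using knot by (auto simp: smooth_knot_def)

lemma smooth_tng: "smooth_on tng UNIV"
  unfolding velocity_def [abs_def] by (rule smooth_on_vector_derivative[OF smooth_\<gamma>])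

lemma smooth_acc: "smooth_on acc UNIV"
  unfolding acceleration_def [abs_def] by (rule smooth_on_vector_derivative[OF smooth_tng])

text \<open>Positive curvature is what makes the normalisation \<open>(acc \<bullet> acc) powr (- 1/2)\<close> smooth.\<close>

lemma smooth_nor: "smooth_on nor UNIV"
proof -
  have "smooth_on (\<lambda>s. (acc s \<bullet> acc s) powr (- (1/2))) UNIV"
    by (rule smooth_on_compose[OF smooth_on_powr smooth_on_inner[OF smooth_acc smooth_acc]])
      (use curved in auto)
  from smooth_on_scaleR[OF this smooth_acc] show ?thesis
  proof (rule smooth_on_cong)
    fix s
    have "(acc s \<bullet> acc s) powr (- (1/2)) = inverse (sqrt (acc s \<bullet> acc s))"
      using powr_half_sqrt[of "acc s \<bullet> acc s"] by (simp add: powr_minus)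
    then show "(acc s \<bullet> acc s) powr (- (1/2)) *\<^sub>R acc s = nor s"
      by (simp add: principal_normal_def norm_eq_sqrt_inner)
  qed
qed

lemma smooth_bin: "smooth_on bin UNIV"
  unfolding binormal_def [abs_def]
  by (rule bounded_bilinear.smooth_on_prod[OF bilinear_cross[unfolded bilinear_conv_bounded_bilinear]
        smooth_tng smooth_nor])

definition nor' :: "real \<Rightarrow> real^3" where "nor' s = vector_derivative nor (at s)"
definition bin' :: "real \<Rightarrow> real^3" where "bin' s = vector_derivative bin (at s)"

lemma has_vector_derivative_frame:
  "(\<gamma> has_vector_derivative tng s) (at s)" "(tng has_vector_derivative acc s) (at s)"
  "(nor has_vector_derivative nor' s) (at s)" "(bin has_vector_derivative bin' s) (at s)"
  unfolding velocity_def[of \<gamma> s] acceleration_def nor'_def bin'_def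
  by (rule smooth_on_has_vector_derivative, rule smooth_\<gamma> smooth_tng smooth_nor smooth_bin)+

lemma tng_tng: "tng s \<bullet> tng s = 1"
  by (simp add: dot_square_norm norm_tng)

lemma tng_acc: "tng s \<bullet> acc s = 0"
  using inner_derivative_of_constant[OF has_vector_derivative_frame(2,2) tng_tng, of s]
    inner_commute[of "tng s" "acc s"] by linarith

lemma frame_inner:
  "nor s \<bullet> nor s = 1" "tng s \<bullet> nor s = 0" "tng s \<bullet> bin s = 0" "acc s \<bullet> bin s = 0" "acc s \<bullet> nor s = norm (acc s)"
proof -
  have pos: "norm (acc s) \<noteq> 0" using curved[of s] by simp
  have nor: "nor s = inverse (norm (acc s)) *\<^sub>R acc s" by (simp add: principal_normal_def)
  show "tng s \<bullet> nor s = 0" by (simp add: nor tng_acc)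
  show "tng s \<bullet> bin s = 0" by (simp add: binormal_def dot_cross_self)
  have "nor s \<bullet> bin s = 0" by (simp add: binormal_def dot_cross_self)
  then show "acc s \<bullet> bin s = 0" using pos by (simp add: nor)
  have "acc s \<bullet> nor s = inverse (norm (acc s)) * (norm (acc s))\<^sup>2"
    by (simp add: nor power2_norm_eq_inner)
  then show "acc s \<bullet> nor s = norm (acc s)"
    using pos by (simp add: power2_eq_square)
  moreover have "nor s \<bullet> nor s = inverse (norm (acc s)) * (acc s \<bullet> nor s)"
    by (subst (1) nor) simp
  ultimately show "nor s \<bullet> nor s = 1" using pos by simp
qed

text \<open>The tangential components of the Frenet equations.\<close>

lemma frenet_tangential: "tng s \<bullet> nor' s = - norm (acc s)" "tng s \<bullet> bin' s = 0"
  using inner_derivative_of_constant[OF has_vector_derivative_frame(2,3) frame_inner(2), of s]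
    inner_derivative_of_constant[OF has_vector_derivative_frame(2,4) frame_inner(3), of s]
  by (simp_all add: frame_inner)

lemma frame_expansion: "w = (w \<bullet> tng s) *\<^sub>R tng s + (w \<bullet> nor s) *\<^sub>R nor s + (w \<bullet> bin s) *\<^sub>R bin s"
  unfolding binormal_def by (rule orthonormal_frame_expansion[OF tng_tng frame_inner(1,2)])

text \<open>
  In both functions the first parameter is that of the free point, and the second one is that of the point whose
  frame is used, the point of tangency of a special pair.
\<close>

definition chord_n :: "real \<times> real \<Rightarrow> real" where "chord_n y = (\<gamma> (snd y) - \<gamma> (fst y)) \<bullet> nor (snd y)"
definition chord_b :: "real \<times> real \<Rightarrow> real" where "chord_b y = (\<gamma> (snd y) - \<gamma> (fst y)) \<bullet> bin (snd y)"

lemma smooth_fst: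
  assumes "smooth_on f UNIV"
  shows "smooth_on (\<lambda>y. f (fst y)) (UNIV :: (real \<times> real) set)"
  by (rule smooth_on_compose[OF assms smooth_on_bounded_linear[OF open_UNIV bounded_linear_fst] subset_UNIV])

lemma smooth_snd:
  assumes "smooth_on f UNIV"
  shows "smooth_on (\<lambda>y. f (snd y)) (UNIV :: (real \<times> real) set)"
  by (rule smooth_on_compose[OF assms smooth_on_bounded_linear[OF open_UNIV bounded_linear_snd] subset_UNIV])

lemma smooth_chord_n: "smooth_on chord_n UNIV" and smooth_chord_b: "smooth_on chord_b UNIV"
  unfolding chord_n_def [abs_def] chord_b_def [abs_def]
  by (intro smooth_on_inner smooth_on_diff smooth_snd[OF smooth_\<gamma>] smooth_fst[OF smooth_\<gamma>]
      smooth_snd[OF smooth_nor] smooth_snd[OF smooth_bin])+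

lemma has_derivative_chord_component:
  assumes f: "(f has_vector_derivative f') (at c)"
  shows "((\<lambda>y. (\<gamma> (snd y) - \<gamma> (fst y)) \<bullet> f (snd y)) has_derivative
    (\<lambda>v. snd v * ((\<gamma> c - \<gamma> a) \<bullet> f' + tng c \<bullet> f c) - fst v * (tng a \<bullet> f c))) (at (a, c))"
proof -
  have 1: "((\<lambda>y. h (fst y)) has_derivative (\<lambda>v. fst v *\<^sub>R h')) (at (a, c))"
    if "(h has_vector_derivative h') (at a)" for h :: "real \<Rightarrow> real^3" and h'
  proof -
    have "(h has_derivative (\<lambda>t. t *\<^sub>R h')) (at (fst (a, c)))"
      using that by (simp add: has_vector_derivative_def)
    from has_derivative_compose[OF has_derivative_fst[OF has_derivative_ident] this] show ?thesis .
  qed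
  have 2: "((\<lambda>y. h (snd y)) has_derivative (\<lambda>v. snd v *\<^sub>R h')) (at (a, c))"
    if "(h has_vector_derivative h') (at c)" for h :: "real \<Rightarrow> real^3" and h'
  proof -
    have "(h has_derivative (\<lambda>t. t *\<^sub>R h')) (at (snd (a, c)))"
      using that by (simp add: has_vector_derivative_def)
    from has_derivative_compose[OF has_derivative_snd[OF has_derivative_ident] this] show ?thesis .
  qed
  have "((\<lambda>y. (\<gamma> (snd y) - \<gamma> (fst y)) \<bullet> f (snd y)) has_derivative
    (\<lambda>v. (\<gamma> (snd (a, c)) - \<gamma> (fst (a, c))) \<bullet> (snd v *\<^sub>R f') + (snd v *\<^sub>R tng c - fst v *\<^sub>R tng a) \<bullet> f (snd (a, c)))) (at (a, c))"
    by (intro has_derivative_inner has_derivative_diff 1[OF has_vector_derivative_frame(1)]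
        2[OF has_vector_derivative_frame(1)] 2[OF f])
  then show ?thesis
    by (simp add: inner_diff_left algebra_simps)
qed

definition chord_n' :: "real \<Rightarrow> real \<Rightarrow> real \<times> real \<Rightarrow> real" where
  "chord_n' a c v = snd v * ((\<gamma> c - \<gamma> a) \<bullet> nor' c + tng c \<bullet> nor c) - fst v * (tng a \<bullet> nor c)"
definition chord_b' :: "real \<Rightarrow> real \<Rightarrow> real \<times> real \<Rightarrow> real" where
  "chord_b' a c v = snd v * ((\<gamma> c - \<gamma> a) \<bullet> bin' c + tng c \<bullet> bin c) - fst v * (tng a \<bullet> bin c)"

lemma has_derivative_chord_n: "(chord_n has_derivative chord_n' a c) (at (a, c))"
  and has_derivative_chord_b: "(chord_b has_derivative chord_b' a c) (at (a, c))"
  unfolding chord_n_def [abs_def] chord_b_def [abs_def] chord_n'_def [abs_def] chord_b'_def [abs_def]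
  by (rule has_derivative_chord_component[OF has_vector_derivative_frame(3)],
      rule has_derivative_chord_component[OF has_vector_derivative_frame(4)])

lemma chord_components_zero_iff:
  "chord_n (s, t) = 0 \<and> chord_b (s, t) = 0 \<longleftrightarrow> \<gamma> s \<in> tangent_line \<gamma> t"
proof
  assume *: "chord_n (s, t) = 0 \<and> chord_b (s, t) = 0"
  then have "\<gamma> t - \<gamma> s = ((\<gamma> t - \<gamma> s) \<bullet> tng t) *\<^sub>R tng t"
    using frame_expansion[of "\<gamma> t - \<gamma> s" t] by (simp add: chord_n_def chord_b_def)
  then have "\<gamma> s = \<gamma> t + (- ((\<gamma> t - \<gamma> s) \<bullet> tng t)) *\<^sub>R tng t"
    by (simp add: algebra_simps)
  then show "\<gamma> s \<in> tangent_line \<gamma> t" unfolding tangent_line_def by blast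
next
  assume "\<gamma> s \<in> tangent_line \<gamma> t"
  then obtain x where "\<gamma> s = \<gamma> t + x *\<^sub>R tng t" by (auto simp: tangent_line_def)
  then show "chord_n (s, t) = 0 \<and> chord_b (s, t) = 0" by (simp add: chord_n_def chord_b_def frame_inner)
qed

text \<open>
  If \<open>\<gamma> a = \<gamma> c + x tng c\<close>, then the Frenet equations give \<open>x * curvature\<close> and \<open>0\<close> for the derivatives of
  the normal and binormal component of the chord along the tangent point \<open>c\<close>.  The derivative of the binormal
  component along \<open>a\<close> is \<open>- tng a \<bullet> bin c\<close>; it vanishes only if the tangent line at \<open>a\<close> lies in the
  osculating plane at \<open>c\<close>.
\<close>

lemma chord_derivatives:
  assumes hit: "tangent_hits T \<gamma> c a"
    and gen: "\<not> tangent_line \<gamma> a \<subseteq> osculating_plane \<gamma> c"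
  shows "chord_n' a c (0, 1) \<noteq> 0" "chord_b' a c (0, 1) = 0" "chord_b' a c (1, 0) \<noteq> 0"
proof -
  obtain x where x: "\<gamma> a = \<gamma> c + x *\<^sub>R tng c" using hit by (auto simp: tangent_hits_def tangent_line_def)
  have "\<gamma> c \<noteq> \<gamma> a" using hit by (simp add: tangent_hits_def eq_iff)
  then have "x \<noteq> 0" using x by auto
  then show "chord_n' a c (0, 1) \<noteq> 0" using curved[of c] by (simp add: chord_n'_def x frame_inner frenet_tangential)
  show "chord_b' a c (0, 1) = 0" by (simp add: chord_b'_def x frame_inner frenet_tangential)
  show "chord_b' a c (1, 0) \<noteq> 0"
  proof
    assume "chord_b' a c (1, 0) = 0"
    then have "tng a \<bullet> bin c = 0" by (simp add: chord_b'_def)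
    then have e: "tng a = (tng a \<bullet> tng c) *\<^sub>R tng c + (tng a \<bullet> nor c) *\<^sub>R nor c"
      using frame_expansion[of "tng a" c] by simp
    have "\<gamma> a + r *\<^sub>R tng a = \<gamma> c + (x + r * (tng a \<bullet> tng c)) *\<^sub>R tng c +
            (r * (tng a \<bullet> nor c) / norm (acc c)) *\<^sub>R acc c" for r
    proof -
      have "r *\<^sub>R tng a = (r * (tng a \<bullet> tng c)) *\<^sub>R tng c + (r * (tng a \<bullet> nor c)) *\<^sub>R nor c"
        by (subst e) (simp add: scaleR_add_right)
      moreover have "(r * (tng a \<bullet> nor c)) *\<^sub>R nor c = (r * (tng a \<bullet> nor c) / norm (acc c)) *\<^sub>R acc c"
        by (subst (2) principal_normal_def) (simp add: divide_inverse)
      ultimately show ?thesis by (simp add: x scaleR_add_left)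
    qed
    then have "tangent_line \<gamma> a \<subseteq> osculating_plane \<gamma> c"
      unfolding tangent_line_def osculating_plane_def by blast
    with gen show False ..
  qed
qed

section \<open>Isolation of special pairs\<close>

lemma velocity_periodic:
  assumes "[s = t] (rmod T)"
  shows "tng s = tng t"
proof -
  obtain k :: int where k: "t = s + of_int k * T" using assms by (auto simp: rcong_altdef)
  have shift: "\<gamma> (x + of_int k * T) = \<gamma> x" for x
    unfolding eq_iff rcong_altdef by (intro exI[of _ "- k"]) simp
  have "((\<lambda>x. \<gamma> (x + of_int k * T)) has_vector_derivative tng t) (at s)"
  proof -
    have "((\<gamma> \<circ> (\<lambda>x. x + of_int k * T)) has_vector_derivative (1 *\<^sub>R tng t)) (at s)"
      by (rule vector_diff_chain_at) (auto intro!: derivative_eq_intros has_vector_derivative_frame simp: k)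
    then show ?thesis by (simp add: comp_def)
  qed
  then have "(\<gamma> has_vector_derivative tng t) (at s)" by (simp add: shift)
  then show ?thesis using has_vector_derivative_frame(1) vector_derivative_unique_at by blast
qed

lemma tangent_hits_cong:
  assumes "[s = s'] (rmod T)" "[t = t'] (rmod T)"
  shows "tangent_hits T \<gamma> s t \<longleftrightarrow> tangent_hits T \<gamma> s' t'"
proof -
  have "\<gamma> s = \<gamma> s'" "\<gamma> t = \<gamma> t'" using assms by (simp_all add: eq_iff)
  moreover from this have "[s = t] (rmod T) \<longleftrightarrow> [s' = t'] (rmod T)"
    by (simp add: eq_iff[symmetric])
  ultimately show ?thesis
    using velocity_periodic[OF assms(1)] by (simp add: tangent_hits_def tangent_line_def)
qed

lemma flat_dist_le: "flat_dist T s t \<le> \<bar>s - t + of_int k * T\<bar>"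
  unfolding flat_dist_def by (rule cINF_lower) (auto intro!: bdd_belowI[of _ 0])

lemma flat_dist_le_abs:
  assumes "[t = t'] (rmod T)"
  shows "flat_dist T s t' \<le> \<bar>s - t\<bar>"
proof -
  obtain k :: int where "t' = t + of_int k * T" using assms by (auto simp: rcong_altdef)
  then show ?thesis using flat_dist_le[of s t' k] by simp
qed

lemma special_pairs_rmod:
  assumes "special1 T \<gamma> u1 u2 \<or> special2 T \<gamma> u1 u2"
  shows "(u1 rmod T, u2 rmod T) \<in> special_pairs T \<gamma>"
proof -
  have "[u1 rmod T = u1] (rmod T)" "[u2 rmod T = u2] (rmod T)" by (simp_all add: rcong_def)
  from tangent_hits_cong[OF this] tangent_hits_cong[OF this(2,1)] show ?thesis
    using assms T_pos
    by (simp add: special_pairs_def special1_def special2_def rmod_less rmod_nonneg)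
qed

text \<open>
  Points of the square around one special pair lie in the flat square of that pair on the torus.  Another
  special pair in it would lie in two flat squares, which are disjoint; and \<open>\<delta> < T\<close>, so no other lift of the
  same pair lies in the square.
\<close>

lemma special_pair_isolated:
  assumes \<delta>: "admissible_delta T \<gamma> \<delta>"
    and u: "special1 T \<gamma> u1 u2 \<or> special2 T \<gamma> u1 u2"
    and w: "\<bar>w1 - u1\<bar> \<le> \<delta>" "\<bar>w2 - u2\<bar> \<le> \<delta>"
  shows "\<not> [w1 = w2] (rmod T)"
    "special1 T \<gamma> w1 w2 \<or> special2 T \<gamma> w1 w2 \<Longrightarrow> w1 = u1 \<and> w2 = u2"
proof -
  let ?p = "\<lambda>u1 u2. (u1 rmod T, u2 rmod T)"
  have rm: "[x = x rmod T] (rmod T)" for x by (simp add: rcong_def)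
  have up: "?p u1 u2 \<in> special_pairs T \<gamma>" by (rule special_pairs_rmod[OF u])
  have pos: "\<delta> > 0" and disj: "disjoint_family_on (flat_square T \<delta>) (special_pairs T \<gamma>)"
    and diag: "flat_square T \<delta> (?p u1 u2) \<inter> {(s1, s2). flat_dist T s1 s2 \<le> \<delta>} = {}"
    using \<delta> up by (auto simp: admissible_delta_def)
  have self: "(x, y) \<in> flat_square T \<delta> (?p x y)" for x y
    using flat_dist_le_abs[OF rm, of x x] flat_dist_le_abs[OF rm, of y y] pos by (simp add: flat_square_def)
  have wu: "(w1, w2) \<in> flat_square T \<delta> (?p u1 u2)"
    using flat_dist_le_abs[OF rm, of w1 u1] flat_dist_le_abs[OF rm, of w2 u2] w by (simp add: flat_square_def)
  \<comment> \<open>The pair itself is off the diagonal neighbourhood, while flat distances are less than \<open>T\<close>.\<close>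
  have "?p u1 u2 \<in> flat_square T \<delta> (?p u1 u2)"
    using flat_dist_le[of "u1 rmod T" "u1 rmod T" 0] flat_dist_le[of "u2 rmod T" "u2 rmod T" 0] pos
    by (simp add: flat_square_def)
  then have "\<delta> < flat_dist T (u1 rmod T) (u2 rmod T)" using diag by force
  also have "\<dots> \<le> \<bar>u1 rmod T - u2 rmod T\<bar>" using flat_dist_le[of _ _ 0] by simp
  also have "\<dots> < T"
    using rmod_less[OF T_pos, of u1] rmod_less[OF T_pos, of u2] rmod_nonneg[of T u1] rmod_nonneg[of T u2] T_pos
    by auto
  finally have small: "\<delta> < T" .
  show "\<not> [w1 = w2] (rmod T)"
  proof
    assume "[w1 = w2] (rmod T)"
    then have "flat_dist T w1 w2 \<le> \<delta>" using flat_dist_le_abs[of w1 w2 w1] pos by simp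
    then show False using wu diag by blast
  qed
  assume "special1 T \<gamma> w1 w2 \<or> special2 T \<gamma> w1 w2"
  then have "?p w1 w2 \<in> special_pairs T \<gamma>" by (rule special_pairs_rmod)
  then have "?p w1 w2 = ?p u1 u2"
    using disj up self[of w1 w2] wu unfolding disjoint_family_on_def by blast
  then have "[w1 = u1] (rmod T)" "[w2 = u2] (rmod T)" by (simp_all add: rcong_def)
  then show "w1 = u1 \<and> w2 = u2"
    using w small T_pos by (auto intro: rcong_imp_eq)
qed

end

context stratified_circle_constraint
begin

theorem broken_fibration_summary:
  "broken_fibration 3 M \<sigma> height {a1 - \<delta><..<a1 + \<delta>} \<and>
   card {p. critical_point M \<sigma> height p} = 2 \<and>
   {p. critical_point M \<sigma> height p} = {of_coords a1 a2 0 1, of_coords a1 a2 0 (-1)} \<and>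
   (\<forall>p\<in>{p. critical_point M \<sigma> height p}.
      (p \<in> M \<and> g p = 0 \<and> p \<bullet> e1 = a1 \<and> p \<bullet> e2 = a2) \<and> has_morse_index height (stratum M \<sigma> p) p 1)"
proof (intro conjI ballI)
  show "broken_fibration 3 M \<sigma> height {a1 - \<delta><..<a1 + \<delta>}" by (rule broken_fibration_height)
  show crit: "{p. critical_point M \<sigma> height p} = {of_coords a1 a2 0 1, of_coords a1 a2 0 (-1)}"
    by (rule critical_points_height)
  have "of_coords a1 a2 0 1 \<noteq> of_coords a1 a2 0 (-1)"
  proof
    assume "of_coords a1 a2 0 1 = of_coords a1 a2 0 (-1)"
    from arg_cong[OF this, of "\<lambda>x. x \<bullet> e4"] show False by simp
  qed
  then show "card {p. critical_point M \<sigma> height p} = 2" unfolding crit by simp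
next
  fix p assume "p \<in> {p. critical_point M \<sigma> height p}"
  then have p: "p \<in> M" "is_fold p" by (simp_all add: critical_point_iff)
  show "p \<in> M" by (rule p(1))
  show "g p = 0" "p \<bullet> e1 = a1" "p \<bullet> e2 = a2" using fold_simps[OF p(2,1)] by simp_all
  show "has_morse_index height (stratum M \<sigma> p) p 1" by (rule fold_morse_index[OF p])
qed

end

section \<open>The broken fibration near a special pair\<close>

text \<open>
  The component functions of the chord form the planar vector field of the abstract situation.  The first base
  coordinate is the parameter \<open>a\<close> of the free point, the second one the parameter \<open>c\<close> of the point of tangency,
  so an \<open>s\<^sub>1\<close>-special pair is the case in which \<open>c\<close> comes first.
\<close>

lemma (in regular_knot) circle_constraint_at_hit:
  fixes e1 e2 e3 e4 :: "'a::euclidean_space"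
  assumes gen: "generic_knot T \<gamma>" and \<delta>: "admissible_delta T \<gamma> \<delta>" and hit: "tangent_hits T \<gamma> c a"
    and basis: "Basis = {e1, e2, e3, e4}" "distinct [e1, e2, e3, e4]"
  shows "circle_constraint e1 e2 e3 e4 chord_n chord_b (chord_n' a c) (chord_b' a c) a c \<delta>"
proof
  show "Basis = {e1, e2, e3, e4}" "distinct [e1, e2, e3, e4]" by (fact basis)+
  show "0 < \<delta>" using \<delta> by (simp add: admissible_delta_def)
  show "smooth_on chord_n UNIV" "smooth_on chord_b UNIV" by (rule smooth_chord_n, rule smooth_chord_b)
  show "chord_n (a, c) = 0" "chord_b (a, c) = 0"
    using chord_components_zero_iff[of a c] hit by (simp_all add: tangent_hits_def)
  show "(chord_n has_derivative chord_n' a c) (at (a, c))" "(chord_b has_derivative chord_b' a c) (at (a, c))"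
    by (rule has_derivative_chord_n, rule has_derivative_chord_b)
  have "\<not> tangent_line \<gamma> a \<subseteq> osculating_plane \<gamma> c"
    using gen hit by (simp add: generic_knot_def)
  from chord_derivatives[OF hit this]
  show "chord_n' a c (0, 1) \<noteq> 0" "chord_b' a c (0, 1) = 0" "chord_b' a c (1, 0) \<noteq> 0" by this+
  fix s t assume st: "s \<in> {a - \<delta>..a + \<delta>}" "t \<in> {c - \<delta>..c + \<delta>}" "(s, t) \<noteq> (a, c)"
  have special: "special1 T \<gamma> a c \<or> special2 T \<gamma> a c" using hit by (simp add: special2_def)
  have close: "\<bar>s - a\<bar> \<le> \<delta>" "\<bar>t - c\<bar> \<le> \<delta>" using st by auto
  note iso = special_pair_isolated[OF \<delta> special close]
  have "\<not> tangent_hits T \<gamma> t s"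
  proof
    assume "tangent_hits T \<gamma> t s"
    then have "special1 T \<gamma> s t \<or> special2 T \<gamma> s t" by (simp add: special2_def)
    from iso(2)[OF this] st(3) show False by simp
  qed
  then have "\<gamma> s \<notin> tangent_line \<gamma> t"
    using iso(1) rcong_sym_iff[of s t T] by (simp add: tangent_hits_def)
  then show "chord_n (s, t) \<noteq> 0 \<or> chord_b (s, t) \<noteq> 0" using chord_components_zero_iff[of s t] by simp
qed

lemma Basis_real_real_complex:
  "(Basis :: (real \<times> real \<times> complex) set) = {(1, 0, 0), (0, 1, 0), (0, 0, 1), (0, 0, \<i>)}"
  by (auto simp: Basis_prod_def Basis_complex_def zero_prod_def)

lemma norm_complex_eq_1_iff: "norm z = 1 \<longleftrightarrow> (Re z)\<^sup>2 + (Im z)\<^sup>2 - 1 = 0"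
  by (simp add: cmod_def)

lemma base_in_interior_square: "\<delta> > 0 \<Longrightarrow> (a1, a2) \<in> interior (square \<delta> a1 a2)"
  by (simp add: square_def interior_Times)

theorem lemma62:
  fixes T \<delta> :: real and \<gamma> :: "real \<Rightarrow> real^3"
  assumes "generic_knot T \<gamma>" and "admissible_delta T \<gamma> \<delta>"
  shows "(\<forall>a1 a2. special2 T \<gamma> a1 a2 \<longrightarrow>
           (let I = {a1 - \<delta><..<a1 + \<delta>};
                N = N0 (height2 \<gamma>) \<delta> a1 a2;
                \<sigma> = N0_label (height2 \<gamma>) \<delta> a1 a2;
                M = N \<inter> proj_s1 -` I;
                Crit = {p. critical_point M \<sigma> proj_s1 p}
            in broken_fibration 3 M \<sigma> proj_s1 I \<and>
               card Crit = 2 \<and>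
               Crit = {(a1, a2, cis (pi / 2)), (a1, a2, cis (- (pi / 2)))} \<and>
               (\<forall>p\<in>Crit. p \<in> real_boundary (height2 \<gamma>) \<delta> a1 a2 \<and>
                          has_morse_index proj_s1 (stratum M \<sigma> p) p 1)))
       \<and> (\<forall>a1 a2. special1 T \<gamma> a1 a2 \<longrightarrow>
           (let I = {a2 - \<delta><..<a2 + \<delta>};
                N = N0 (height1 \<gamma>) \<delta> a1 a2;
                \<sigma> = N0_label (height1 \<gamma>) \<delta> a1 a2;
                M = N \<inter> proj_s2 -` I;
                Crit = {p. critical_point M \<sigma> proj_s2 p}
            in broken_fibration 3 M \<sigma> proj_s2 I \<and>
               card Crit = 2 \<and>
               Crit = {(a1, a2, cis (pi / 2)), (a1, a2, cis (- (pi / 2)))} \<and>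
               (\<forall>p\<in>Crit. p \<in> real_boundary (height1 \<gamma>) \<delta> a1 a2 \<and>
                          has_morse_index proj_s2 (stratum M \<sigma> p) p 1)))"
proof (intro conjI allI impI)
  interpret regular_knot T \<gamma>
    by standard (use assms(1) in \<open>simp_all add: generic_knot_def\<close>)
  have pos: "\<delta> > 0" using assms(2) by (simp add: admissible_delta_def)
  {
    fix a1 a2 assume "special2 T \<gamma> a1 a2"
    then have hit: "tangent_hits T \<gamma> a2 a1" by (simp add: special2_def)
    interpret C: circle_constraint "(1, 0, 0) :: real \<times> real \<times> complex" "(0, 1, 0)" "(0, 0, 1)" "(0, 0, \<i>)"
      chord_n chord_b "chord_n' a1 a2" "chord_b' a1 a2" a1 a2 \<delta>
      by (rule circle_constraint_at_hit[OF assms hit]) (simp_all add: Basis_real_real_complex)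
    have g: "C.g = height2 \<gamma>"
    proof
      fix x :: "real \<times> real \<times> complex"
      obtain s1 s2 z where x: "x = (s1, s2, z)" by (cases x)
      show "C.g x = height2 \<gamma> x"
        by (simp add: x C.g_def height2_def normal_vector_def chord_n_def chord_b_def inner_add_right)
    qed
    have M: "C.M = N0 (height2 \<gamma>) \<delta> a1 a2 \<inter> proj_s1 -` {a1 - \<delta><..<a1 + \<delta>}" (is "_ = ?M")
    proof (rule set_eqI)
      fix x :: "real \<times> real \<times> complex"
      obtain s1 s2 z where x: "x = (s1, s2, z)" by (cases x)
      show "x \<in> C.M \<longleftrightarrow> x \<in> ?M"
        by (simp add: x C.M_def C.q_def g N0_def square_def proj_s1_def norm_complex_eq_1_iff) auto
    qed
    let ?\<sigma> = "N0_label (height2 \<gamma>) \<delta> a1 a2"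
    interpret S: stratified_circle_constraint "(1, 0, 0) :: real \<times> real \<times> complex" "(0, 1, 0)" "(0, 0, 1)" "(0, 0, \<i>)"
      chord_n chord_b "chord_n' a1 a2" "chord_b' a1 a2" a1 a2 \<delta> ?\<sigma>
    proof
      fix x y assume xy: "x \<in> C.M" "y \<in> C.M"
      obtain s1 s2 z where x: "x = (s1, s2, z)" by (cases x)
      obtain t1 t2 w where y: "y = (t1, t2, w)" by (cases y)
      have "s1 \<noteq> a1 - \<delta>" "s1 \<noteq> a1 + \<delta>" "t1 \<noteq> a1 - \<delta>" "t1 \<noteq> a1 + \<delta>"
        using xy by (simp_all add: C.M_def x y)
      then show "?\<sigma> x = ?\<sigma> y \<longleftrightarrow> (C.g x = 0 \<longleftrightarrow> C.g y = 0) \<and> (C.on_edge x \<longleftrightarrow> C.on_edge y)"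
        by (simp add: x y N0_label_def C.on_edge_def g)
    qed
    have height: "(\<lambda>x. x \<bullet> (1, 0, 0)) = proj_s1"
      by (rule ext) (simp add: proj_s1_def split: prod.split)
    have crit: "C.of_coords a1 a2 0 1 = (a1, a2, cis (pi / 2))" "C.of_coords a1 a2 0 (-1) = (a1, a2, cis (- (pi / 2)))"
      by (simp_all add: C.of_coords_def complex_eq_iff)
    have real_bd: "p \<in> real_boundary (height2 \<gamma>) \<delta> a1 a2"
      if "p \<in> ?M \<and> height2 \<gamma> p = 0 \<and> p \<bullet> (1, 0, 0) = a1 \<and> p \<bullet> (0, 1, 0) = a2" for p
    proof -
      obtain s1 s2 z where p: "p = (s1, s2, z)" by (cases p)
      show ?thesis
        using that base_in_interior_square[OF pos, of a1 a2] by (clarsimp simp: real_boundary_def p)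
    qed
    note sum = S.broken_fibration_summary[unfolded height M g crit]
    show "let I = {a1 - \<delta><..<a1 + \<delta>}; N = N0 (height2 \<gamma>) \<delta> a1 a2; \<sigma> = N0_label (height2 \<gamma>) \<delta> a1 a2;
              M = N \<inter> proj_s1 -` I; Crit = {p. critical_point M \<sigma> proj_s1 p}
          in broken_fibration 3 M \<sigma> proj_s1 I \<and> card Crit = 2 \<and>
             Crit = {(a1, a2, cis (pi / 2)), (a1, a2, cis (- (pi / 2)))} \<and>
             (\<forall>p\<in>Crit. p \<in> real_boundary (height2 \<gamma>) \<delta> a1 a2 \<and> has_morse_index proj_s1 (stratum M \<sigma> p) p 1)"
      unfolding Let_def
    proof (intro conjI ballI sum[THEN conjunct1] sum[THEN conjunct2, THEN conjunct1]
        sum[THEN conjunct2, THEN conjunct2, THEN conjunct1])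
      fix p assume "p \<in> {p. critical_point ?M ?\<sigma> proj_s1 p}"
      note p = bspec[OF sum[THEN conjunct2, THEN conjunct2, THEN conjunct2] this]
      show "p \<in> real_boundary (height2 \<gamma>) \<delta> a1 a2" by (rule real_bd[OF conjunct1[OF p]])
      show "has_morse_index proj_s1 (stratum ?M ?\<sigma> p) p 1" by (rule conjunct2[OF p])
    qed
  }
  {
    fix a1 a2 assume "special1 T \<gamma> a1 a2"
    then have hit: "tangent_hits T \<gamma> a1 a2" by (simp add: special1_def)
    interpret C: circle_constraint "(0, 1, 0) :: real \<times> real \<times> complex" "(1, 0, 0)" "(0, 0, 1)" "(0, 0, \<i>)"
      chord_n chord_b "chord_n' a2 a1" "chord_b' a2 a1" a2 a1 \<delta>
      by (rule circle_constraint_at_hit[OF assms hit]) (auto simp: Basis_real_real_complex)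
    have g: "C.g = height1 \<gamma>"
    proof
      fix x :: "real \<times> real \<times> complex"
      obtain s1 s2 z where x: "x = (s1, s2, z)" by (cases x)
      show "C.g x = height1 \<gamma> x"
        by (simp add: x C.g_def height1_def normal_vector_def chord_n_def chord_b_def inner_add_right)
    qed
    have M: "C.M = N0 (height1 \<gamma>) \<delta> a1 a2 \<inter> proj_s2 -` {a2 - \<delta><..<a2 + \<delta>}" (is "_ = ?M")
    proof (rule set_eqI)
      fix x :: "real \<times> real \<times> complex"
      obtain s1 s2 z where x: "x = (s1, s2, z)" by (cases x)
      show "x \<in> C.M \<longleftrightarrow> x \<in> ?M"
        by (simp add: x C.M_def C.q_def g N0_def square_def proj_s2_def norm_complex_eq_1_iff) auto
    qed
    let ?\<sigma> = "N0_label (height1 \<gamma>) \<delta> a1 a2"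
    interpret S: stratified_circle_constraint "(0, 1, 0) :: real \<times> real \<times> complex" "(1, 0, 0)" "(0, 0, 1)" "(0, 0, \<i>)"
      chord_n chord_b "chord_n' a2 a1" "chord_b' a2 a1" a2 a1 \<delta> ?\<sigma>
    proof
      fix x y assume xy: "x \<in> C.M" "y \<in> C.M"
      obtain s1 s2 z where x: "x = (s1, s2, z)" by (cases x)
      obtain t1 t2 w where y: "y = (t1, t2, w)" by (cases y)
      have "s2 \<noteq> a2 - \<delta>" "s2 \<noteq> a2 + \<delta>" "t2 \<noteq> a2 - \<delta>" "t2 \<noteq> a2 + \<delta>"
        using xy by (simp_all add: C.M_def x y)
      then show "?\<sigma> x = ?\<sigma> y \<longleftrightarrow> (C.g x = 0 \<longleftrightarrow> C.g y = 0) \<and> (C.on_edge x \<longleftrightarrow> C.on_edge y)"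
        by (simp add: x y N0_label_def C.on_edge_def g)
    qed
    have height: "(\<lambda>x. x \<bullet> (0, 1, 0)) = proj_s2"
      by (rule ext) (simp add: proj_s2_def split: prod.split)
    have crit: "C.of_coords a2 a1 0 1 = (a1, a2, cis (pi / 2))" "C.of_coords a2 a1 0 (-1) = (a1, a2, cis (- (pi / 2)))"
      by (simp_all add: C.of_coords_def complex_eq_iff)
    have real_bd: "p \<in> real_boundary (height1 \<gamma>) \<delta> a1 a2"
      if "p \<in> ?M \<and> height1 \<gamma> p = 0 \<and> p \<bullet> (0, 1, 0) = a2 \<and> p \<bullet> (1, 0, 0) = a1" for p
    proof -
      obtain s1 s2 z where p: "p = (s1, s2, z)" by (cases p)
      show ?thesis
        using that base_in_interior_square[OF pos, of a1 a2] by (clarsimp simp: real_boundary_def p)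
    qed
    note sum = S.broken_fibration_summary[unfolded height M g crit]
    show "let I = {a2 - \<delta><..<a2 + \<delta>}; N = N0 (height1 \<gamma>) \<delta> a1 a2; \<sigma> = N0_label (height1 \<gamma>) \<delta> a1 a2;
              M = N \<inter> proj_s2 -` I; Crit = {p. critical_point M \<sigma> proj_s2 p}
          in broken_fibration 3 M \<sigma> proj_s2 I \<and> card Crit = 2 \<and>
             Crit = {(a1, a2, cis (pi / 2)), (a1, a2, cis (- (pi / 2)))} \<and>
             (\<forall>p\<in>Crit. p \<in> real_boundary (height1 \<gamma>) \<delta> a1 a2 \<and> has_morse_index proj_s2 (stratum M \<sigma> p) p 1)"
      unfolding Let_def
    proof (intro conjI ballI sum[THEN conjunct1] sum[THEN conjunct2, THEN conjunct1]
        sum[THEN conjunct2, THEN conjunct2, THEN conjunct1])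
      fix p assume "p \<in> {p. critical_point ?M ?\<sigma> proj_s2 p}"
      note p = bspec[OF sum[THEN conjunct2, THEN conjunct2, THEN conjunct2] this]
      show "p \<in> real_boundary (height1 \<gamma>) \<delta> a1 a2" by (rule real_bd[OF conjunct1[OF p]])
      show "has_morse_index proj_s2 (stratum ?M ?\<sigma> p) p 1" by (rule conjunct2[OF p])
    qed
  }
qed

end
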